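(* Let $G$ be a finite non-cyclic group and let $p$ be the smallest prime divisor of $|G|$. Then $$\mathsf D(G)\leq \frac{2}{p}|G|.$$
   Context: A sequence over a finite group $G$ is a finite unordered list of elements of $G$ with repetition allowed; its length is its number of terms with multiplicity. It is product-one if its terms can be ordered so that their product is the identity. A minimal product-one sequence is a nonempty product-one sequence that cannot be partitioned into two nonempty product-one subsequences. $\mathsf D(G)$ (the large Davenport constant) is the maximal length of a minimal product-one sequence over $G$. *)

theory Defs
  imports
    Complex_Main
    "HOL-Algebra.Elementary_Groups"
    "HOL-Library.Multiset"
    "HOL-Computational_Algebra.Primes"
begin

definition product_one :: "('a, 'b) monoid_scheme \<Rightarrow> 'a multiset \<Rightarrow> bool" where
  "product_one G S \<longleftrightarrow> set_mset S \<subseteq> carrier G \<and>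
     (\<exists>xs. mset xs = S \<and> foldr (\<otimes>\<^bsub>G\<^esub>) xs \<one>\<^bsub>G\<^esub> = \<one>\<^bsub>G\<^esub>)"

definition minimal_product_one :: "('a, 'b) monoid_scheme \<Rightarrow> 'a multiset \<Rightarrow> bool" where
  "minimal_product_one G S \<longleftrightarrow> S \<noteq> {#} \<and> product_one G S \<and>
     \<not> (\<exists>T U. S = T + U \<and> T \<noteq> {#} \<and> U \<noteq> {#} \<and> product_one G T \<and> product_one G U)"

(* For a finite group the maximum is attained: see minimal_product_one_sizes. *)
definition large_davenport :: "('a, 'b) monoid_scheme \<Rightarrow> nat" where
  "large_davenport G = Max {size S | S. minimal_product_one G S}"

context group
begin

lemma foldr_mult_closed:
  "set xs \<subseteq> carrier G \<Longrightarrow> foldr (\<otimes>) xs \<one> \<in> carrier G"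
  by (induction xs) auto

lemma foldr_mult_append:
  "set xs \<subseteq> carrier G \<Longrightarrow> set ys \<subseteq> carrier G \<Longrightarrow>
     foldr (\<otimes>) (xs @ ys) \<one> = foldr (\<otimes>) xs \<one> \<otimes> foldr (\<otimes>) ys \<one>"
  by (induction xs) (auto simp: m_assoc foldr_mult_closed simp del: foldr_append)

lemma product_oneI:
  "set xs \<subseteq> carrier G \<Longrightarrow> foldr (\<otimes>) xs \<one> = \<one> \<Longrightarrow> product_one G (mset xs)"
  unfolding product_one_def by (intro conjI exI[of _ xs]) simp_all

lemma minimal_product_one_size_le:
  assumes "finite (carrier G)" "minimal_product_one G S"
  shows "size S \<le> order G"
proof (rule ccontr)
  assume big: "\<not> size S \<le> order G"
  from assms(2) obtain xs where xs: "mset xs = S" "foldr (\<otimes>) xs \<one> = \<one>"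
    and carr: "set xs \<subseteq> carrier G"
    unfolding minimal_product_one_def product_one_def by auto
  let ?P = "\<lambda>i. foldr (\<otimes>) (take i xs) \<one>"
  have "?P ` {..<length xs} \<subseteq> carrier G"
    by (intro image_subsetI foldr_mult_closed subset_trans[OF set_take_subset carr])
  then have "card (?P ` {..<length xs}) \<le> order G"
    unfolding order_def using assms(1) by (rule card_mono[rotated])
  moreover have "order G < card {..<length xs}"
    using big xs(1) by auto
  ultimately have "\<not> inj_on ?P {..<length xs}"
    by (intro pigeonhole) simp
  then obtain k l where kl: "k < length xs" "l < length xs" "?P k = ?P l" "k \<noteq> l"
    unfolding inj_on_def by blast
  obtain i j where ij: "i < j" "j < length xs" "?P i = ?P j"
    using kl(4) by (rule linorder_neqE_nat) (use kl(1-3) that in metis)+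
  define as where "as = take i xs"
  define bs where "bs = drop i (take j xs)"
  define cs where "cs = drop j xs"
  have ab: "take j xs = as @ bs"
    unfolding as_def bs_def using ij(1)
    by (metis append_take_drop_id less_imp_le_nat min.absorb1 take_take)
  have abc: "xs = as @ bs @ cs"
    unfolding cs_def by (metis ab append.assoc append_take_drop_id)
  have carrs: "set as \<subseteq> carrier G" "set bs \<subseteq> carrier G" "set cs \<subseteq> carrier G"
    using carr abc by auto
  note closed = carrs[THEN foldr_mult_closed]
  have "foldr (\<otimes>) as \<one> = foldr (\<otimes>) as \<one> \<otimes> foldr (\<otimes>) bs \<one>"
    using trans[OF ij(3)[folded as_def, unfolded ab] foldr_mult_append[OF carrs(1,2)]] .
  then have b1: "foldr (\<otimes>) bs \<one> = \<one>"
    using closed(1,2) l_cancel_one' by blast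
  have "foldr (\<otimes>) xs \<one> = foldr (\<otimes>) as \<one> \<otimes> (foldr (\<otimes>) bs \<one> \<otimes> foldr (\<otimes>) cs \<one>)"
    unfolding abc using carrs by (simp add: foldr_mult_append del: foldr_append)
  then have ac1: "foldr (\<otimes>) (as @ cs) \<one> = \<one>"
    using xs(2) b1 closed foldr_mult_append[OF carrs(1,3)] by simp
  have "product_one G (mset bs)" "product_one G (mset (as @ cs))"
    by (rule product_oneI; use b1 ac1 carrs in \<open>simp del: foldr_append\<close>)+
  moreover have "S = mset bs + mset (as @ cs)"
    using xs(1) abc by (simp add: union_lcomm)
  moreover have "mset bs \<noteq> {#}" "mset (as @ cs) \<noteq> {#}"
    using ij(1,2) unfolding bs_def cs_def by auto
  ultimately have "\<exists>T U. S = T + U \<and> T \<noteq> {#} \<and> U \<noteq> {#} \<and> product_one G T \<and> product_one G U"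
    by (intro exI[of _ "mset bs"] exI[of _ "mset (as @ cs)"] conjI)
  with assms(2) show False
    unfolding minimal_product_one_def by (elim conjE notE)
qed

lemma minimal_product_one_sizes:
  assumes "finite (carrier G)"
  shows "finite {size S | S. minimal_product_one G S}"
    and "{size S | S. minimal_product_one G S} \<noteq> {}"
proof -
  show "finite {size S | S. minimal_product_one G S}"
    using minimal_product_one_size_le[OF assms]
    by (auto intro: finite_subset[OF _ finite_atMost[of "order G"]])
  have "product_one G {#\<one>#}"
    using product_oneI[of "[\<one>]"] by simp
  moreover have "T = {#} \<or> U = {#}" if "{#\<one>#} = T + U" for T U
    using that union_is_single[of T U "\<one>"] by metis
  moreover have "{#\<one>#} \<noteq> {#}" by simp
  ultimately have "minimal_product_one G {#\<one>#}"
    unfolding minimal_product_one_def by blast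
  then show "{size S | S. minimal_product_one G S} \<noteq> {}" by blast
qed

end

end

theory Submission
  imports Defs "HOL-Number_Theory.Residues" "HOL-Algebra.Multiplicative_Group"
begin

text \<open>
  For \<open>p = 2\<close> the bound is \<open>size S \<le> order G\<close>. Let \<open>|G|\<close> be odd. If every minimal product-one sequence
  over a subgroup \<open>H\<close> has length at most \<open>N\<close>, then every one over \<open>G\<close> has length at most \<open>N |G : H|\<close>, because
  prefix products in a common coset of \<open>H\<close> cut a sequence into blocks with product in \<open>H\<close>. So it is
  enough to find a subgroup with \<open>N \<le> 2 |H| / r\<close> for a prime divisor \<open>r\<close> of \<open>|G|\<close>.

  A minimal noncyclic subgroup contains either two independent commuting elements of prime order \<open>r\<close>,
  where Olson's theorem gives \<open>N \<le> 2 r\<close> and \<open>|H| = r\<^sup>2\<close>, or an element \<open>a\<close> of prime order \<open>q\<close> and an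
  element \<open>b\<close> of order \<open>r\<^bsup>k+1\<^esup>\<close> that acts on \<open>\<langle>a\<rangle>\<close> with prime order \<open>r\<close>. Then \<open>|H| = q r\<^bsup>k+1\<^esup>\<close> and
  \<open>N \<le> 2 q r\<^sup>k\<close> follows from the case of order \<open>q r\<close> by a pigeonhole argument on the exponents of \<open>b\<close>.

  In the group of affine maps of order \<open>q r\<close>, a product-one sequence \<open>S\<close> of length at least \<open>2 q + 1\<close>
  splits as soon as it contains a product-one subsequence \<open>V\<close> and, disjoint from it, terms whose
  reorderings have products with all \<open>q\<close> translation parts. By the Cauchy-Davenport theorem
  and a sharpening of it, \<open>(q + 1) / 2\<close> disjoint noncommuting pairs are such terms; the cases without so
  many pairs outside \<open>V\<close> are dominated by one class of commuting terms.
\<close>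

section \<open>Residues modulo a prime\<close>

text \<open>The budget of \<open>2 * q + 1\<close> terms is spent exactly: any \<open>q\<close>
  terms whose exponents sum to a multiple of \<open>p\<close> contain a product-one
  \<open>V\<close>, and the remaining \<open>q + 1\<close> terms are just enough for
  \<open>(q + 1) / 2\<close> pairs. Cauchy-Davenport alone gains one residue per noncommuting pair
  and would need about twice as many pairs. So a pair has to gain two residues;
  \<open>pair_growth\<close> provides this while at least two and at most \<open>q - 3\<close>
  residues are present. Its proof must exclude the multipliers 1 and -1. A power of \<open>s\<close>
  is never -1 because \<open>p\<close> is odd; and if the linear parts of a pair are inverse to each
  other, the two terms are placed on opposite sides of the word instead of together. In the final
  bound the prime \<open>r\<close> attached to the subgroup may differ from \<open>p\<close>: every
  prime divisor of the group order is at least \<open>p\<close>, so \<open>2 / r\<close> is at most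
  \<open>2 / p\<close>.\<close>

definition nres :: "nat \<Rightarrow> int set \<Rightarrow> nat" where
  "nres m A = card ((\<lambda>x. x mod int m) ` A)"

lemma finite_residues: "m > 0 \<Longrightarrow> finite ((\<lambda>x. x mod int m) ` A)"
  by (rule finite_subset[of _ "{0..<int m}"]) auto

lemma nres_le: "m > 0 \<Longrightarrow> nres m A \<le> m"
proof -
  assume "m > 0"
  then have "(\<lambda>x. x mod int m) ` A \<subseteq> {0..<int m}" by auto
  then show ?thesis unfolding nres_def using card_mono[of "{0..<int m}"] by fastforce
qed

lemma nres_mono_cong:
  assumes "m > 0" "\<And>x. x \<in> A \<Longrightarrow> \<exists>y\<in>B. [x = y] (mod int m)"
  shows "nres m A \<le> nres m B"
  unfolding nres_def
proof (rule card_mono)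
  show "finite ((\<lambda>x. x mod int m) ` B)" using assms(1) by (rule finite_residues)
  show "(\<lambda>x. x mod int m) ` A \<subseteq> (\<lambda>x. x mod int m) ` B"
    using assms(2) by (fastforce simp: cong_def)
qed

lemma nres_mono: "m > 0 \<Longrightarrow> A \<subseteq> B \<Longrightarrow> nres m A \<le> nres m B"
  by (rule nres_mono_cong) (meson cong_refl subsetD)+

lemma nres_pos: "m > 0 \<Longrightarrow> A \<noteq> {} \<Longrightarrow> nres m A \<ge> 1"
  unfolding nres_def by (metis One_nat_def Suc_leI card_gt_0_iff finite_residues image_is_empty)

lemma nres_singleton [simp]: "nres m {a} = 1"
  unfolding nres_def by simp

lemma nres_affine:
  assumes "m > 0" "coprime c (int m)"
  shows "nres m ((\<lambda>x. c * x + d) ` A) = nres m A"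
proof -
  have "(\<lambda>x. x mod int m) ` (\<lambda>x. c * x + d) ` A
      = (\<lambda>y. (c * y + d) mod int m) ` (\<lambda>x. x mod int m) ` A"
    unfolding image_image by (rule image_cong) (auto simp: mod_add_left_eq mod_mult_right_eq intro: mod_add_cong)
  moreover have "inj_on (\<lambda>y. (c * y + d) mod int m) ((\<lambda>x. x mod int m) ` A)"
  proof (rule inj_onI, elim imageE)
    fix y y' x x' assume yy: "(c * y + d) mod int m = (c * y' + d) mod int m"
      "y = x mod int m" "y' = x' mod int m"
    from yy(1) have "[c * y + d = c * y' + d] (mod int m)" by (simp only: cong_def)
    then have "[c * y = c * y'] (mod int m)" by (simp only: cong_add_rcancel)
    then have "[y = y'] (mod int m)"
      using assms(2) by (simp only: cong_mult_lcancel)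
    then show "y = y'" using yy by (simp add: cong_def)
  qed
  ultimately show ?thesis unfolding nres_def by (simp add: card_image)
qed

lemma nres_translate: "m > 0 \<Longrightarrow> nres m ((\<lambda>x. x + d) ` A) = nres m A"
  using nres_affine[of m 1 d A] by simp

lemma nres_full_obtain:
  assumes "m > 0" "nres m A = m"
  obtains x where "x \<in> A" "[x = r] (mod int m)"
proof -
  have "(\<lambda>x. x mod int m) ` A = {0..<int m}"
    by (rule card_subset_eq) (use assms in \<open>auto simp: nres_def\<close>)
  then have "r mod int m \<in> (\<lambda>x. x mod int m) ` A" using assms(1) by simp
  then show thesis using that by (auto simp: cong_def)
qed

lemma nres_two:
  assumes "\<not> [a = b] (mod int m)"
  shows "nres m {a, b} = 2"
  using assms unfolding nres_def by (auto simp: cong_def card_insert_if)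

lemma nres_three:
  assumes "\<not> [a = b] (mod int m)" "\<not> [a = c] (mod int m)" "\<not> [b = c] (mod int m)"
  shows "nres m {a, b, c} = 3"
  using assms unfolding nres_def by (auto simp: cong_def card_insert_if)

lemma nres_less_insert:
  assumes "m > 0" "\<And>x. x \<in> A \<Longrightarrow> \<not> [x = b] (mod int m)"
  shows "nres m (insert b A) = Suc (nres m A)"
proof -
  have "b mod int m \<notin> (\<lambda>x. x mod int m) ` A"
  proof
    assume "b mod int m \<in> (\<lambda>x. x mod int m) ` A"
    then obtain x where x: "x \<in> A" "b mod int m = x mod int m" by blast
    then show False using assms(2)[OF x(1)] by (simp add: cong_def)
  qed
  then show ?thesis using finite_residues[OF assms(1)] unfolding nres_def by simp
qed

section \<open>Sumsets modulo a prime\<close>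

text \<open>A nonzero \<open>d\<close> generates the residues modulo the prime \<open>q\<close>: the
  multiple \<open>k * d\<close> with \<open>k = (y - x0) / d\<close> leads from \<open>x0\<close> to
  any \<open>y\<close>.\<close>

lemma residues_closed_shift:
  assumes q: "prime q" and A: "A \<subseteq> {0..<int q}" "A \<noteq> {}"
    and d: "\<not> [d = 0] (mod int q)" and cl: "\<And>x. x \<in> A \<Longrightarrow> (x + d) mod int q \<in> A"
  shows "A = {0..<int q}"
proof
  obtain x0 where x0: "x0 \<in> A" using A(2) by blast
  have *: "(x0 + int k * d) mod int q \<in> A" for k
  proof (induction k)
    case 0 then show ?case using x0 A(1) by auto
  next
    case (Suc k)
    from cl[OF this] show ?case by (simp add: mod_simps algebra_simps)
  qed
  show "{0..<int q} \<subseteq> A"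
  proof
    fix y assume y: "y \<in> {0..<int q}"
    have "coprime d (int q)"
      using d q by (metis cong_0_iff coprime_commute prime_imp_coprime prime_nat_int_transfer)
    then obtain e where e: "[d * e = 1] (mod int q)" using cong_solve_coprime_int by blast
    define k where "k = nat ((e * (y - x0)) mod int q)"
    have "int k = (e * (y - x0)) mod int q" using q prime_gt_0_nat[OF q] unfolding k_def by simp
    then have "[int k = e * (y - x0)] (mod int q)" by (simp add: cong_def)
    then have "[x0 + int k * d = x0 + (e * (y - x0)) * d] (mod int q)"
      by (intro cong_add cong_mult) auto
    also have "x0 + (e * (y - x0)) * d = x0 + (d * e) * (y - x0)" by (simp add: algebra_simps)
    also have "[x0 + (d * e) * (y - x0) = x0 + 1 * (y - x0)] (mod int q)"
      using e by (intro cong_add cong_mult) auto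
    finally have "(x0 + int k * d) mod int q = y mod int q" by (simp add: cong_def)
    then show "y \<in> A" using *[of k] y by simp
  qed
qed (rule A)

text \<open>Induction on \<open>card B\<close> by the Dyson transform: the elements \<open>y\<close>
  of \<open>B\<close> with \<open>e + y\<close> outside \<open>A\<close> are moved to
  \<open>A\<close> as \<open>e + y\<close>. The sum of the cardinalities is kept, and no new sums
  arise, since \<open>(e + y) + b = (e + b) + y\<close> with \<open>e + b\<close> in
  \<open>A\<close> for \<open>b\<close> in \<open>B'\<close>.\<close>

lemma cauchy_davenport_residues:
  assumes q: "prime q"
  shows "A \<subseteq> {0..<int q} \<Longrightarrow> B \<subseteq> {0..<int q} \<Longrightarrow> A \<noteq> {} \<Longrightarrow> B \<noteq> {} \<Longrightarrow>
    min q (card A + card B - 1) \<le> card ((\<lambda>(a, b). (a + b) mod int q) ` (A \<times> B))"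
proof (induction "card B" arbitrary: A B rule: less_induct)
  case less
  let ?S = "\<lambda>A B. (\<lambda>(a, b). (a + b) mod int q) ` (A \<times> B)"
  have q0: "q > 0" using q prime_gt_0_nat by blast
  have fin: "finite A" "finite B" using less.prems finite_subset by auto
  have inj: "inj_on (\<lambda>x. (e + x) mod int q) C" if "C \<subseteq> {0..<int q}" for C e
  proof (rule inj_onI)
    fix x y assume xy: "x \<in> C" "y \<in> C" "(e + x) mod int q = (e + y) mod int q"
    then have "[x = y] (mod int q)" by (metis cong_def cong_add_lcancel)
    moreover have "0 \<le> x" "x < int q" "0 \<le> y" "y < int q" using xy that by auto
    ultimately show "x = y" by (simp add: cong_def)
  qed
  obtain y0 where y0: "y0 \<in> B" using less.prems by blast
  have sub: "(\<lambda>x. (y0 + x) mod int q) ` A \<subseteq> ?S A B"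
    using y0 by (force simp: add.commute)
  have geA: "card A \<le> card (?S A B)"
    using card_mono[OF _ sub] card_image[OF inj[OF less.prems(1), of y0]] fin by simp
  show ?case
  proof (cases "A = {0..<int q} \<or> B = {y0}")
    case True
    then show ?thesis using geA by auto
  next
    case False
    then obtain y1 where y1: "y1 \<in> B" "y1 \<noteq> y0" using y0 by blast
    have "\<not> [y1 - y0 = 0] (mod int q)"
    proof
      assume "[y1 - y0 = 0] (mod int q)"
      then have "[y1 = y0] (mod int q)" by (simp add: cong_diff_iff_cong_0)
      moreover have "0 \<le> y0" "y0 < int q" "0 \<le> y1" "y1 < int q"
        using y0 y1 less.prems(2) by auto
      ultimately show False using y1(2) by (simp add: cong_def)
    qed
    \<comment> \<open>\<open>A\<close> is not closed under the shift by \<open>y1 - y0\<close>. A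
      point \<open>x\<close> where it leaves \<open>A\<close> gives an \<open>e\<close> with
      \<open>e + y0\<close> in \<open>A\<close> and \<open>e + y1\<close> outside, so
      \<open>B'\<close> is nonempty and smaller than \<open>B\<close>.\<close>
    then obtain x where x: "x \<in> A" "(x + (y1 - y0)) mod int q \<notin> A"
      using residues_closed_shift[OF q less.prems(1,3)] False by blast
    define e where "e = x - y0"
    define A' where "A' = A \<union> (\<lambda>y. (e + y) mod int q) ` B"
    define B' where "B' = {y \<in> B. (e + y) mod int q \<in> A}"
    have B': "B' \<subseteq> B" "y0 \<in> B'" "y1 \<notin> B'"
      using x y0 less.prems(1) unfolding B'_def e_def by (auto simp: algebra_simps)
    then have lt: "card B' < card B" using y1 fin by (intro psubset_card_mono) auto
    have A': "A' \<subseteq> {0..<int q}" "A' \<noteq> {}" using less.prems q0 unfolding A'_def by auto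
    have "A' = A \<union> (\<lambda>y. (e + y) mod int q) ` (B - B')"
      unfolding A'_def B'_def by auto
    moreover have "A \<inter> (\<lambda>y. (e + y) mod int q) ` (B - B') = {}" unfolding B'_def by auto
    ultimately have "card A' = card A + card ((\<lambda>y. (e + y) mod int q) ` (B - B'))"
      using fin by (simp add: card_Un_disjoint)
    also have "card ((\<lambda>y. (e + y) mod int q) ` (B - B')) = card (B - B')"
      using less.prems by (intro card_image inj) auto
    also have "card (B - B') = card B - card B'"
      using B' fin finite_subset by (metis card_Diff_subset)
    finally have cards: "card A' + card B' = card A + card B"
      using lt by simp
    have "?S A' B' \<subseteq> ?S A B"
    proof (rule image_subsetI, clarify)
      fix a b assume ab: "a \<in> A'" "b \<in> B'"
      show "(a + b) mod int q \<in> ?S A B"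
      proof (cases "a \<in> A")
        case True then show ?thesis using ab B' by auto
      next
        case F: False
        then obtain y where y: "y \<in> B" "a = (e + y) mod int q" using ab unfolding A'_def by auto
        have "(a + b) mod int q = ((e + b) mod int q + y) mod int q"
          unfolding y by (simp add: mod_simps algebra_simps)
        then show ?thesis using ab y unfolding B'_def by auto
      qed
    qed
    then have "card (?S A' B') \<le> card (?S A B)" using fin by (intro card_mono) auto
    moreover have "min q (card A' + card B' - 1) \<le> card (?S A' B')"
      using less.hyps[OF lt A'(1) _ A'(2)] B' less.prems by auto
    ultimately show ?thesis using cards by simp
  qed
qed

text \<open>The form used throughout: \<open>C\<close> has to contain each sum only up to
  congruence, so sets of integer values of words can be used without reduction.\<close>

lemma cauchy_davenport:
  assumes q: "prime q" and "A \<noteq> {}" "B \<noteq> {}"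
    and C: "\<And>a b. a \<in> A \<Longrightarrow> b \<in> B \<Longrightarrow> \<exists>c\<in>C. [a + b = c] (mod int q)"
  shows "min q (nres q A + nres q B - 1) \<le> nres q C"
proof -
  let ?r = "\<lambda>x. x mod int q"
  have q0: "q > 0" using q prime_gt_0_nat by blast
  have "min q (card (?r ` A) + card (?r ` B) - 1)
    \<le> card ((\<lambda>(a, b). (a + b) mod int q) ` (?r ` A \<times> ?r ` B))"
    using assms q0 by (intro cauchy_davenport_residues) auto
  also have "\<dots> \<le> card (?r ` C)"
  proof (rule card_mono[OF finite_residues[OF q0]], rule image_subsetI, clarify)
    fix a b assume "a \<in> A" "b \<in> B"
    then obtain c where "c \<in> C" "[a + b = c] (mod int q)" using C by blast
    then show "(a mod int q + b mod int q) mod int q \<in> ?r ` C"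
      by (auto simp: mod_simps cong_def)
  qed
  finally show ?thesis unfolding nres_def .
qed

lemma nres_pigeonhole:
  assumes "m > 0" "nres m A + nres m B > m"
  obtains a b where "a \<in> A" "b \<in> B" "[a = b] (mod int m)"
proof -
  have "(\<lambda>x. x mod int m) ` A \<inter> (\<lambda>x. x mod int m) ` B \<noteq> {}"
  proof
    assume d: "(\<lambda>x. x mod int m) ` A \<inter> (\<lambda>x. x mod int m) ` B = {}"
    have "nres m A + nres m B = card ((\<lambda>x. x mod int m) ` A \<union> (\<lambda>x. x mod int m) ` B)"
      unfolding nres_def using card_Un_disjoint[OF _ _ d] finite_residues[OF assms(1)] by simp
    also have "\<dots> = nres m (A \<union> B)" by (simp add: nres_def image_Un)
    finally show False using assms nres_le[OF assms(1), of "A \<union> B"] by simp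
  qed
  then show thesis using that by (auto simp: cong_def)
qed

section \<open>Progressions and their dilates\<close>

text \<open>If \<open>k\<close> is at most \<open>q - L\<close>, the last two points leave the
  interval at the top; otherwise the points sent to \<open>q - 2\<close> and \<open>q - 1\<close>
  lie in the interval and leave it. \<open>interval_shift_three\<close> repeats this with three
  points.\<close>

lemma interval_shift_two:
  fixes q L k :: int
  assumes "2 \<le> L" "L \<le> q - 2" "2 \<le> k" "k \<le> q - 2"
  shows "2 \<le> card {i \<in> {0..<L}. (i + k) mod q \<notin> {0..<L}}"
proof -
  have "\<exists>i. {i, i + 1} \<subseteq> {i \<in> {0..<L}. (i + k) mod q \<notin> {0..<L}}"
  proof (cases "k \<le> q - L")
    case True
    have "L - 2 + k < q" "L - 1 + k < q" using True by auto
    then show ?thesis using assms by (intro exI[of _ "L - 2"]) auto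
  next
    case False
    have "(q - 2) mod q = q - 2" "(q - 1) mod q = q - 1"
      by (rule mod_pos_pos_trivial; use assms in linarith)+
    moreover have "q - 2 - k + k = q - 2" "q - 2 - k + 1 + k = q - 1" by simp_all
    ultimately have "(q - 2 - k + k) mod q \<notin> {0..<L}" "(q - 2 - k + 1 + k) mod q \<notin> {0..<L}"
      using assms by simp_all
    then show ?thesis using assms False by (intro exI[of _ "q - 2 - k"]) simp
  qed
  then obtain i where "{i, i + 1} \<subseteq> {i \<in> {0..<L}. (i + k) mod q \<notin> {0..<L}}" by blast
  then have "card {i, i + 1} \<le> card {i \<in> {0..<L}. (i + k) mod q \<notin> {0..<L}}"
    by (rule card_mono[rotated]) (rule finite_subset[of _ "{0..<L}"], auto)
  then show ?thesis by simp
qed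

lemma interval_shift_three:
  fixes q L k :: int
  assumes "3 \<le> L" "L \<le> q - 3" "3 \<le> k" "k \<le> q - 3"
  shows "3 \<le> card {i \<in> {0..<L}. (i + k) mod q \<notin> {0..<L}}"
proof -
  have "\<exists>i. {i, i + 1, i + 2} \<subseteq> {i \<in> {0..<L}. (i + k) mod q \<notin> {0..<L}}"
  proof (cases "k \<le> q - L")
    case True
    have "L - 3 + k < q" "L - 2 + k < q" "L - 1 + k < q" using True by auto
    then show ?thesis using assms by (intro exI[of _ "L - 3"]) auto
  next
    case False
    have "(q - 3) mod q = q - 3" "(q - 2) mod q = q - 2" "(q - 1) mod q = q - 1"
      by (rule mod_pos_pos_trivial; use assms in linarith)+
    moreover have "q - 3 - k + k = q - 3" "q - 3 - k + 1 + k = q - 2" "q - 3 - k + 2 + k = q - 1"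
      by simp_all
    ultimately have "(q - 3 - k + k) mod q \<notin> {0..<L}" "(q - 3 - k + 1 + k) mod q \<notin> {0..<L}"
      "(q - 3 - k + 2 + k) mod q \<notin> {0..<L}"
      using assms by simp_all
    then show ?thesis using assms False by (intro exI[of _ "q - 3 - k"]) simp
  qed
  then obtain i where "{i, i + 1, i + 2} \<subseteq> {i \<in> {0..<L}. (i + k) mod q \<notin> {0..<L}}" by blast
  then have "card {i, i + 1, i + 2} \<le> card {i \<in> {0..<L}. (i + k) mod q \<notin> {0..<L}}"
    by (rule card_mono[rotated]) (rule finite_subset[of _ "{0..<L}"], auto)
  then show ?thesis by simp
qed

lemma prime_inverse_mod:
  assumes "prime q" "\<not> [d = 0] (mod int q)"
  obtains d' where "[d * d' = 1] (mod int q)"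
proof -
  have "coprime d (int q)"
    using assms by (metis cong_0_iff coprime_commute prime_imp_coprime prime_nat_int_transfer)
  then show thesis using cong_solve_coprime_int that by blast
qed

lemma prime_mult_not_cong_0:
  assumes "prime q" "\<not> [a = 0] (mod int q)" "\<not> [b = 0] (mod int q)"
  shows "\<not> [a * b = 0] (mod int q)"
  using assms by (simp add: cong_0_iff prime_dvd_mult_iff)

lemma inj_on_affine_mod:
  assumes q: "prime q" and e: "\<not> [e = 0] (mod int q)" and C: "C \<subseteq> {0..<int q}"
  shows "inj_on (\<lambda>i. (e * i + b) mod int q) C"
proof (rule inj_onI)
  fix x y assume xy: "x \<in> C" "y \<in> C" "(e * x + b) mod int q = (e * y + b) mod int q"
  then have "[e * x + b = e * y + b] (mod int q)" by (simp only: cong_def)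
  then have "[e * x = e * y] (mod int q)" by (simp only: cong_add_rcancel)
  moreover have "coprime e (int q)"
    using q e by (metis cong_0_iff coprime_commute prime_imp_coprime prime_nat_int_transfer)
  ultimately have "[x = y] (mod int q)" by (simp only: cong_mult_lcancel)
  moreover have "0 \<le> x" "x < int q" "0 \<le> y" "y < int q" using xy C by auto
  ultimately show "x = y" by (simp add: cong_def)
qed

text \<open>A proper nonempty set is not closed under the shift, so exactly one point
  \<open>x1\<close> leaves. Walking back from it in steps of \<open>d\<close> until \<open>X\<close>
  is left for the first time yields a chain \<open>C\<close>; what remains of \<open>X\<close> would
  be closed under the shift and is therefore empty.\<close>

lemma progression_of_small_shift:
  assumes q: "prime q" and X: "X \<subseteq> {0..<int q}" "X \<noteq> {}" "card X < q"
    and d: "\<not> [d = 0] (mod int q)" and c: "card {x \<in> X. (x + d) mod int q \<notin> X} \<le> 1"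
  shows "\<exists>x0. X = (\<lambda>i. (x0 + i * d) mod int q) ` {0..<int (card X)}"
proof -
  have finX: "finite X" using X(1) finite_subset by blast
  have q0: "int q > 0" using q prime_gt_0_nat by simp
  have nfull: "X \<noteq> {0..<int q}" using X(3) by auto
  obtain x1 where x1: "x1 \<in> X" "(x1 + d) mod int q \<notin> X"
    using residues_closed_shift[OF q X(1,2) d] nfull by blast
  have uniq: "x = x1" if "x \<in> X" "(x + d) mod int q \<notin> X" for x
  proof (rule ccontr)
    assume "x \<noteq> x1"
    then have "card {x, x1} = 2" by simp
    moreover have "card {x, x1} \<le> card {x \<in> X. (x + d) mod int q \<notin> X}"
      using finX x1 that by (intro card_mono) auto
    ultimately show False using c by simp
  qed
  have "\<not> [- d = 0] (mod int q)" using d by (simp add: cong_0_iff)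
  define P where "P = (\<lambda>i::nat. (x1 - int i * d) mod int q \<notin> X)"
  have "\<exists>i. P i"
  proof (rule ccontr)
    assume n: "\<not> (\<exists>i. P i)"
    have "(x - d) mod int q \<in> (\<lambda>i. (x1 - int i * d) mod int q) ` UNIV"
      if x: "x \<in> (\<lambda>i. (x1 - int i * d) mod int q) ` UNIV" for x
    proof -
      obtain i where "x = (x1 - int i * d) mod int q" using x by blast
      then have "(x - d) mod int q = (x1 - int (Suc i) * d) mod int q"
        by (simp add: mod_simps algebra_simps)
      then show ?thesis by blast
    qed
    then have "(\<lambda>i. (x1 - int i * d) mod int q) ` UNIV = {0..<int q}"
      using q0 by (intro residues_closed_shift[OF q _ _ \<open>\<not> [- d = 0] (mod int q)\<close>]) auto
    moreover have "(\<lambda>i. (x1 - int i * d) mod int q) ` UNIV \<subseteq> X" using n unfolding P_def by auto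
    ultimately show False using nfull X(1) by blast
  qed
  define L where "L = (LEAST i. P i)"
  have PL: "(x1 - int L * d) mod int q \<notin> X" and
    lL: "\<And>i. i < L \<Longrightarrow> (x1 - int i * d) mod int q \<in> X"
    using LeastI_ex[OF \<open>\<exists>i. P i\<close>] not_less_Least[of _ P] unfolding L_def P_def by auto
  have L0: "L > 0" using PL x1 X(1) by (cases L) auto
  define C where "C = (\<lambda>i. (x1 - int i * d) mod int q) ` {..<L}"
  have CX: "C \<subseteq> X" unfolding C_def using lL by auto
  have "X - C = {}"
  proof (rule ccontr)
    assume ne: "X - C \<noteq> {}"
    have "(x + d) mod int q \<in> X - C" if x: "x \<in> X - C" for x
    proof -
      have "x1 \<in> C" unfolding C_def using L0 x1 X(1) by (auto intro!: image_eqI[of _ _ 0])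
      then have "(x + d) mod int q \<in> X" using uniq x by blast
      moreover have "(x + d) mod int q \<notin> C"
      proof
        assume "(x + d) mod int q \<in> C"
        then obtain j where j: "j < L" "(x + d) mod int q = (x1 - int j * d) mod int q"
          unfolding C_def by auto
        then have "((x + d) mod int q - d) mod int q = ((x1 - int j * d) mod int q - d) mod int q" by simp
        then have "x mod int q = (x1 - int (Suc j) * d) mod int q"
          by (simp add: mod_simps algebra_simps)
        then have xx: "x = (x1 - int (Suc j) * d) mod int q" using x X(1) by (auto simp: subset_iff)
        show False
        proof (cases "Suc j < L")
          case True then show False using x xx unfolding C_def by blast
        next
          case False then have "Suc j = L" using j by simp
          then show False using x xx PL by simp
        qed
      qed
      ultimately show ?thesis by blast
    qed
    then have "X - C = {0..<int q}" using X(1) ne by (intro residues_closed_shift[OF q _ _ d]) auto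
    then show False using nfull X(1) by blast
  qed
  then have XC: "X = C" using CX by blast
  have "inj_on (\<lambda>i. (x1 - int i * d) mod int q) {..<L}"
  proof (rule linorder_inj_onI)
    fix i j assume ij: "i < j" "i \<in> {..<L}" "j \<in> {..<L}"
    show "(x1 - int i * d) mod int q \<noteq> (x1 - int j * d) mod int q"
    proof
      assume "(x1 - int i * d) mod int q = (x1 - int j * d) mod int q"
      then have "int q dvd (x1 - int i * d) - (x1 - int j * d)" by (simp add: mod_eq_dvd_iff)
      then have "int q dvd int (j - i) * d" using ij by (simp add: algebra_simps of_nat_diff)
      then have dv: "int q dvd int (j - i)" using d q by (simp add: cong_0_iff prime_dvd_mult_iff)
      \<comment> \<open>A coincidence makes \<open>j - i\<close> a multiple of \<open>q\<close>, so
        the point outside \<open>X\<close> found after \<open>L\<close> steps would already be met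
        after fewer steps.\<close>
      have "(x1 - int (L - (j - i)) * d) mod int q = (x1 - int L * d + int (j - i) * d) mod int q"
        using ij by (simp add: of_nat_diff algebra_simps)
      also have "\<dots> = (x1 - int L * d) mod int q"
        using dv by (metis dvd_mult2 mod_add_right_eq mod_0_imp_dvd add.right_neutral dvd_imp_mod_0)
      finally have "(x1 - int (L - (j - i)) * d) mod int q \<notin> X" using PL by (simp only: not_False_eq_True)
      moreover have "L - (j - i) < L" using ij by auto
      ultimately show False using lL by blast
    qed
  qed (simp add: linorder_linear)
  then have cX: "card X = L" using XC unfolding C_def by (simp add: card_image)
  have "C = (\<lambda>i. ((x1 - int (L - 1) * d) + i * d) mod int q) ` {0..<int L}"
  proof (intro equalityI subsetI)
    fix y assume "y \<in> C"
    then obtain i where i: "i < L" "y = (x1 - int i * d) mod int q" unfolding C_def by auto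
    have "y = ((x1 - int (L - 1) * d) + int (L - 1 - i) * d) mod int q"
      using i by (simp add: of_nat_diff algebra_simps)
    then show "y \<in> (\<lambda>i. ((x1 - int (L - 1) * d) + i * d) mod int q) ` {0..<int L}"
      using i by (intro image_eqI[of _ _ "int (L - 1 - i)"]) auto
  next
    fix y assume "y \<in> (\<lambda>i. ((x1 - int (L - 1) * d) + i * d) mod int q) ` {0..<int L}"
    then obtain i where i: "0 \<le> i" "i < int L" "y = ((x1 - int (L - 1) * d) + i * d) mod int q" by auto
    have eq: "int (L - 1 - nat i) = int (L - 1) - i" using i L0 by auto
    have "y = (x1 - int (L - 1 - nat i) * d) mod int q"
      unfolding eq i(3) by (simp add: algebra_simps)
    then show "y \<in> C" unfolding C_def using i L0 by (intro image_eqI[of _ _ "L - 1 - nat i"]) auto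
  qed
  then have "X = (\<lambda>i. ((x1 - int (L - 1) * d) + i * d) mod int q) ` {0..<int (card X)}"
    using XC cX by simp
  then show ?thesis by blast
qed

text \<open>Since \<open>e * (i + e') + b\<close> is congruent to \<open>(e * i + b) + 1\<close>,
  the shift by 1 on the dilate \<open>W\<close> corresponds to the shift by \<open>e'\<close> on the
  interval, where exits are easy to count.\<close>

lemma interval_affine_successors:
  assumes q: "prime q" and L: "0 \<le> L" "L < int q" and ee: "[e * e' = 1] (mod int q)"
    and W: "W = (\<lambda>i. (e * i + b) mod int q) ` {0..<L}"
  shows "card {i \<in> {0..<L}. (i + e' mod int q) mod int q \<notin> {0..<L}} \<le> card {w \<in> W. (w + 1) mod int q \<notin> W}"
proof -
  have "int q > 1" using q prime_gt_1_nat by force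
  then have e: "\<not> [e = 0] (mod int q)"
    using ee by (metis cong_0_iff cong_dvd_iff dvd_mult2 zdvd_not_zless zero_less_one)
  let ?f = "\<lambda>i. (e * i + b) mod int q"
  have fsuc: "(?f i + 1) mod int q = ?f ((i + e' mod int q) mod int q)" for i
  proof -
    have "[e * ((i + e' mod int q) mod int q) + b = e * (i + e') + b] (mod int q)"
      by (intro cong_add cong_mult) (auto simp: cong_def mod_simps)
    also have "e * (i + e') + b = e * i + b + e * e'" by (simp add: algebra_simps)
    also have "[e * i + b + e * e' = e * i + b + 1] (mod int q)" using ee by (intro cong_add) auto
    finally show ?thesis by (simp add: cong_def mod_simps)
  qed
  have inj: "inj_on ?f {0..<int q}" by (rule inj_on_affine_mod[OF q e]) simp
  have "?f ` {i \<in> {0..<L}. (i + e' mod int q) mod int q \<notin> {0..<L}} \<subseteq> {w \<in> W. (w + 1) mod int q \<notin> W}"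
  proof (rule image_subsetI)
    fix i assume i: "i \<in> {i \<in> {0..<L}. (i + e' mod int q) mod int q \<notin> {0..<L}}"
    have "?f ((i + e' mod int q) mod int q) \<notin> W"
    proof
      assume "?f ((i + e' mod int q) mod int q) \<in> W"
      then obtain j where j: "j \<in> {0..<L}" "?f ((i + e' mod int q) mod int q) = ?f j" using W by auto
      have "(i + e' mod int q) mod int q = j"
        using \<open>int q > 1\<close> L j by (intro inj_onD[OF inj j(2)]) auto
      then show False using i j by simp
    qed
    then show "?f i \<in> {w \<in> W. (w + 1) mod int q \<notin> W}" using i W fsuc by auto
  qed
  moreover have "inj_on ?f {i \<in> {0..<L}. (i + e' mod int q) mod int q \<notin> {0..<L}}"
    using L by (intro inj_on_subset[OF inj]) auto
  moreover have "finite {w \<in> W. (w + 1) mod int q \<notin> W}" using W by simp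
  ultimately show ?thesis using card_inj_on_le by blast
qed

lemma interval_affine_missing:
  assumes q: "prime q" and L: "1 \<le> L" "L < int q" and e: "\<not> [e = 0] (mod int q)"
    and W: "W = (\<lambda>i. (e * i + b) mod int q) ` {0..<L}" "W \<subseteq> {0..L}"
  obtains y where "{0..L} = insert y W" "y \<notin> W"
proof -
  have "card W = nat L"
    unfolding W using L by (subst card_image[OF inj_on_affine_mod[OF q e]]) auto
  then have "card ({0..L} - W) = 1"
    using W(2) L by (subst card_Diff_subset) (auto simp: finite_subset)
  then obtain y where "{0..L} - W = {y}" using card_1_singletonE by blast
  then show thesis using that W(2) by blast
qed

text \<open>A dilate \<open>W\<close> with \<open>e\<close> other than 1 and -1 has two points
  leaving it under the shift by 1. But \<open>W\<close> is \<open>{0..L}\<close> without one point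
  \<open>y\<close>, and if its translate by \<open>D\<close> fits into \<open>{0..L}\<close> too,
  then \<open>D\<close> is 1 or -1, which leaves room for only one such point.\<close>

lemma no_double_affine_interval:
  assumes q: "prime q" and L: "2 \<le> L" "L \<le> int q - 3" and e: "\<not> [e = 0] (mod int q)"
    "\<not> [e = 1] (mod int q)" "\<not> [e = - 1] (mod int q)" and D: "\<not> [D = 0] (mod int q)"
    and in1: "\<And>i. i \<in> {0..<L} \<Longrightarrow> (e * i + b) mod int q \<in> {0..L}"
    and in2: "\<And>i. i \<in> {0..<L} \<Longrightarrow> (e * i + b + D) mod int q \<in> {0..L}"
  shows False
proof -
  define W where "W = (\<lambda>i. (e * i + b) mod int q) ` {0..<L}"
  have WI: "W \<subseteq> {0..L}" unfolding W_def using in1 by blast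
  obtain y where y: "{0..L} = insert y W" "y \<notin> W"
    using interval_affine_missing[OF q _ _ e(1) W_def WI] L by auto
  obtain e' where ee: "[e * e' = 1] (mod int q)" using prime_inverse_mod[OF q e(1)] .
  have q1: "int q > 0" using L by simp
  define k' where "k' = e' mod int q"
  have k'r: "0 \<le> k'" "k' < int q" unfolding k'_def using q1 by auto
  have kk: "[e * k' = 1] (mod int q)"
    unfolding k'_def using ee by (simp add: cong_def mod_simps)
  have "k' \<noteq> 0" using kk L by (auto simp: cong_def)
  moreover have "k' \<noteq> 1" using kk e(2) by auto
  moreover have "k' \<noteq> int q - 1"
  proof
    assume "k' = int q - 1"
    then have "[e * k' = e * (- 1)] (mod int q)" by (intro cong_mult) (auto simp: cong_def mod_simps)
    then have "[- e = 1] (mod int q)" using kk by (metis cong_sym cong_trans mult_minus1_right)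
    then show False using e(3) by (metis cong_minus_minus_iff minus_minus)
  qed
  ultimately have k'2: "2 \<le> k'" "k' \<le> int q - 2" using k'r by auto
  have two: "2 \<le> card {w \<in> W. (w + 1) mod int q \<notin> W}"
    using interval_shift_two[of L "int q" k'] interval_affine_successors[OF q _ _ ee W_def] L k'2
    unfolding k'_def by fastforce
  have in2W: "(w + D) mod int q \<in> {0..L}" if "w \<in> W" for w
    using in2 that unfolding W_def by (auto simp: mod_simps)
  define k where "k = D mod int q"
  have kr: "0 < k" "k < int q" unfolding k_def using q1 D
    by (auto simp: cong_def intro: le_neq_trans)
  have in2k: "(w + k) mod int q \<in> {0..L}" if "w \<in> W" for w
    using in2W[OF that] unfolding k_def by (simp add: mod_simps)
  \<comment> \<open>Otherwise two points of \<open>{0..L}\<close> leave it under the shift by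
    \<open>k\<close>. Neither may lie in \<open>W\<close>, but only \<open>y\<close> lies outside
    \<open>W\<close>.\<close>
  have "k = 1 \<or> k = int q - 1"
  proof (rule ccontr)
    assume "\<not> ?thesis"
    then have "2 \<le> card {i \<in> {0..<L + 1}. (i + k) mod int q \<notin> {0..<L + 1}}"
      using kr L by (intro interval_shift_two) auto
    moreover have "{i \<in> {0..<L + 1}. (i + k) mod int q \<notin> {0..<L + 1}} \<subseteq> {y}"
    proof
      fix i assume i: "i \<in> {i \<in> {0..<L + 1}. (i + k) mod int q \<notin> {0..<L + 1}}"
      have "i \<notin> W" using i in2k[of i] by auto
      moreover have "i \<in> {0..L}" using i by auto
      ultimately show "i \<in> {y}" using y(1) by blast
    qed
    then have "card {i \<in> {0..<L + 1}. (i + k) mod int q \<notin> {0..<L + 1}} \<le> card {y}"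
      by (intro card_mono) auto
    ultimately show False by simp
  qed
  then have "\<exists>z. {w \<in> W. (w + 1) mod int q \<notin> W} \<subseteq> {z}"
  proof
    assume k1: "k = 1"
    have "{w \<in> W. (w + 1) mod int q \<notin> W} \<subseteq> {y - 1}"
    proof
      fix w assume w: "w \<in> {w \<in> W. (w + 1) mod int q \<notin> W}"
      then have "(w + 1) mod int q = y" using in2k[of w] k1 y by auto
      moreover have "0 \<le> w" "w \<le> L" using w WI by auto
      ultimately show "w \<in> {y - 1}" using L by simp
    qed
    then show ?thesis by blast
  next
    assume k1: "k = int q - 1"
    have "0 \<notin> W"
    proof
      assume "0 \<in> W"
      from in2k[OF this] have "k mod int q \<le> L" by simp
      moreover have "k mod int q = k" using kr by (intro mod_pos_pos_trivial) auto
      ultimately show False using k1 L by simp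
    qed
    then have y0: "y = 0" using y L by auto
    have "{w \<in> W. (w + 1) mod int q \<notin> W} \<subseteq> {L}"
    proof
      fix w assume w: "w \<in> {w \<in> W. (w + 1) mod int q \<notin> W}"
      then have "0 \<le> w" "w \<le> L" "w + 1 \<notin> W" using WI L by auto
      moreover have "w + 1 \<in> insert y W" if "w < L"
        unfolding y(1)[symmetric] using that \<open>0 \<le> w\<close> by simp
      ultimately show "w \<in> {L}" using y0 by fastforce
    qed
    then show ?thesis by blast
  qed
  then obtain z where "{w \<in> W. (w + 1) mod int q \<notin> W} \<subseteq> {z}" by blast
  then have "card {w \<in> W. (w + 1) mod int q \<notin> W} \<le> card {z}" by (intro card_mono) auto
  then show False using two by simp
qed

text \<open>For \<open>L = 2\<close> the two image points lie in \<open>{0..2}\<close> and differ by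
  \<open>e\<close>. For larger \<open>L\<close> the image is \<open>{0..L}\<close> without one
  point, hence has at most two exits, whereas an inverse \<open>e'\<close> between 3 and
  \<open>q - 3\<close> would cause three.\<close>

lemma affine_interval_multiplier:
  assumes q: "prime q" and L: "2 \<le> L" "L \<le> int q - 3" and ee: "[e * e' = 1] (mod int q)"
    and in1: "\<And>i. i \<in> {0..<L} \<Longrightarrow> (e * i + b) mod int q \<in> {0..L}"
  shows "\<exists>j\<in>{-2,-1,1,2}. [(if L = 2 then e else e') = j] (mod int q)"
proof -
  have "int q > 1" using L by simp
  then have nz: "\<not> [e = 0] (mod int q)" "\<not> [e' = 0] (mod int q)"
    using ee by (metis cong_0_iff cong_dvd_iff dvd_mult dvd_mult2 zdvd_not_zless zero_less_one)+
  have mem: "\<exists>j\<in>{-2,-1,1,2}. [x = j] (mod int q)"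
    if "\<not> [x = 0] (mod int q)" "j0 \<in> {-2..2}" "[x = j0] (mod int q)" for x j0
  proof -
    have "j0 \<noteq> 0" using that by auto
    then have "j0 \<in> {-2,-1,1,2}" using that(2) by auto
    then show ?thesis using that(3) by blast
  qed
  show ?thesis
  proof (cases "L = 2")
    case True
    define u v where "u = (e * 0 + b) mod int q" and "v = (e * 1 + b) mod int q"
    have uv: "u \<in> {0..2}" "v \<in> {0..2}" using in1[of 0] in1[of 1] True unfolding u_def v_def by auto
    have "[e = v - u] (mod int q)" unfolding u_def v_def by (simp add: cong_def mod_simps)
    moreover have "v - u \<in> {-2..2}" using uv by auto
    ultimately show ?thesis using mem[OF nz(1)] True by simp
  next
    case False
    define W where "W = (\<lambda>i. (e * i + b) mod int q) ` {0..<L}"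
    have WI: "W \<subseteq> {0..L}" unfolding W_def using in1 by blast
    obtain y where y: "{0..L} = insert y W" "y \<notin> W"
      using interval_affine_missing[OF q _ _ nz(1) W_def WI] L by auto
    have "{w \<in> W. (w + 1) mod int q \<notin> W} \<subseteq> {y - 1, L}"
    proof
      fix w assume w: "w \<in> {w \<in> W. (w + 1) mod int q \<notin> W}"
      then have "0 \<le> w" "w \<le> L" "w + 1 \<notin> W" using WI L by auto
      moreover have "w + 1 \<in> insert y W" if "w < L"
        unfolding y(1)[symmetric] using that \<open>0 \<le> w\<close> by simp
      ultimately show "w \<in> {y - 1, L}" by fastforce
    qed
    then have "card {w \<in> W. (w + 1) mod int q \<notin> W} \<le> card {y - 1, L}" by (intro card_mono) auto
    also have "\<dots> \<le> 2" by (simp add: card_insert_if)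
    finally have "card {i \<in> {0..<L}. (i + e' mod int q) mod int q \<notin> {0..<L}} \<le> 2"
      using interval_affine_successors[OF q _ _ ee W_def] L by force
    then have n: "\<not> (3 \<le> e' mod int q \<and> e' mod int q \<le> int q - 3)"
      using interval_shift_three[of L "int q" "e' mod int q"] L False by auto
    have r: "0 \<le> e' mod int q" "e' mod int q < int q" using L by auto
    define j0 where "j0 = (if e' mod int q < 3 then e' mod int q else e' mod int q - int q)"
    have "j0 \<in> {-2..2}" using n r unfolding j0_def by auto
    moreover have "[e' = j0] (mod int q)" unfolding j0_def by (simp add: cong_def mod_simps)
    ultimately show ?thesis using mem[OF nz(2)] False by simp
  qed
qed

text \<open>Both multipliers are congruent to numbers among -2, -1, 1, 2, and \<open>e\<close> is
  neither 1 nor -1, so their product minus 1 is one of 3, -5, 1, -3. A prime \<open>q\<close> of at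
  least 7 divides none of these.\<close>

lemma no_two_affine_intervals:
  assumes q: "prime q" "q \<ge> 7" and L: "2 \<le> L" "L \<le> int q - 3" and ee: "[e * e' = 1] (mod int q)"
    and e: "\<not> [e = 1] (mod int q)" "\<not> [e = - 1] (mod int q)"
    and in1: "\<And>i. i \<in> {0..<L} \<Longrightarrow> (e * i + b) mod int q \<in> {0..L}"
    and in2: "\<And>i. i \<in> {0..<L} \<Longrightarrow> (e' * i + c) mod int q \<in> {0..L}"
  shows False
proof -
  have ee': "[e' * e = 1] (mod int q)" using ee by (simp add: mult.commute)
  obtain j j' where j: "j \<in> {-2,-1,1,2}" "j' \<in> {-2,-1,1,2}" "[e = j] (mod int q)" "[e' = j'] (mod int q)"
    using affine_interval_multiplier[OF q(1) L ee in1] affine_interval_multiplier[OF q(1) L ee' in2]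
    by (cases "L = 2") auto
  have "[j * j' = 1] (mod int q)"
    using cong_mult[OF j(3,4)] ee by (metis cong_sym cong_trans)
  then have d: "int q dvd j * j' - 1" by (simp add: cong_iff_dvd_diff)
  have "j \<noteq> 1" "j \<noteq> - 1" using j e by auto
  then have jj: "j * j' - 1 \<in> {3, -5, 1, -3}" using j by auto
  then have "j * j' - 1 \<noteq> 0" "\<bar>j * j' - 1\<bar> \<le> 5" by auto
  then show False using dvd_imp_le_int[OF _ d] q(2) by auto
qed

text \<open>If the conclusion failed, \<open>A\<close> would be a progression with difference \<open>\<delta>\<close> and \<open>B\<close> a progression
  with one more term; a dilate of a progression almost fits into another one only for the multipliers
  \<open>\<plusminus>1, \<plusminus>2, \<plusminus>1/2\<close>.\<close>

lemma pair_growth: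
  assumes q: "prime q" "q \<ge> 7" and card: "2 \<le> nres q A" "nres q A + 3 \<le> q"
    and d: "\<not> [\<delta> = 0] (mod int q)"
    and t1: "\<And>x. x \<in> A \<Longrightarrow> \<exists>y\<in>B. [x + a = y] (mod int q)"
    and t2: "\<And>x. x \<in> A \<Longrightarrow> \<exists>y\<in>B. [x + a + \<delta> = y] (mod int q)"
    and e: "\<not> [e = 0] (mod int q)" "\<not> [e = 1] (mod int q)" "\<not> [e = - 1] (mod int q)"
    and t3: "\<And>x. x \<in> A \<Longrightarrow> \<exists>y\<in>B. [e * x + b = y] (mod int q)"
    and t4: "(\<exists>D. \<not> [D = 0] (mod int q) \<and> (\<forall>x\<in>A. \<exists>y\<in>B. [e * x + b + D = y] (mod int q))) \<or>
      (\<exists>e' c. [e * e' = 1] (mod int q) \<and> (\<forall>x\<in>A. \<exists>y\<in>B. [e' * x + c = y] (mod int q)))"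
  shows "nres q A + 2 \<le> nres q B"
proof (rule ccontr)
  assume neg: "\<not> ?thesis"
  define X where "X = (\<lambda>x. x mod int q) ` A"
  define Y where "Y = (\<lambda>x. x mod int q) ` B"
  have cX: "card X = nres q A" and cY: "card Y = nres q B" unfolding X_def Y_def nres_def by auto
  have q0: "int q > 0" using q by simp
  have XR: "X \<subseteq> {0..<int q}" and YR: "Y \<subseteq> {0..<int q}" unfolding X_def Y_def using q0 by auto
  have fin: "finite X" "finite Y" using XR YR finite_subset by blast+
  have small: "card Y \<le> card X + 1" using neg cX cY by simp
  have lift: "(k * x + m) mod int q \<in> Y"
    if x: "x \<in> X" and h: "\<And>x. x \<in> A \<Longrightarrow> \<exists>y\<in>B. [k * x + m = y] (mod int q)" for x k m
  proof -
    obtain z where z: "z \<in> A" "x = z mod int q" using x unfolding X_def by blast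
    obtain y where y: "y \<in> B" "[k * z + m = y] (mod int q)" using h[OF z(1)] by blast
    have "[k * x + m = k * z + m] (mod int q)"
      using z by (intro cong_add cong_mult) (auto simp: cong_def)
    then have "(k * x + m) mod int q = y mod int q" using y(2) by (simp add: cong_def)
    then show ?thesis using y(1) unfolding Y_def by blast
  qed
  have T1: "(x + a) mod int q \<in> Y" if "x \<in> X" for x
    using lift[of x 1 a] that t1 by simp
  have T2: "(x + (a + \<delta>)) mod int q \<in> Y" if "x \<in> X" for x
    using lift[of x 1 "a + \<delta>"] that t2 by (simp add: add.assoc)
  have T3: "(e * x + b) mod int q \<in> Y" if "x \<in> X" for x
    using lift[of x e b] that t3 by simp
  have inj: "inj_on (\<lambda>x. (x + c) mod int q) {0..<int q}" for c
    using inj_on_affine_mod[OF q(1), of 1 "{0..<int q}" c] q by (simp add: cong_def)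
  \<comment> \<open>A point leaving \<open>X\<close> under \<open>\<delta>\<close> gives a point of
    \<open>Y\<close> outside \<open>X + a\<close>, and there is room for only one.\<close>
  have "card {x \<in> X. (x + \<delta>) mod int q \<notin> X} \<le> 1"
  proof -
    let ?T = "(\<lambda>x. (x + a) mod int q) ` X"
    have "(\<lambda>x. (x + (a + \<delta>)) mod int q) ` {x \<in> X. (x + \<delta>) mod int q \<notin> X} \<subseteq> Y - ?T"
    proof (rule image_subsetI)
      fix x assume x: "x \<in> {x \<in> X. (x + \<delta>) mod int q \<notin> X}"
      have "(x + (a + \<delta>)) mod int q \<notin> ?T"
      proof
        assume "(x + (a + \<delta>)) mod int q \<in> ?T"
        then obtain z where z: "z \<in> X" "(x + (a + \<delta>)) mod int q = (z + a) mod int q" by blast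
        then have "((x + \<delta>) mod int q + a) mod int q = (z + a) mod int q"
          by (simp add: mod_simps algebra_simps)
        moreover have "z \<in> {0..<int q}" "(x + \<delta>) mod int q \<in> {0..<int q}"
          using z(1) XR q0 by auto
        ultimately have "(x + \<delta>) mod int q = z" using inj_onD[OF inj[of a]] by blast
        then show False using x z by simp
      qed
      then show "(x + (a + \<delta>)) mod int q \<in> Y - ?T" using x T2 by blast
    qed
    moreover have "inj_on (\<lambda>x. (x + (a + \<delta>)) mod int q) {x \<in> X. (x + \<delta>) mod int q \<notin> X}"
      using XR by (intro inj_on_subset[OF inj]) auto
    ultimately have "card {x \<in> X. (x + \<delta>) mod int q \<notin> X} \<le> card (Y - ?T)"
      using fin card_inj_on_le by blast
    also have "card (Y - ?T) = card Y - card ?T"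
      using T1 fin by (intro card_Diff_subset) auto
    also have "card ?T = card X" using XR by (intro card_image inj_on_subset[OF inj]) auto
    finally show ?thesis using small by simp
  qed
  moreover have "X \<noteq> {}" "card X < q" using card cX by auto
  ultimately obtain x0 where x0: "X = (\<lambda>i. (x0 + i * \<delta>) mod int q) ` {0..<int (card X)}"
    using progression_of_small_shift[OF q(1) XR _ _ d] by blast
  define L where "L = int (card X)"
  have L: "2 \<le> L" "L \<le> int q - 3" unfolding L_def using card cX by auto
  obtain d' where dd: "[\<delta> * d' = 1] (mod int q)" using prime_inverse_mod[OF q(1) d] .
  have nd': "\<not> [d' = 0] (mod int q)"
  proof
    assume "[d' = 0] (mod int q)"
    then have "[\<delta> * d' = \<delta> * 0] (mod int q)" by (intro cong_mult) auto
    then have "[1 = 0] (mod int q)" using dd by (metis cong_sym cong_trans mult_zero_right)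
    then show False using q by (simp add: cong_def)
  qed
  \<comment> \<open>The affine coordinate in which \<open>X + a\<close> becomes
    \<open>{0..<L}\<close>. Together with the last point shifted by \<open>\<delta>\<close>, this
    forces \<open>Y\<close> to become \<open>{0..L}\<close>.\<close>
  define u where "u = (\<lambda>y. (d' * y + (- (x0 + a) * d')) mod int q)"
  have uinj: "inj_on u {0..<int q}" unfolding u_def by (rule inj_on_affine_mod[OF q(1) nd']) simp
  have ucong: "u (y mod int q) = (d' * (y - x0 - a)) mod int q" for y
  proof -
    have "[d' * (y mod int q) + (- (x0 + a) * d') = d' * y + (- (x0 + a) * d')] (mod int q)"
      by (intro cong_add cong_mult) (auto simp: cong_def)
    also have "d' * y + (- (x0 + a) * d') = d' * (y - x0 - a)" by (simp add: algebra_simps)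
    finally show ?thesis unfolding u_def cong_def .
  qed
  have ueq: "u (y mod int q) = z mod int q" if "y - x0 - a = z * \<delta>" for y z
  proof -
    have "d' * (y - x0 - a) = z * (\<delta> * d')" unfolding that by simp
    also have "[z * (\<delta> * d') = z * 1] (mod int q)" using dd by (intro cong_mult) auto
    finally show ?thesis unfolding ucong by (simp add: cong_def)
  qed
  have uaff: "u ((k * (x0 + i * \<delta>) + m) mod int q) = (k * i + d' * (k * x0 + m - x0 - a)) mod int q" for k i m
  proof -
    have "d' * (k * (x0 + i * \<delta>) + m - x0 - a) = k * i * (\<delta> * d') + d' * (k * x0 + m - x0 - a)"
      by (simp add: algebra_simps)
    also have "[\<dots> = k * i * 1 + d' * (k * x0 + m - x0 - a)] (mod int q)"
      using dd by (intro cong_add cong_mult) auto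
    finally show ?thesis unfolding ucong by (simp add: cong_def)
  qed
  have inX: "(x0 + i * \<delta>) mod int q \<in> X" if "i \<in> {0..<L}" for i
    using that by (subst x0) (auto simp: L_def)
  have uY: "u ` Y \<subseteq> {0..<int q}" unfolding u_def using q0 by auto
  have subL: "{0..L} \<subseteq> u ` Y"
  proof
    fix i assume i: "i \<in> {0..L}"
    show "i \<in> u ` Y"
    proof (cases "i = L")
      case True
      have "((x0 + (L - 1) * \<delta>) mod int q + (a + \<delta>)) mod int q \<in> Y" using T2 inX[of "L - 1"] L by auto
      then have "(x0 + (L - 1) * \<delta> + (a + \<delta>)) mod int q \<in> Y" by (simp add: mod_simps)
      moreover have "u ((x0 + (L - 1) * \<delta> + (a + \<delta>)) mod int q) = L mod int q"
        by (rule ueq) (simp add: algebra_simps)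
      moreover have "L mod int q = L" using L by (intro mod_pos_pos_trivial) auto
      ultimately show ?thesis using True by (metis image_eqI)
    next
      case False
      then have i': "i \<in> {0..<L}" using i by auto
      have "((x0 + i * \<delta>) mod int q + a) mod int q \<in> Y" using T1 inX[OF i'] by auto
      then have "(x0 + i * \<delta> + a) mod int q \<in> Y" by (simp add: mod_simps)
      moreover have "u ((x0 + i * \<delta> + a) mod int q) = i mod int q"
        by (rule ueq) (simp add: algebra_simps)
      moreover have "i mod int q = i" using L i' by (intro mod_pos_pos_trivial) auto
      ultimately show ?thesis by (metis image_eqI)
    qed
  qed
  have "card (u ` Y) = card Y" using YR by (intro card_image inj_on_subset[OF uinj])
  then have "card (u ` Y) \<le> card {0..L}" using small L by (simp add: L_def)
  then have YL: "u ` Y = {0..L}" using subL fin by (intro card_seteq[symmetric]) auto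
  have key: "(k * i + d' * (k * x0 + m - x0 - a)) mod int q \<in> {0..L}"
    if i: "i \<in> {0..<L}" and h: "\<And>x. x \<in> A \<Longrightarrow> \<exists>y\<in>B. [k * x + m = y] (mod int q)" for i k m
  proof -
    have "(k * ((x0 + i * \<delta>) mod int q) + m) mod int q \<in> Y" using lift[OF inX[OF i] h] .
    moreover have "(k * ((x0 + i * \<delta>) mod int q) + m) mod int q = (k * (x0 + i * \<delta>) + m) mod int q"
      by (metis mod_add_left_eq mod_mult_right_eq)
    ultimately have "(k * (x0 + i * \<delta>) + m) mod int q \<in> Y" by simp
    then show ?thesis using uaff YL by (metis image_eqI)
  qed
  from t4 show False
  proof (elim disjE exE conjE)
    fix D assume D: "\<not> [D = 0] (mod int q)" "\<forall>x\<in>A. \<exists>y\<in>B. [e * x + b + D = y] (mod int q)"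
    have "(e * i + d' * (e * x0 + b - x0 - a) + d' * D) mod int q \<in> {0..L}" if "i \<in> {0..<L}" for i
      using key[OF that, of e "b + D"] D(2) by (simp add: algebra_simps)
    then show False
      using no_double_affine_interval[OF q(1) L e prime_mult_not_cong_0[OF q(1) nd' D(1)]]
        key[of _ e b] t3 by blast
  next
    fix e' c assume ee: "[e * e' = 1] (mod int q)" "\<forall>x\<in>A. \<exists>y\<in>B. [e' * x + c = y] (mod int q)"
    show False
      using no_two_affine_intervals[OF q L ee(1) e(2,3)] key[of _ e b] key[of _ e' c] t3 ee(2) by blast
  qed
qed

section \<open>Sequences of affine maps\<close>

lemma mset_concat_zip_pairs:
  "length as = length bs \<Longrightarrow>
     mset (concat (map (\<lambda>(g, h). [g, h]) (zip as bs))) = mset as + mset bs"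
  by (induction as bs rule: list_induct2) auto

text \<open>Sort by key and pair position \<open>i\<close> with position \<open>n - r + i\<close>.
  If their keys agreed, the \<open>n - r + 1\<close> positions from one to the other would all share
  the key, leaving fewer than \<open>r\<close> terms with another key.\<close>

lemma disjoint_pairs_by_key:
  fixes M :: "'a multiset" and k :: "'a \<Rightarrow> 'b::linorder"
  assumes n: "2 * r \<le> size M" and c: "\<And>c. r \<le> size (filter_mset (\<lambda>x. k x \<noteq> c) M)"
  shows "\<exists>ps. length ps = r \<and> (\<forall>(g, h)\<in>set ps. k g \<noteq> k h) \<and>
    mset (concat (map (\<lambda>(g, h). [g, h]) ps)) \<subseteq># M"
proof -
  obtain xs where xs: "mset xs = M" using ex_mset by blast
  define l where "l = sort_key k xs"
  define n where "n = length l"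
  have lM: "mset l = M" and srt: "sorted (map k l)" unfolding l_def using xs by auto
  have n2: "2 * r \<le> n" unfolding n_def using n lM by auto
  define ps where "ps = zip (take r l) (drop (n - r) l)"
  have len: "length (take r l) = length (drop (n - r) l)" using n2 by (auto simp: n_def)
  have lenps: "length ps = r" unfolding ps_def using n2 by (auto simp: n_def)
  have "l = take r l @ take (n - 2 * r) (drop r l) @ drop (n - r) l"
  proof -
    have "drop r l = take (n - 2 * r) (drop r l) @ drop (n - 2 * r) (drop r l)"
      by (rule append_take_drop_id[symmetric])
    moreover have "drop (n - 2 * r) (drop r l) = drop (n - r) l" using n2 by (simp add: algebra_simps)
    ultimately show ?thesis by (metis append_take_drop_id)
  qed
  then have "mset l = mset (take r l) + (mset (take (n - 2 * r) (drop r l)) + mset (drop (n - r) l))"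
    by (metis mset_append)
  then have "mset (take r l) + mset (drop (n - r) l) \<subseteq># M" unfolding lM[symmetric]
    by (simp add: subseteq_mset_def)
  then have sub: "mset (concat (map (\<lambda>(g, h). [g, h]) ps)) \<subseteq># M"
    unfolding ps_def mset_concat_zip_pairs[OF len] .
  have "k (l ! i) \<noteq> k (l ! (n - r + i))" if i: "i < r" for i
  proof
    assume eq: "k (l ! i) = k (l ! (n - r + i))"
    define c where "c = k (l ! i)"
    have same: "k (l ! j) = c" if j: "i \<le> j" "j \<le> n - r + i" for j
    proof -
      have jn: "n - r + i < length l" using i n2 unfolding n_def by auto
      have "map k l ! i \<le> map k l ! j" "map k l ! j \<le> map k l ! (n - r + i)"
        by (rule sorted_nth_mono[OF srt]; use j jn in simp)+
      then show ?thesis using eq j jn unfolding c_def by auto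
    qed
    have "size (filter_mset (\<lambda>x. k x \<noteq> c) M) = length (filter (\<lambda>x. k x \<noteq> c) l)"
      unfolding lM[symmetric] by (metis mset_filter size_mset)
    also have "\<dots> = card {j. j < n \<and> k (l ! j) \<noteq> c}"
      unfolding n_def by (rule length_filter_conv_card)
    also have "\<dots> \<le> card ({..<n} - {i..n - r + i})"
      using same by (intro card_mono) auto
    also have "\<dots> = n - (n - r + 1)"
      using i n2 by (subst card_Diff_subset) auto
    also have "\<dots> < r" using i n2 by auto
    finally show False using assms(2)[of c] by simp
  qed
  then have "\<forall>(g, h)\<in>set ps. k g \<noteq> k h"
    unfolding ps_def set_zip using n2 by (auto simp: n_def)
  then show ?thesis using lenps sub by blast
qed

lemma mset_subset_size_exists:
  "k \<le> size M \<Longrightarrow> \<exists>N. N \<subseteq># M \<and> size N = k"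
proof -
  assume k: "k \<le> size M"
  obtain xs where "mset xs = M" using ex_mset by blast
  then show ?thesis using k
    by (intro exI[of _ "mset (take k xs)"])
      (metis append_take_drop_id length_take min.absorb2 mset_append mset_subset_eq_add_left size_mset)
qed

section \<open>Words of affine maps and their values\<close>

locale affine_model =
  fixes p q :: nat and s :: int
  assumes p: "prime p" "odd p" and q: "prime q" and pq: "p dvd q - 1"
    and s_pow_p: "[s ^ p = 1] (mod int q)" and s_not_1: "\<not> [s = 1] (mod int q)"
begin

lemma p_ge_3: "p \<ge> 3"
  using p by (metis One_nat_def Suc_leI dvd_refl numeral_2_eq_2 numeral_3_eq_3 order_le_imp_less_or_eq prime_gt_1_nat)

text \<open>\<open>q - 1\<close> is even and a multiple of the odd \<open>p\<close>, so it is at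
  least \<open>2 * p\<close>. The size estimates below rest on this inequality.\<close>

lemma q_ge: "2 * p + 1 \<le> q" "odd q" "q \<ge> 7"
proof -
  have q2: "q \<ge> 2" using q prime_ge_2_nat by blast
  have "p \<le> q - 1" using pq q2 by (intro dvd_imp_le) auto
  then have "q > 2" using p_ge_3 by simp
  then show oq: "odd q" using q prime_odd_nat by blast
  obtain m where m: "q - 1 = p * m" using pq by blast
  have "even (p * m)" using oq q2 unfolding m[symmetric] by simp
  then have "even m" using p(2) by simp
  moreover have "m \<noteq> 0" using m q2 by (intro notI) simp
  ultimately have "2 \<le> m" by presburger
  then have "p * 2 \<le> p * m" by (rule mult_le_mono2)
  moreover have "q = p * m + 1" using m q2 by linarith
  ultimately show a: "2 * p + 1 \<le> q" by linarith
  then show "q \<ge> 7" using p_ge_3 by simp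
qed

lemma q_pos: "q > 0" and p_pos: "p > 0" using q_ge p_ge_3 by auto

lemma s_pow_mod: "[s ^ (a mod p) = s ^ a] (mod int q)"
proof -
  have "s ^ a = (s ^ p) ^ (a div p) * s ^ (a mod p)"
    by (metis power_add power_mult mult_div_mod_eq)
  moreover have "[(s ^ p) ^ (a div p) * s ^ (a mod p) = 1 ^ (a div p) * s ^ (a mod p)] (mod int q)"
    by (intro cong_mult cong_pow s_pow_p cong_refl)
  ultimately show ?thesis by (simp add: cong_sym)
qed

lemma s_pow_cong: "[a = b] (mod p) \<Longrightarrow> [s ^ a = s ^ b] (mod int q)"
  by (metis cong_def s_pow_mod)

lemma s_pow_cong_1: "p dvd a \<Longrightarrow> [s ^ a = 1] (mod int q)"
  using s_pow_cong[of a 0] by (simp add: cong_0_iff)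

lemma s_pow_coprime: "coprime (s ^ a) (int q)"
proof -
  have "\<not> int q dvd s"
  proof
    assume "int q dvd s"
    then have "int q dvd s ^ p" using p_pos by (simp add: dvd_power_le dvd_trans)
    then have "int q dvd 1" using s_pow_p by (simp add: cong_dvd_iff)
    then show False using q_ge by simp
  qed
  then have "coprime s (int q)" using q
    by (metis coprime_commute prime_imp_coprime prime_nat_int_transfer)
  then show ?thesis by simp
qed

lemma s_pow_nz: "\<not> [s ^ a = 0] (mod int q)"
proof
  assume "[s ^ a = 0] (mod int q)"
  then have "int q dvd s ^ a" by (simp add: cong_0_iff)
  then have "is_unit (int q)" using s_pow_coprime[of a] coprime_common_divisor dvd_refl by blast
  then show False using q_ge by simp
qed

lemma s_pow_eq_1_iff: "[s ^ a = 1] (mod int q) \<longleftrightarrow> p dvd a"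
proof
  assume a: "[s ^ a = 1] (mod int q)"
  show "p dvd a"
  proof (rule ccontr)
    assume "\<not> p dvd a"
    then have "coprime a p" using p by (metis coprime_commute prime_imp_coprime)
    then obtain x where x: "[a * x = 1] (mod p)" using cong_solve_coprime_nat by auto
    have "[s ^ (a * x) = 1] (mod int q)" using cong_pow[OF a, of x] by (simp add: power_mult)
    moreover have "[s ^ (a * x) = s ^ 1] (mod int q)" by (rule s_pow_cong[OF x])
    ultimately show False using s_not_1 by (metis cong_sym cong_trans power_one_right)
  qed
qed (rule s_pow_cong_1)

lemma s_pow_cong_iff: "[s ^ a = s ^ b] (mod int q) \<longleftrightarrow> [a = b] (mod p)"
proof
  have main: "[a = b] (mod p)" if le: "a \<le> b" and h: "[s ^ a = s ^ b] (mod int q)" for a b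
  proof -
    have "s ^ b = s ^ a * s ^ (b - a)" using le by (simp flip: power_add)
    then have "[s ^ a * s ^ (b - a) = s ^ a * 1] (mod int q)" using h by (simp add: cong_sym)
    then have "[s ^ (b - a) = 1] (mod int q)" using s_pow_coprime cong_mult_lcancel by blast
    then have "p dvd b - a" by (simp add: s_pow_eq_1_iff)
    then show ?thesis using le by (metis cong_altdef_nat cong_sym)
  qed
  assume "[s ^ a = s ^ b] (mod int q)"
  then show "[a = b] (mod p)" using main[of a b] main[of b a] by (metis cong_sym nat_le_linear)
qed (rule s_pow_cong)

text \<open>The order of a power of \<open>s\<close> divides the odd \<open>p\<close>, while -1 has
  order 2. This rules out the multiplier -1 in \<open>pair_growth\<close>.\<close>

lemma s_pow_not_minus_1: "\<not> [s ^ a = - 1] (mod int q)"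
proof
  assume "[s ^ a = - 1] (mod int q)"
  then have "[(s ^ a) ^ p = (- 1) ^ p] (mod int q)" by (rule cong_pow)
  moreover have "[(s ^ a) ^ p = 1] (mod int q)"
    using s_pow_cong_1[of "a * p"] by (simp add: power_mult)
  ultimately have "[1 = - 1] (mod int q)" using p(2) by (simp add: cong_def)
  then have "int q dvd 2" by (simp add: cong_iff_dvd_diff)
  then have "int q \<le> 2" by (rule zdvd_imp_le) simp
  then show False using q_ge by simp
qed

text \<open>A pair \<open>(x, t)\<close> stands for the affine map \<open>y \<mapsto> x + s\<^sup>t y\<close> over the integers modulo \<open>q\<close>;
  \<open>val\<close> is the translation part of a composition and \<open>deg\<close> the exponent of its linear part.\<close>

fun val :: "(int \<times> nat) list \<Rightarrow> int" where
  "val [] = 0"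
| "val ((x, t) # l) = x + s ^ t * val l"

text \<open>Left unreduced modulo \<open>p\<close>, so that the same words serve when
  \<open>b\<close> has order a higher power of \<open>p\<close> and the total exponent is tested
  modulo that power.\<close>

definition deg :: "(int \<times> nat) list \<Rightarrow> nat" where
  "deg l = sum_list (map snd l)"

definition dg :: "(int \<times> nat) multiset \<Rightarrow> nat" where
  "dg M = sum_mset (image_mset snd M)"

definition vals :: "(int \<times> nat) multiset \<Rightarrow> int set" where
  "vals M = val ` {l. mset l = M}"

lemma deg_simps [simp]: "deg [] = 0" "deg (g # l) = snd g + deg l" "deg (l @ l') = deg l + deg l'"
  unfolding deg_def by auto

lemma dg_simps [simp]: "dg {#} = 0" "dg (add_mset g M) = snd g + dg M" "dg (M + N) = dg M + dg N"
  unfolding dg_def by auto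

lemma dg_mset [simp]: "dg (mset l) = deg l"
  unfolding dg_def deg_def by (metis mset_map sum_mset_sum_list)

lemma val_Cons: "val (g # l) = fst g + s ^ snd g * val l"
  by (cases g) simp

lemma val_append: "val (l @ l') = val l + s ^ deg l * val l'"
  by (induction l) (auto simp: val_Cons algebra_simps power_add)

lemma valsI: "mset l = M \<Longrightarrow> val l \<in> vals M" unfolding vals_def by blast

lemma valsE: assumes "v \<in> vals M" obtains l where "mset l = M" "v = val l"
  using assms unfolding vals_def by blast

lemma vals_nonempty: "vals M \<noteq> {}"
  unfolding vals_def using ex_mset by auto

lemma vals_plus: "a \<in> vals M \<Longrightarrow> b \<in> vals N \<Longrightarrow> a + s ^ dg M * b \<in> vals (M + N)"
proof (elim valsE)
  fix l l' assume "mset l = M" "mset l' = N" "a = val l" "b = val l'"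
  then show ?thesis using valsI[of "l @ l'" "M + N"] by (auto simp: val_append)
qed

lemma nres_vals_plus: "min q (nres q (vals M) + nres q (vals N) - 1) \<le> nres q (vals (M + N))"
proof -
  have "min q (nres q (vals M) + nres q ((\<lambda>x. s ^ dg M * x + 0) ` vals N) - 1) \<le> nres q (vals (M + N))"
    by (rule cauchy_davenport[OF q]) (use vals_nonempty vals_plus in \<open>fastforce intro: cong_refl\<close>)+
  then show ?thesis using nres_affine[OF q_pos s_pow_coprime[of "dg M"], of 0] by simp
qed

lemma nres_vals_le_plus: "nres q (vals M) \<le> nres q (vals (M + N))"
  using nres_vals_plus[of M N] nres_pos[OF q_pos vals_nonempty, of N] nres_le[OF q_pos, of "vals M"] by auto

lemma nres_vals_mono: "M \<subseteq># N \<Longrightarrow> nres q (vals M) \<le> nres q (vals N)"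
  using nres_vals_le_plus[of M "N - M"] by simp

text \<open>Product-one in the group of order \<open>p * q\<close>, the empty sequence included. The
  exponent of a product does not depend on the order of the factors, so only the translation part is
  quantified over orderings.\<close>

definition one :: "(int \<times> nat) multiset \<Rightarrow> bool" where
  "one M \<longleftrightarrow> p dvd dg M \<and> (\<exists>v\<in>vals M. int q dvd v)"

definition splits :: "(int \<times> nat) multiset \<Rightarrow> bool" where
  "splits S \<longleftrightarrow> (\<exists>T U. S = T + U \<and> T \<noteq> {#} \<and> U \<noteq> {#} \<and> one T \<and> one U)"

lemma one_plus: "one M \<Longrightarrow> one N \<Longrightarrow> one (M + N)"
  unfolding one_def using vals_plus[of _ M _ N] by (metis dg_simps(3) dvd_add dvd_mult)

lemma one_of_full:
  assumes "T \<subseteq># M" "nres q (vals T) = q" "p dvd dg M"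
  shows "one M"
proof -
  have "nres q (vals M) = q"
    using nres_vals_mono[OF assms(1)] assms(2) nres_le[OF q_pos, of "vals M"] by simp
  then obtain v where "v \<in> vals M" "[v = 0] (mod int q)" using nres_full_obtain[OF q_pos] by metis
  then show ?thesis using assms(3) unfolding one_def by (auto simp: cong_0_iff)
qed

lemma splits_of_full:
  assumes S: "p dvd dg S" and V: "V \<subseteq># S" "V \<noteq> {#}" "one V"
    and T: "T \<subseteq># S - V" "nres q (vals T) = q"
  shows "splits S"
proof -
  have "dg S = dg V + dg (S - V)" using V(1) by (metis dg_simps(3) subset_mset.add_diff_inverse)
  then have "p dvd dg (S - V)" using S V(3) unfolding one_def by (metis dvd_add_right_iff)
  then have "one (S - V)" using one_of_full[OF T] by simp
  moreover have "S - V \<noteq> {#}"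
  proof
    assume "S - V = {#}"
    then have "vals T \<subseteq> {0}" using T(1) unfolding vals_def by auto
    then have "nres q (vals T) \<le> nres q {0}" by (rule nres_mono[OF q_pos])
    then show False using T(2) q_ge by simp
  qed
  moreover have "S = V + (S - V)" using V(1) by simp
  ultimately show ?thesis unfolding splits_def using V by blast
qed

text \<open>The key of a pair: \<open>- 1\<close> for translations and the fixed point of the affine map otherwise. Two
  nontrivial maps commute iff their keys agree.\<close>

definition cl :: "int \<times> nat \<Rightarrow> int" where
  "cl g = (if p dvd snd g then - 1
     else (SOME f. f \<in> {0..<int q} \<and> [fst g = f * (1 - s ^ snd g)] (mod int q)))"

lemma cl_nonneg_spec:
  assumes "\<not> p dvd snd g"
  shows "cl g \<in> {0..<int q}" "[fst g = cl g * (1 - s ^ snd g)] (mod int q)"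
proof -
  have "\<not> [1 - s ^ snd g = 0] (mod int q)"
    using assms s_pow_eq_1_iff[of "snd g"] by (metis cong_diff_iff_cong_0 cong_sym)
  then obtain d where d: "[(1 - s ^ snd g) * d = 1] (mod int q)" using prime_inverse_mod[OF q] by blast
  let ?f = "(fst g * d) mod int q"
  have "[?f * (1 - s ^ snd g) = (fst g * d) * (1 - s ^ snd g)] (mod int q)"
    by (intro cong_mult) (auto simp: cong_def)
  also have "(fst g * d) * (1 - s ^ snd g) = fst g * ((1 - s ^ snd g) * d)" by (simp add: algebra_simps)
  also have "[fst g * ((1 - s ^ snd g) * d) = fst g * 1] (mod int q)" using d by (intro cong_mult) auto
  finally have "\<exists>f. f \<in> {0..<int q} \<and> [fst g = f * (1 - s ^ snd g)] (mod int q)"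
    using q_pos by (intro exI[of _ ?f]) (auto simp: cong_sym)
  from someI_ex[OF this] show "cl g \<in> {0..<int q}" "[fst g = cl g * (1 - s ^ snd g)] (mod int q)"
    unfolding cl_def using assms by auto
qed

lemma cl_eq_minus_1_iff: "cl g = - 1 \<longleftrightarrow> p dvd snd g"
  using cl_nonneg_spec(1)[of g] by (auto simp: cl_def)

definition comm :: "int \<times> nat \<Rightarrow> int \<times> nat \<Rightarrow> bool" where
  "comm g h \<longleftrightarrow> [fst g * (1 - s ^ snd h) = fst h * (1 - s ^ snd g)] (mod int q)"

text \<open>For two non-translations the commutation equation becomes
  \<open>(cl g - cl h) * (1 - s ^ snd g) * (1 - s ^ snd h) = 0\<close> modulo \<open>q\<close>. A
  nonzero translation commutes with no non-translation. The identity has to be excluded because it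
  commutes across classes.\<close>

lemma not_comm_of_cl_neq:
  assumes "cl g \<noteq> cl h" and "\<not> (p dvd snd g \<and> int q dvd fst g)" "\<not> (p dvd snd h \<and> int q dvd fst h)"
  shows "\<not> comm g h"
proof
  assume c: "comm g h"
  have nz: "\<not> [1 - s ^ snd k = 0] (mod int q)" if "\<not> p dvd snd k" for k :: "int \<times> nat"
    using that s_pow_eq_1_iff[of "snd k"] by (metis cong_diff_iff_cong_0 cong_sym)
  have z: "[1 - s ^ snd k = 0] (mod int q)" if "p dvd snd k" for k :: "int \<times> nat"
    using that s_pow_eq_1_iff[of "snd k"] by (metis cong_diff_iff_cong_0 cong_sym)
  have mixed: False if "p dvd snd a" "\<not> p dvd snd b" "comm a b" "\<not> int q dvd fst a" for a b
  proof -
    have "[fst b * (1 - s ^ snd a) = fst b * 0] (mod int q)" using z[OF that(1)] by (intro cong_mult) auto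
    then have "[fst a * (1 - s ^ snd b) = 0] (mod int q)"
      using that(3) unfolding comm_def by (metis cong_trans mult_zero_right)
    then show False using prime_mult_not_cong_0[OF q _ nz[OF that(2)], of "fst a"] that(4)
      by (simp add: cong_0_iff)
  qed
  have sym: "comm h g" using c unfolding comm_def by (rule cong_sym)
  consider "p dvd snd g" "p dvd snd h" | "p dvd snd g" "\<not> p dvd snd h" | "\<not> p dvd snd g" "p dvd snd h"
    | "\<not> p dvd snd g" "\<not> p dvd snd h" by blast
  then show False
  proof cases
    case 1 then show False using assms(1) by (simp add: cl_def)
  next
    case 2 then show False using mixed[OF _ _ c] assms by blast
  next
    case 3 then show False using mixed[OF _ _ sym] assms by blast
  next
    case 4
    let ?a = "1 - s ^ snd g" and ?b = "1 - s ^ snd h"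
    have 1: "[fst g * ?b = (cl g * ?a) * ?b] (mod int q)"
      using cl_nonneg_spec(2)[OF 4(1)] by (intro cong_mult) auto
    have 2: "[fst h * ?a = (cl h * ?b) * ?a] (mod int q)"
      using cl_nonneg_spec(2)[OF 4(2)] by (intro cong_mult) auto
    have "[(cl g * ?a) * ?b = (cl h * ?b) * ?a] (mod int q)"
      using cong_trans[OF cong_trans[OF cong_sym[OF 1] c[unfolded comm_def]] 2] .
    then have "[(cl g * ?a) * ?b - (cl h * ?b) * ?a = 0] (mod int q)" by (simp add: cong_diff_iff_cong_0)
    moreover have "(cl g * ?a) * ?b - (cl h * ?b) * ?a = (cl g - cl h) * (?a * ?b)"
      by (simp add: algebra_simps)
    ultimately have "[cl g - cl h = 0] (mod int q)"
      using prime_mult_not_cong_0[OF q _ prime_mult_not_cong_0[OF q nz[OF 4(1)] nz[OF 4(2)]]] by metis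
    then have "[cl g = cl h] (mod int q)" by (simp add: cong_diff_iff_cong_0)
    moreover have "cl g \<in> {0..<int q}" "cl h \<in> {0..<int q}" using cl_nonneg_spec(1) 4 by auto
    ultimately show False using assms(1) by (simp add: cong_def)
  qed
qed

section \<open>Growth of value sets under noncommuting pairs\<close>

lemma comm_diff:
  "comm g h \<longleftrightarrow> [(fst g + s ^ snd g * fst h) - (fst h + s ^ snd h * fst g) = 0] (mod int q)"
proof -
  have "(fst g + s ^ snd g * fst h) - (fst h + s ^ snd h * fst g)
    = fst g * (1 - s ^ snd h) - fst h * (1 - s ^ snd g)" by (simp add: algebra_simps)
  then show ?thesis unfolding comm_def by (simp add: cong_diff_iff_cong_0)
qed

lemma nres_vals_noncomm_pair:
  assumes "\<not> comm g h"
  shows "2 \<le> nres q (vals {#g, h#})"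
proof -
  have "fst g + s ^ snd g * fst h \<in> vals {#g, h#}" "fst h + s ^ snd h * fst g \<in> vals {#g, h#}"
    using valsI[of "[g, h]" "{#g, h#}"] valsI[of "[h, g]" "{#g, h#}"] by (auto simp: val_Cons add_mset_commute)
  then have "nres q {fst g + s ^ snd g * fst h, fst h + s ^ snd h * fst g} \<le> nres q (vals {#g, h#})"
    by (intro nres_mono[OF q_pos]) auto
  then show ?thesis using nres_two assms comm_diff by (simp add: cong_diff_iff_cong_0)
qed

text \<open>Every placement of \<open>g\<close> and \<open>h\<close> around a word for
  \<open>M\<close> maps \<open>vals M\<close> affinely into the new value set. Appending them in
  both orders gives two translations that differ by \<open>\<delta>\<close>. Prepending them in both
  orders gives the multiplier \<open>s ^ (snd g + snd h)\<close> twice, the first alternative in the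
  last hypothesis of \<open>pair_growth\<close>; this works unless the multiplier is 1.\<close>

lemma nres_vals_add_pair:
  assumes nc: "\<not> comm g h" and L: "2 \<le> nres q (vals M)" "nres q (vals M) + 3 \<le> q"
  shows "nres q (vals M) + 2 \<le> nres q (vals (M + {#g, h#}))"
proof -
  define D where "D = (fst g + s ^ snd g * fst h) - (fst h + s ^ snd h * fst g)"
  have D: "\<not> [D = 0] (mod int q)" using nc comm_diff unfolding D_def by simp
  define \<delta> where "\<delta> = s ^ dg M * D"
  have \<delta>: "\<not> [\<delta> = 0] (mod int q)" unfolding \<delta>_def by (rule prime_mult_not_cong_0[OF q s_pow_nz D])
  define a where "a = s ^ dg M * (fst h + s ^ snd h * fst g)"
  let ?B = "vals (M + {#g, h#})"
  have mem: "val l' \<in> ?B" if "mset l = M" "mset l' = mset l + {#g, h#}" for l l'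
    using that by (intro valsI) auto
  have t1: "x + a \<in> ?B" if "x \<in> vals M" for x
    using that
  proof (rule valsE)
    fix l assume l: "mset l = M" "x = val l"
    have "val (l @ [h, g]) = x + a"
      using l by (auto simp: val_append val_Cons a_def simp flip: dg_mset)
    then show ?thesis using mem[OF l(1), of "l @ [h, g]"] by (simp add: add_mset_commute)
  qed
  have t2: "x + a + \<delta> \<in> ?B" if "x \<in> vals M" for x
    using that
  proof (rule valsE)
    fix l assume l: "mset l = M" "x = val l"
    have "val (l @ [g, h]) = x + a + \<delta>"
      using l by (auto simp: val_append val_Cons a_def \<delta>_def D_def algebra_simps simp flip: dg_mset)
    then show ?thesis using mem[OF l(1), of "l @ [g, h]"] by simp
  qed
  have tl: "s ^ (snd g + snd h) * x + (fst h + s ^ snd h * fst g) \<in> ?B"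
      "s ^ (snd g + snd h) * x + (fst h + s ^ snd h * fst g) + D \<in> ?B"
      "s ^ snd g * x + (fst g + s ^ snd g * s ^ dg M * fst h) \<in> ?B"
      "s ^ snd h * x + (fst h + s ^ snd h * s ^ dg M * fst g) \<in> ?B" if x: "x \<in> vals M" for x
  proof -
    obtain l where l: "mset l = M" "x = val l" using x by (rule valsE)
    have v: "val (h # g # l) = s ^ (snd g + snd h) * x + (fst h + s ^ snd h * fst g)"
      "val (g # h # l) = s ^ (snd g + snd h) * x + (fst h + s ^ snd h * fst g) + D"
      "val (g # l @ [h]) = s ^ snd g * x + (fst g + s ^ snd g * s ^ dg M * fst h)"
      "val (h # l @ [g]) = s ^ snd h * x + (fst h + s ^ snd h * s ^ dg M * fst g)"
      using l by (auto simp: val_append val_Cons D_def algebra_simps power_add simp flip: dg_mset)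
    show "s ^ (snd g + snd h) * x + (fst h + s ^ snd h * fst g) \<in> ?B"
      "s ^ (snd g + snd h) * x + (fst h + s ^ snd h * fst g) + D \<in> ?B"
      "s ^ snd g * x + (fst g + s ^ snd g * s ^ dg M * fst h) \<in> ?B"
      "s ^ snd h * x + (fst h + s ^ snd h * s ^ dg M * fst g) \<in> ?B"
      using mem[OF l(1), of "h # g # l"] mem[OF l(1), of "g # h # l"] mem[OF l(1), of "g # l @ [h]"]
        mem[OF l(1), of "h # l @ [g]"] unfolding v by (simp_all add: add_mset_commute)
  qed
  show ?thesis
  proof (cases "[s ^ (snd g + snd h) = 1] (mod int q)")
    case False
    show ?thesis
      by (rule pair_growth[OF q q_ge(3) L \<delta>, where a = a and e = "s ^ (snd g + snd h)" and
            b = "fst h + s ^ snd h * fst g"])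
        (use t1 t2 tl False D s_pow_nz s_pow_not_minus_1 in \<open>blast intro: cong_refl\<close>)+
  next
    \<comment> \<open>The linear parts are inverse to each other. With one term in front and the
      other at the end, the multipliers \<open>s ^ snd g\<close> and \<open>s ^ snd h\<close> are
      mutually inverse, which is the second alternative. They are not 1, since two translations
      would commute.\<close>
    case True
    have "\<not> [s ^ snd g = 1] (mod int q)"
    proof
      assume g1: "[s ^ snd g = 1] (mod int q)"
      have "[s ^ snd g * s ^ snd h = 1 * s ^ snd h] (mod int q)" using g1 by (intro cong_mult) auto
      then have h1: "[s ^ snd h = 1] (mod int q)" using True by (simp add: power_add cong_def)
      have "[fst g * (1 - s ^ snd h) = fst g * (1 - 1)] (mod int q)"
        "[fst h * (1 - s ^ snd g) = fst h * (1 - 1)] (mod int q)"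
        by (intro cong_mult cong_diff cong_refl g1 h1)+
      then show False using nc unfolding comm_def by (simp add: cong_def)
    qed
    moreover have "[s ^ snd g * s ^ snd h = 1] (mod int q)" using True by (simp add: power_add)
    ultimately show ?thesis
      by (intro pair_growth[OF q q_ge(3) L \<delta>, where a = a and e = "s ^ snd g" and
            b = "fst g + s ^ snd g * s ^ dg M * fst h"])
        (use t1 t2 tl s_pow_nz s_pow_not_minus_1 in \<open>blast intro: cong_refl\<close>)+
  qed
qed

lemma nres_vals_add_pair_ge:
  assumes nc: "\<not> comm g h"
  shows "min q (nres q (vals M) + 1) \<le> nres q (vals (M + {#g, h#}))"
  using nres_vals_plus[of M "{#g, h#}"] nres_vals_noncomm_pair[OF nc] by linarith

text \<open>The first pair has two values, and each further pair adds two while at most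
  \<open>q - 3\<close> are present. From \<open>q - 2\<close> values on only one more is guaranteed,
  hence the cap \<open>q - 1\<close>.\<close>

lemma nres_vals_pairs:
  assumes "ps \<noteq> []" "\<forall>(g, h)\<in>set ps. \<not> comm g h"
  shows "min (q - 1) (2 * length ps) \<le> nres q (vals (mset (concat (map (\<lambda>(g, h). [g, h]) ps))))"
  using assms
proof (induction ps)
  case (Cons gh ps)
  obtain g h where gh: "gh = (g, h)" by (cases gh)
  have nc: "\<not> comm g h" using Cons.prems gh by simp
  define M where "M = mset (concat (map (\<lambda>(g, h). [g, h]) ps))"
  have eq: "mset (concat (map (\<lambda>(g, h). [g, h]) (gh # ps))) = M + {#g, h#}"
    unfolding M_def gh by simp
  show ?case
  proof (cases "ps = []")
    case True
    then have "mset (concat (map (\<lambda>(g, h). [g, h]) (gh # ps))) = {#g, h#}" unfolding gh by simp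
    then show ?thesis using nres_vals_noncomm_pair[OF nc] True by simp
  next
    case False
    then have IH: "min (q - 1) (2 * length ps) \<le> nres q (vals M)" unfolding M_def using Cons by auto
    have "length ps \<ge> 1" using False by (cases ps) auto
    then have two: "2 \<le> nres q (vals M)" using IH q_ge by auto
    show ?thesis unfolding eq
    proof (cases "nres q (vals M) + 3 \<le> q")
      case True
      then show "min (q - 1) (2 * length (gh # ps)) \<le> nres q (vals (M + {#g, h#}))"
        using nres_vals_add_pair[OF nc two] IH by auto
    next
      case False
      then show "min (q - 1) (2 * length (gh # ps)) \<le> nres q (vals (M + {#g, h#}))"
        using nres_vals_add_pair_ge[OF nc, of M] by auto
    qed
  qed
qed simp

text \<open>All pairs but one reach \<open>q - 1\<close> residues, and Cauchy-Davenport lets the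
  last pair add the missing one.\<close>

lemma full_of_noncomm_pairs:
  assumes "2 * length ps = q + 1" "\<forall>(g, h)\<in>set ps. \<not> comm g h"
  shows "nres q (vals (mset (concat (map (\<lambda>(g, h). [g, h]) ps)))) = q"
proof -
  obtain gh ps' where ps: "ps = gh # ps'" using assms(1) by (cases ps) auto
  obtain g h where gh: "gh = (g, h)" by (cases gh)
  define M where "M = mset (concat (map (\<lambda>(g, h). [g, h]) ps'))"
  have "ps' \<noteq> []" using assms(1) ps q_ge by auto
  then have "min (q - 1) (2 * length ps') \<le> nres q (vals M)"
    unfolding M_def using nres_vals_pairs assms(2) ps by auto
  then have "q - 1 \<le> nres q (vals M)" using assms(1) ps by auto
  moreover have "\<not> comm g h" using assms(2) ps gh by simp
  ultimately have "q \<le> nres q (vals (M + {#g, h#}))"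
    using nres_vals_add_pair_ge[of g h M] by auto
  moreover have "mset (concat (map (\<lambda>(g, h). [g, h]) ps)) = M + {#g, h#}"
    unfolding M_def ps gh by simp
  ultimately show ?thesis using nres_le[OF q_pos] by (simp add: le_antisym)
qed

text \<open>The principal way to split: when no single key is too frequent in \<open>T\<close>,
  pairing by key yields \<open>(q + 1) / 2\<close> disjoint noncommuting pairs outside
  \<open>V\<close>.\<close>

lemma splits_of_classes:
  assumes S: "p dvd dg S" and id: "\<And>g. g \<in># S \<Longrightarrow> \<not> (p dvd snd g \<and> int q dvd fst g)"
    and V: "V \<subseteq># S" "V \<noteq> {#}" "one V"
    and T: "T \<subseteq># S - V" "q + 1 \<le> size T" "\<And>c. q + 1 \<le> 2 * size (filter_mset (\<lambda>g. cl g \<noteq> c) T)"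
  shows "splits S"
proof -
  obtain r where r: "q + 1 = 2 * r" using q_ge(2) by (metis dvd_def odd_even_add odd_one)
  obtain ps where ps: "length ps = r" "\<forall>(g, h)\<in>set ps. cl g \<noteq> cl h"
    "mset (concat (map (\<lambda>(g, h). [g, h]) ps)) \<subseteq># T"
    using disjoint_pairs_by_key[of r T cl] T(2,3) r by auto
  have "g \<in># S \<and> h \<in># S" if "(g, h) \<in> set ps" for g h
  proof -
    have "[g, h] \<in> (\<lambda>(g, h). [g, h]) ` set ps" using that by (rule rev_image_eqI) simp
    then have "g \<in># mset (concat (map (\<lambda>(g, h). [g, h]) ps))" "h \<in># mset (concat (map (\<lambda>(g, h). [g, h]) ps))"
      unfolding set_mset_mset set_concat set_map by (meson UN_I list.set_intros)+
    then show ?thesis using ps(3) T(1) by (meson in_diffD mset_subset_eqD)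
  qed
  then have "\<forall>(g, h)\<in>set ps. \<not> comm g h" using ps(2) not_comm_of_cl_neq id by fast
  then have "nres q (vals (mset (concat (map (\<lambda>(g, h). [g, h]) ps)))) = q"
    using full_of_noncomm_pairs ps(1) r by simp
  then show ?thesis using splits_of_full[OF S V] ps(3) T(1) subset_mset.order_trans by blast
qed

section \<open>Product-one subsequences among terms of total exponent zero\<close>

definition zsums :: "(int \<times> nat) multiset \<Rightarrow> int set" where
  "zsums U = (\<Union>V\<in>{V. V \<subseteq># U \<and> p dvd dg V}. vals V)"

text \<open>The values of the cyclic rotations of one ordering are already pairwise distinct.\<close>

lemma nres_minimal_zero_deg:
  assumes B: "p dvd dg B" and min: "\<And>V. V \<subset># B \<Longrightarrow> V \<noteq> {#} \<Longrightarrow> \<not> p dvd dg V"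
    and none: "\<not> one B"
  shows "size B \<le> nres q (vals B)"
proof -
  obtain l where l: "mset l = B" using ex_mset by blast
  define w where "w = (\<lambda>i. val (drop i l @ take i l))"
  have wB: "w i \<in> vals B" for i
    unfolding w_def by (rule valsI) (metis append_take_drop_id l mset_append union_commute)
  have degl: "p dvd deg l" using B l by (metis dg_mset)
  \<comment> \<open>A rotation conjugates the product by a prefix. The product is a translation, so
    its value is merely scaled by a power of \<open>s\<close>.\<close>
  have wv: "[s ^ deg (take i l) * w i = val l] (mod int q)" for i
  proof -
    have e: "deg (take i l) + deg (drop i l) = deg l"
      by (metis append_take_drop_id deg_simps(3))
    have "s ^ deg (take i l) * w i
      = s ^ deg (take i l) * val (drop i l) + s ^ deg l * val (take i l)"
      unfolding w_def val_append e[symmetric] by (simp add: algebra_simps power_add)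
    also have "[\<dots> = s ^ deg (take i l) * val (drop i l) + 1 * val (take i l)] (mod int q)"
      using s_pow_cong_1[OF degl] by (intro cong_add cong_mult) auto
    also have "s ^ deg (take i l) * val (drop i l) + 1 * val (take i l) = val l"
      using val_append[of "take i l" "drop i l"] by simp
    finally show ?thesis .
  qed
  have nv: "\<not> [val l = 0] (mod int q)"
    using none B valsI[OF l] unfolding one_def by (auto simp: cong_0_iff)
  have "inj_on (\<lambda>i. w i mod int q) {..<length l}"
  proof (rule linorder_inj_onI)
    fix i j assume ij: "i < j" "i \<in> {..<length l}" "j \<in> {..<length l}"
    show "w i mod int q \<noteq> w j mod int q"
    proof
      assume "w i mod int q = w j mod int q"
      then have "[w i = w j] (mod int q)" by (simp add: cong_def)
      then have 1: "[s ^ deg (take i l) * w i = s ^ deg (take i l) * w j] (mod int q)"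
        by (intro cong_mult) auto
      have "[s ^ deg (take j l) * w j = s ^ deg (take i l) * w j] (mod int q)"
        using cong_trans[OF cong_trans[OF wv[of j] cong_sym[OF wv[of i]]] 1] .
      moreover have "\<not> [w j = 0] (mod int q)"
      proof
        assume "[w j = 0] (mod int q)"
        then have "[s ^ deg (take j l) * w j = s ^ deg (take j l) * 0] (mod int q)"
          by (intro cong_mult) auto
        then have "[val l = 0] (mod int q)" using cong_trans[OF cong_sym[OF wv[of j]]] by simp
        then show False using nv by simp
      qed
      then have "coprime (w j) (int q)"
        using q by (metis cong_0_iff coprime_commute prime_imp_coprime prime_nat_int_transfer)
      ultimately have "[s ^ deg (take j l) = s ^ deg (take i l)] (mod int q)"
        using cong_mult_rcancel by blast
      then have c: "[deg (take j l) = deg (take i l)] (mod p)" by (simp add: s_pow_cong_iff)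
      \<comment> \<open>Equal values at \<open>i\<close> and \<open>j\<close> make the exponent of
        the part in between a multiple of \<open>p\<close>, against the minimality of
        \<open>B\<close>.\<close>
      define m where "m = drop i (take j l)"
      have tj: "take j l = take i l @ m"
        unfolding m_def using ij by (metis append_take_drop_id min.absorb1 less_imp_le_nat take_take)
      have "[deg (take i l) + deg m = deg (take i l) + 0] (mod p)" using c tj by simp
      then have "p dvd deg m" by (simp only: cong_add_lcancel_nat cong_0_iff)
      moreover have "mset m \<noteq> {#}" unfolding m_def using ij by auto
      moreover have "mset m \<subset># B"
      proof -
        have "l = take i l @ m @ drop j l" using tj by (metis append.assoc append_take_drop_id)
        then have "B = mset m + (mset (take i l) + mset (drop j l))"
          using l by (metis mset_append union_assoc union_commute)
        moreover have "mset (drop j l) \<noteq> {#}" using ij by simp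
        ultimately have "B - mset m \<noteq> {#}" "mset m \<subseteq># B" by simp_all
        then show ?thesis by (metis cancel_comm_monoid_add_class.diff_cancel subset_mset.le_neq_trans)
      qed
      ultimately show False using min[of "mset m"] by simp
    qed
  qed (simp add: linorder_linear)
  then have "card ((\<lambda>i. w i mod int q) ` {..<length l}) = size B"
    using l by (auto simp: card_image)
  moreover have "card ((\<lambda>i. w i mod int q) ` {..<length l}) \<le> nres q (vals B)"
    unfolding nres_def using wB by (intro card_mono finite_residues[OF q_pos]) auto
  ultimately show ?thesis by simp
qed

lemma minimal_zero_deg_exists:
  assumes "p dvd dg U" "U \<noteq> {#}"
  obtains B where "B \<subseteq># U" "B \<noteq> {#}" "p dvd dg B" "\<And>V. V \<subset># B \<Longrightarrow> V \<noteq> {#} \<Longrightarrow> \<not> p dvd dg V"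
proof -
  let ?P = "\<lambda>B. B \<subseteq># U \<and> B \<noteq> {#} \<and> p dvd dg B"
  have "?P U" using assms by simp
  then obtain B where B: "?P B" and least: "\<And>V. ?P V \<Longrightarrow> size B \<le> size V"
    using ex_has_least_nat[of ?P U size] by blast
  show thesis
  proof (rule that)
    fix V assume V: "V \<subset># B" "V \<noteq> {#}"
    then have "size V < size B" by (simp add: mset_subset_size)
    moreover have "V \<subseteq># U" using V(1) B by (meson subset_mset.less_imp_le subset_mset.order_trans)
    ultimately show "\<not> p dvd dg V" using least V(2) by (meson leD)
  qed (use B in auto)
qed

text \<open>Pieces whose exponent sum is divisible by \<open>p\<close> have trivial linear part, so
  their values simply add. The second form keeps track of \<open>B\<close>, by which the resulting
  subsequence is later seen to be nonempty.\<close>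

lemma zsums_plus:
  assumes "a \<in> zsums U" "b \<in> vals B" "p dvd dg B"
  shows "\<exists>c\<in>zsums (U + B). [a + b = c] (mod int q)"
    and "\<exists>V. B \<subseteq># V \<and> V \<subseteq># U + B \<and> p dvd dg V \<and> (\<exists>c\<in>vals V. [a + b = c] (mod int q))"
proof -
  obtain V where V: "V \<subseteq># U" "p dvd dg V" "a \<in> vals V" using assms(1) unfolding zsums_def by blast
  have c: "a + s ^ dg V * b \<in> vals (V + B)" using vals_plus[OF V(3) assms(2)] .
  have "[a + s ^ dg V * b = a + 1 * b] (mod int q)"
    using s_pow_cong_1[OF V(2)] by (intro cong_add cong_mult) auto
  then have cg: "[a + b = a + s ^ dg V * b] (mod int q)" by (simp add: cong_sym)
  have VB: "B \<subseteq># V + B" "V + B \<subseteq># U + B" "p dvd dg (V + B)" using V assms(3) by auto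
  show "\<exists>c\<in>zsums (U + B). [a + b = c] (mod int q)"
    using c cg VB unfolding zsums_def by blast
  show "\<exists>V. B \<subseteq># V \<and> V \<subseteq># U + B \<and> p dvd dg V \<and> (\<exists>c\<in>vals V. [a + b = c] (mod int q))"
    using c cg VB by blast
qed

lemma zsums_0: "0 \<in> zsums U"
proof -
  have "val [] \<in> vals {#}" by (rule valsI) simp
  then show ?thesis unfolding zsums_def by (intro UN_I[of "{#}"]) auto
qed

lemma zsums_mono: "U \<subseteq># U' \<Longrightarrow> zsums U \<subseteq> zsums U'"
  unfolding zsums_def using subset_mset.order_trans by blast

text \<open>Peel off a minimal nonempty block \<open>B\<close> of exponent zero. It has at least
  \<open>size B\<close> values, none of them 0 since \<open>B\<close> is not product-one. Adding 0
  for the option to leave \<open>B\<close> out, Cauchy-Davenport gains \<open>size B\<close>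
  residues.\<close>

lemma nres_zsums:
  assumes "p dvd dg U" "\<And>V. V \<subseteq># U \<Longrightarrow> V \<noteq> {#} \<Longrightarrow> \<not> one V"
  shows "min q (1 + size U) \<le> nres q (zsums U)"
  using assms
proof (induction "size U" arbitrary: U rule: less_induct)
  case less
  show ?case
  proof (cases "U = {#}")
    case True
    have "zsums U \<noteq> {}" using zsums_0 by blast
    then show ?thesis using nres_pos[OF q_pos, of "zsums U"] True by simp
  next
    case False
    obtain B where B: "B \<subseteq># U" "B \<noteq> {#}" "p dvd dg B"
      "\<And>V. V \<subset># B \<Longrightarrow> V \<noteq> {#} \<Longrightarrow> \<not> p dvd dg V"
      using minimal_zero_deg_exists[OF less.prems(1) False] by blast
    define U' where "U' = U - B"
    have U: "U = U' + B" unfolding U'_def using B(1) by simp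
    have "p dvd dg U'" using less.prems(1) B(3) unfolding U by (simp add: dvd_add_left_iff)
    moreover have "size U' < size U" using B(2) unfolding U by (simp add: nonempty_has_size)
    moreover have "\<not> one V" if "V \<subseteq># U'" "V \<noteq> {#}" for V
      using less.prems(2) that U by (metis mset_subset_eq_add_left subset_mset.order_trans)
    ultimately have IH: "min q (1 + size U') \<le> nres q (zsums U')" using less.hyps by blast
    have nB: "\<not> one B" using less.prems(2) B by blast
    have "size B \<le> nres q (vals B)" using nres_minimal_zero_deg[OF B(3) B(4) nB] by blast
    moreover have "nres q (insert 0 (vals B)) = Suc (nres q (vals B))"
      using nB B(3) unfolding one_def by (intro nres_less_insert[OF q_pos]) (auto simp: cong_0_iff)
    moreover have "min q (nres q (zsums U') + nres q (insert 0 (vals B)) - 1) \<le> nres q (zsums U)"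
    proof (rule cauchy_davenport[OF q])
      show "zsums U' \<noteq> {}" using zsums_0 by blast
      fix a b assume a: "a \<in> zsums U'" and b: "b \<in> insert 0 (vals B)"
      show "\<exists>c\<in>zsums U. [a + b = c] (mod int q)"
      proof (cases "b = 0")
        case True
        have "a \<in> zsums U" using a zsums_mono[of U' U] U by auto
        then show ?thesis using True cong_refl by force
      next
        case False
        then show ?thesis using zsums_plus(1)[OF a _ B(3)] b U by auto
      qed
    qed simp
    ultimately show ?thesis using IH U by (auto simp: min_def split: if_splits)
  qed
qed

text \<open>The analogue of the Davenport constant \<open>q\<close> of the translation group. One
  block \<open>B\<close> is forced to be used: the values available without it and the negated
  values of \<open>B\<close> together number more than \<open>q\<close>, so they meet. Forcing
  \<open>B\<close> keeps the empty subsequence out.\<close>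

lemma exists_one_of_size:
  assumes "p dvd dg U" "q \<le> size U"
  shows "\<exists>V. V \<subseteq># U \<and> V \<noteq> {#} \<and> one V"
proof (rule ccontr)
  assume n: "\<not> ?thesis"
  have "U \<noteq> {#}" using assms(2) q_pos by auto
  obtain B where B: "B \<subseteq># U" "B \<noteq> {#}" "p dvd dg B"
    "\<And>V. V \<subset># B \<Longrightarrow> V \<noteq> {#} \<Longrightarrow> \<not> p dvd dg V"
    using minimal_zero_deg_exists[OF assms(1) \<open>U \<noteq> {#}\<close>] by blast
  define U' where "U' = U - B"
  have U: "U = U' + B" unfolding U'_def using B(1) by simp
  have "p dvd dg U'" using assms(1) B(3) unfolding U by (simp add: dvd_add_left_iff)
  moreover have "\<not> one V" if "V \<subseteq># U'" "V \<noteq> {#}" for V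
    using n that U by (metis mset_subset_eq_add_left subset_mset.order_trans)
  ultimately have "min q (1 + size U') \<le> nres q (zsums U')" using nres_zsums by blast
  moreover have "size B \<le> nres q (vals B)" using nres_minimal_zero_deg[OF B(3) B(4)] n B by blast
  moreover have "nres q ((\<lambda>x. (- 1) * x + 0) ` vals B) = nres q (vals B)"
    using q_pos by (intro nres_affine) auto
  moreover have "size B \<ge> 1" using B(2) by (simp add: Suc_leI nonempty_has_size)
  ultimately have "nres q (zsums U') + nres q ((\<lambda>x. (- 1) * x + 0) ` vals B) > q"
    using assms(2) U by auto
  then obtain a b' where ab': "a \<in> zsums U'" "b' \<in> (\<lambda>x. (- 1) * x + 0) ` vals B" "[a = b'] (mod int q)"
    by (rule nres_pigeonhole[OF q_pos])
  then obtain b where ab: "a \<in> zsums U'" "b \<in> vals B" "[a = - b] (mod int q)" by auto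
  obtain V c where V: "B \<subseteq># V" "V \<subseteq># U" "p dvd dg V" "c \<in> vals V" "[a + b = c] (mod int q)"
    using zsums_plus(2)[OF ab(1,2) B(3)] U by blast
  have "[a + b = - b + b] (mod int q)" using ab(3) by (intro cong_add) auto
  then have "[c = 0] (mod int q)" using cong_trans[OF cong_sym[OF V(5)]] by simp
  then have "one V" using V unfolding one_def by (auto simp: cong_0_iff)
  moreover have "V \<noteq> {#}" using V(1) B(2) by auto
  ultimately show False using n V(2) by blast
qed

text \<open>Pigeonhole on the exponents of the \<open>p + 1\<close> prefixes of length 0 to
  \<open>p\<close>.\<close>

lemma zero_deg_sublist_exists:
  assumes "p \<le> length l"
  obtains a m b where "l = a @ m @ b" "m \<noteq> []" "length m \<le> p" "p dvd deg m"
proof -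
  let ?f = "\<lambda>i. deg (take i l) mod p"
  have "?f ` {..p} \<subseteq> {..<p}" using p_pos by auto
  then have "card (?f ` {..p}) \<le> card {..<p}" by (intro card_mono) auto
  then have "\<not> inj_on ?f {..p}" using pigeonhole[of ?f "{..p}"] by simp
  then obtain i j where ij: "i < j" "j \<le> p" "?f i = ?f j"
    unfolding inj_on_def by (metis atMost_iff linorder_neqE_nat)
  define m where "m = drop i (take j l)"
  have tj: "take j l = take i l @ m"
    unfolding m_def using ij by (metis append_take_drop_id min.absorb1 less_imp_le_nat take_take)
  have "[deg (take i l) + deg m = deg (take i l) + 0] (mod p)" using ij(3) tj by (simp add: cong_def)
  then have "p dvd deg m" by (simp only: cong_add_lcancel_nat cong_0_iff)
  moreover have "m \<noteq> []" "length m \<le> p" unfolding m_def using ij assms by auto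
  moreover have "l = take i l @ m @ drop j l" using tj by (metis append.assoc append_take_drop_id)
  ultimately show thesis using that by blast
qed

lemma zero_deg_sub_exists:
  assumes "p \<le> size M"
  obtains V where "V \<subseteq># M" "V \<noteq> {#}" "size V \<le> p" "p dvd dg V"
proof -
  obtain l where l: "mset l = M" using ex_mset by blast
  then have "p \<le> length l" using assms by auto
  then obtain a m b where m: "l = a @ m @ b" "m \<noteq> []" "length m \<le> p" "p dvd deg m"
    by (rule zero_deg_sublist_exists)
  then have "M = mset m + (mset a + mset b)" using l by (auto simp: union_lcomm)
  then show thesis using that[of "mset m"] m by simp
qed

text \<open>All these maps fix \<open>f\<close>, hence so does their composition, which determines
  its translation part.\<close>

lemma val_same_class:
  assumes "\<And>g. g \<in> set l \<Longrightarrow> \<not> p dvd snd g \<and> cl g = f"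
  shows "[val l = f * (1 - s ^ deg l)] (mod int q)"
  using assms
proof (induction l)
  case (Cons g l)
  have "[fst g = f * (1 - s ^ snd g)] (mod int q)" using cl_nonneg_spec(2)[of g] Cons.prems by auto
  moreover have "[val l = f * (1 - s ^ deg l)] (mod int q)" using Cons by simp
  ultimately have "[fst g + s ^ snd g * val l
      = f * (1 - s ^ snd g) + s ^ snd g * (f * (1 - s ^ deg l))] (mod int q)"
    by (intro cong_add cong_mult) auto
  also have "f * (1 - s ^ snd g) + s ^ snd g * (f * (1 - s ^ deg l)) = f * (1 - s ^ deg (g # l))"
    by (simp add: algebra_simps power_add)
  finally show ?case by (simp add: val_Cons)
qed simp

lemma one_same_class:
  assumes "\<And>g. g \<in># V \<Longrightarrow> \<not> p dvd snd g \<and> cl g = f" "p dvd dg V"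
  shows "one V"
proof -
  obtain l where l: "mset l = V" using ex_mset by blast
  have 1: "[val l = f * (1 - s ^ deg l)] (mod int q)" using val_same_class assms(1) l by (metis set_mset_mset)
  have "p dvd deg l" using assms(2) l by (metis dg_mset)
  then have "[f * (1 - s ^ deg l) = f * (1 - 1)] (mod int q)"
    by (intro cong_mult cong_diff cong_refl s_pow_cong_1)
  then have "[val l = 0] (mod int q)" using cong_trans[OF 1] by simp
  then show ?thesis unfolding one_def using valsI[OF l] assms(2) by (auto simp: cong_0_iff)
qed

lemma one_in_class:
  assumes "p \<le> size M" "\<And>g. g \<in># M \<Longrightarrow> \<not> p dvd snd g \<and> cl g = f"
  obtains V where "V \<subseteq># M" "V \<noteq> {#}" "size V \<le> p" "one V"
proof -
  obtain V where V: "V \<subseteq># M" "V \<noteq> {#}" "size V \<le> p" "p dvd dg V"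
    using zero_deg_sub_exists[OF assms(1)] by blast
  have "one V" using V(1,4) assms(2) by (intro one_same_class) (auto dest: mset_subset_eqD)
  then show thesis using that V by blast
qed

text \<open>A smallest candidate with \<open>k + p\<close> or more terms could still lose a nonempty
  piece of at most \<open>p\<close> terms whose exponent sum is divisible by
  \<open>p\<close>.\<close>

lemma zero_deg_sub_size:
  assumes "p dvd dg M" "k \<le> size M"
  obtains W where "W \<subseteq># M" "p dvd dg W" "k \<le> size W" "size W < k + p"
proof -
  let ?P = "\<lambda>B. B \<subseteq># M \<and> k \<le> size B \<and> p dvd dg B"
  have "?P M" using assms by simp
  then obtain W where W: "?P W" and least: "\<And>V. ?P V \<Longrightarrow> size W \<le> size V"
    using ex_has_least_nat[of ?P M size] by blast
  have "size W < k + p"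
  proof (rule ccontr)
    assume big: "\<not> size W < k + p"
    then obtain V where V: "V \<subseteq># W" "V \<noteq> {#}" "size V \<le> p" "p dvd dg V"
      using zero_deg_sub_exists[of W] by auto
    have sz: "size (W - V) = size W - size V" using V(1) by (rule size_Diff_submset)
    have "dg W = dg V + dg (W - V)" using V(1) by (metis dg_simps(3) subset_mset.add_diff_inverse)
    then have "p dvd dg (W - V)" using V W by (metis dvd_add_right_iff)
    moreover have "W - V \<subseteq># M" using W by (meson diff_subset_eq_self subset_mset.order_trans)
    moreover have "k \<le> size (W - V)" using sz big V(3) by simp
    ultimately have "size W \<le> size (W - V)" using least by blast
    moreover have "size V > 0" using V(2) by (simp add: nonempty_has_size)
    ultimately show False using sz V(1) size_mset_mono[OF V(1)] by simp
  qed
  then show thesis using that W by blast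
qed

end

section \<open>Runs, splittings and choices in lists\<close>

text \<open>The terms outside \<open>P\<close> separate the others into at most one run more than
  their own number.\<close>

lemma filter_run_bound:
  fixes n :: nat
  assumes "\<And>a m b. l = a @ m @ b \<Longrightarrow> \<forall>x\<in>set m. P x \<Longrightarrow> length m \<le> n"
  shows "length (filter P l) \<le> n * (length (filter (\<lambda>x. \<not> P x) l) + 1)"
  using assms
proof (induction l rule: length_induct)
  case (1 l)
  let ?m = "takeWhile P l"
  have m: "length ?m \<le> n"
    using "1.prems"[of "[]" ?m "dropWhile P l"] by (auto dest: set_takeWhileD)
  show ?case
  proof (cases "dropWhile P l")
    case Nil
    then have "l = ?m" by (metis append_Nil2 takeWhile_dropWhile_id)
    then have "length (filter P l) \<le> length ?m" by (metis length_filter_le)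
    then show ?thesis using m by simp
  next
    case (Cons x r)
    then have l: "l = ?m @ x # r" by (metis takeWhile_dropWhile_id)
    have nx: "\<not> P x" using Cons by (metis dropWhile_eq_Cons_conv)
    have "length r < length l" by (subst l) simp
    moreover have "length m' \<le> n" if "r = a @ m' @ b" "\<forall>x\<in>set m'. P x" for a m' b
      using "1.prems"[of "?m @ x # a" m' b] that l by auto
    ultimately have "length (filter P r) \<le> n * (length (filter (\<lambda>x. \<not> P x) r) + 1)"
      using "1.IH" by blast
    moreover have "length (filter P l) \<le> length ?m + length (filter P r)"
      by (subst l) (use nx in simp)
    moreover have "length (filter (\<lambda>x. \<not> P x) l) = Suc (length (filter (\<lambda>x. \<not> P x) r))"
    proof -
      have "filter (\<lambda>x. \<not> P x) ?m = []" by (auto simp: filter_empty_conv dest: set_takeWhileD)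
      then show ?thesis using nx by (subst l) simp
    qed
    ultimately show ?thesis using m by simp
  qed
qed

lemma filter_append_split:
  "filter P l = a @ b \<Longrightarrow> \<exists>l1 l2. l = l1 @ l2 \<and> filter P l1 = a \<and> filter P l2 = b"
proof (induction l arbitrary: a)
  case (Cons x l)
  show ?case
  proof (cases "a = []")
    case True
    then show ?thesis using Cons.prems by (intro exI[of _ "[]"] exI[of _ "x # l"]) simp
  next
    case False
    define a' where "a' = (if P x then tl a else a)"
    have "filter P l = a' @ b" using Cons.prems False unfolding a'_def by (cases a) (auto split: if_splits)
    then obtain l1 l2 where "l = l1 @ l2" "filter P l1 = a'" "filter P l2 = b" using Cons.IH by blast
    moreover have "filter P [x] @ a' = a"
      using Cons.prems False unfolding a'_def by (cases a) (auto split: if_splits)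
    ultimately show ?thesis by (intro exI[of _ "x # l1"] exI[of _ l2]) (auto split: if_splits)
  qed
qed simp

text \<open>Switching between the members of a pair varies an exponent sum or a value while the
  number of terms stays fixed.\<close>

definition choices :: "('a \<times> 'a) list \<Rightarrow> 'a list set" where
  "choices ps = {c. list_all2 (\<lambda>x gh. x = fst gh \<or> x = snd gh) c ps}"

lemma choices_Nil [simp]: "choices [] = {[]}"
  unfolding choices_def by auto

lemma choices_ConsI: "c \<in> choices ps \<Longrightarrow> x = g \<or> x = h \<Longrightarrow> x # c \<in> choices ((g, h) # ps)"
  unfolding choices_def by simp

lemma choices_length: "c \<in> choices ps \<Longrightarrow> length c = length ps"
  unfolding choices_def by (auto dest: list_all2_lengthD)

lemma choices_subset: "c \<in> choices ps \<Longrightarrow> mset c \<subseteq># mset (concat (map (\<lambda>(g, h). [g, h]) ps))"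
proof -
  assume "c \<in> choices ps"
  then have "list_all2 (\<lambda>x gh. x = fst gh \<or> x = snd gh) c ps" unfolding choices_def by simp
  then show ?thesis
  proof (induction rule: list_all2_induct)
    case (Cons x c gh ps)
    obtain g h where gh: "gh = (g, h)" by (cases gh)
    have "mset [x] \<subseteq># mset [g, h]" using Cons(1) gh by auto
    from subset_mset.add_mono[OF this Cons(3)] show ?case unfolding gh by simp
  qed simp
qed

lemma choices_nonempty: "choices ps \<noteq> {}"
proof (induction ps)
  case (Cons gh ps)
  then show ?case using choices_ConsI[of _ ps _ "fst gh" "snd gh"] by (cases gh) auto
qed simp

section \<open>Value sets from hosts, stars and choices\<close>

context affine_model
begin

text \<open>Translations are inserted in all possible ways into a fixed list \<open>hs\<close> of non-translations;
  \<open>stops hs\<close> are the factors by which a translation is scaled at the possible places.\<close>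

definition hosted :: "(int \<times> nat) list \<Rightarrow> (int \<times> nat) multiset \<Rightarrow> int set" where
  "hosted hs X = val ` {l. filter (\<lambda>g. \<not> p dvd snd g) l = hs \<and> mset l = mset hs + X}"

definition stops :: "(int \<times> nat) list \<Rightarrow> int set" where
  "stops hs = (\<lambda>j. s ^ deg (take j hs)) ` {..length hs}"

lemma deg_filter_cong: "[deg (filter (\<lambda>g. \<not> p dvd snd g) l) = deg l] (mod p)"
proof (induction l)
  case (Cons g l)
  show ?case
  proof (cases "p dvd snd g")
    case True
    then have "[0 + deg (filter (\<lambda>g. \<not> p dvd snd g) l) = snd g + deg l] (mod p)"
      by (intro cong_add Cons) (simp add: cong_0_iff cong_sym_eq[of 0])
    then show ?thesis using True by simp
  next
    case False
    then show ?thesis using Cons by (simp add: cong_add_lcancel_nat)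
  qed
qed simp

text \<open>A translation inserted behind \<open>j\<close> hosts contributes its entry times
  \<open>s ^ deg (take j hs)\<close>, wherever the other translations stand, because they have
  trivial linear part. So each translation adds a dilate of \<open>stops hs\<close>, and
  Cauchy-Davenport applies.\<close>

lemma nres_hosted:
  assumes hs: "\<forall>h\<in>set hs. \<not> p dvd snd h" and X: "\<forall>g\<in>#X. p dvd snd g \<and> \<not> int q dvd fst g"
  shows "min q (1 + (nres q (stops hs) - 1) * size X) \<le> nres q (hosted hs X)"
  using X
proof (induction X)
  case empty
  have "val hs \<in> hosted hs {#}" unfolding hosted_def using hs by (auto intro!: image_eqI[of _ _ hs] filter_True)
  then have "1 \<le> nres q (hosted hs {#})" by (intro nres_pos[OF q_pos]) auto
  then show ?case by simp
next
  case (add x X)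
  have x: "p dvd snd x" "\<not> int q dvd fst x" using add.prems by auto
  have "coprime (fst x) (int q)"
    using q x by (metis coprime_commute prime_imp_coprime prime_nat_int_transfer)
  then have e: "nres q ((\<lambda>v. fst x * v + 0) ` stops hs) = nres q (stops hs)"
    by (rule nres_affine[OF q_pos])
  have st: "stops hs \<noteq> {}" unfolding stops_def by auto
  have IH: "min q (1 + (nres q (stops hs) - 1) * size X) \<le> nres q (hosted hs X)" using add by simp
  then have "1 \<le> nres q (hosted hs X)" using q_pos by simp
  then have ne: "hosted hs X \<noteq> {}" unfolding nres_def by (intro notI) simp
  have "min q (nres q (hosted hs X) + nres q ((\<lambda>v. fst x * v + 0) ` stops hs) - 1)
    \<le> nres q (hosted hs (add_mset x X))"
  proof (rule cauchy_davenport[OF q ne])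
    show "(\<lambda>v. fst x * v + 0) ` stops hs \<noteq> {}" using st by simp
    fix a b assume a: "a \<in> hosted hs X" and b: "b \<in> (\<lambda>v. fst x * v + 0) ` stops hs"
    obtain l where l: "filter (\<lambda>g. \<not> p dvd snd g) l = hs" "mset l = mset hs + X" "a = val l"
      using a unfolding hosted_def by auto
    obtain j where j: "b = fst x * s ^ deg (take j hs)" using b unfolding stops_def by auto
    have "filter (\<lambda>g. \<not> p dvd snd g) l = take j hs @ drop j hs" using l(1) by simp
    then obtain l1 l2 where l12: "l = l1 @ l2" "filter (\<lambda>g. \<not> p dvd snd g) l1 = take j hs"
      "filter (\<lambda>g. \<not> p dvd snd g) l2 = drop j hs"
      using filter_append_split by blast
    have dl1: "[s ^ deg (take j hs) = s ^ deg l1] (mod int q)"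
      using deg_filter_cong[of l1] l12(2) by (intro s_pow_cong) simp
    define l' where "l' = l1 @ x # l2"
    have "val l' \<in> hosted hs (add_mset x X)"
      unfolding hosted_def l'_def using l l12 x(1) by (intro imageI) auto
    moreover have "[a + b = val l'] (mod int q)"
    proof -
      have "[val l + s ^ deg (take j hs) * fst x = val l + s ^ deg l1 * fst x] (mod int q)"
        by (intro cong_add cong_mult dl1 cong_refl)
      also have "val l + s ^ deg l1 * fst x = val l1 + s ^ deg l1 * (fst x + 1 * val l2)"
        unfolding l12(1) val_append by (simp add: algebra_simps)
      also have "[val l1 + s ^ deg l1 * (fst x + 1 * val l2)
        = val l1 + s ^ deg l1 * (fst x + s ^ snd x * val l2)] (mod int q)"
        by (intro cong_add cong_mult cong_refl cong_sym[OF s_pow_cong_1[OF x(1)]])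
      finally show ?thesis unfolding l'_def l(3) j by (simp add: val_append val_Cons algebra_simps)
    qed
    ultimately show "\<exists>c\<in>hosted hs (add_mset x X). [a + b = c] (mod int q)" by blast
  qed
  moreover have "1 \<le> nres q (stops hs)" using nres_pos[OF q_pos st] .
  ultimately show ?case using IH e by (auto simp: min_def split: if_splits)
qed

lemma nres_vals_hosted:
  assumes "\<forall>h\<in>set hs. \<not> p dvd snd h" "\<forall>g\<in>#X. p dvd snd g \<and> \<not> int q dvd fst g"
    "q \<le> 1 + (nres q (stops hs) - 1) * size X"
  shows "nres q (vals (mset hs + X)) = q"
proof -
  have "hosted hs X \<subseteq> vals (mset hs + X)" unfolding hosted_def vals_def by auto
  then have "nres q (hosted hs X) \<le> nres q (vals (mset hs + X))" by (rule nres_mono[OF q_pos])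
  then show ?thesis using nres_hosted[OF assms(1,2)] assms(3) nres_le[OF q_pos, of "vals (mset hs + X)"]
    by auto
qed

lemma nres_stops_single: "\<not> p dvd snd h \<Longrightarrow> nres q (stops [h]) = 2"
proof -
  assume "\<not> p dvd snd h"
  moreover have "{..Suc 0} = {0, 1}" by auto
  ultimately show ?thesis unfolding stops_def
    using nres_two[of 1 "s ^ snd h" q] s_pow_eq_1_iff[of "snd h"] by (auto simp: cong_sym_eq)
qed

text \<open>Three stops instead of two halve the number of translations needed, from
  \<open>q - 1\<close> to \<open>(q - 1) / 2\<close>. For non-translations this requires exponents
  that are not opposite.\<close>

lemma nres_stops_two:
  assumes "\<not> p dvd snd g" "\<not> p dvd snd h" "\<not> p dvd snd g + snd h"
  shows "nres q (stops [g, h]) = 3"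
proof -
  have "{..Suc (Suc 0)} = {0, 1, 2}" by auto
  then have eq: "stops [g, h] = {1, s ^ snd g, s ^ (snd g + snd h)}"
    unfolding stops_def by (simp add: numeral_2_eq_2)
  have "\<not> [snd g + snd h = snd g] (mod p)"
    using assms(2) by (metis cong_0_iff cong_add_lcancel_0_nat)
  then show ?thesis unfolding eq
    using assms s_pow_eq_1_iff s_pow_cong_iff by (intro nres_three) (metis cong_sym)+
qed

text \<open>Modulo \<open>q\<close> the affine map with multiplier \<open>s ^ t\<close> has order
  \<open>p\<close> and one fixed point; the orbit of any other point has \<open>p\<close>
  elements.\<close>

lemma affine_orbit_card:
  assumes Z: "Z \<subseteq> {0..<int q}" and t: "\<not> p dvd t"
    and cl: "\<And>z. z \<in> Z \<Longrightarrow> (s ^ t * z + k) mod int q \<in> Z"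
    and z0: "z0 \<in> Z" "\<not> [(1 - s ^ t) * z0 = k] (mod int q)"
  shows "p \<le> card Z"
proof -
  define it where "it = rec_nat z0 (\<lambda>_ z. (s ^ t * z + k) mod int q)"
  have it0: "it 0 = z0" and itS: "\<And>i. it (Suc i) = (s ^ t * it i + k) mod int q" unfolding it_def by auto
  have itZ: "it i \<in> Z" for i by (induction i) (use z0 cl it0 itS in auto)
  define w where "w = (1 - s ^ t) * z0 - k"
  have inv: "[(1 - s ^ t) * it i - k = s ^ (t * i) * w] (mod int q)" for i
  proof (induction i)
    case (Suc i)
    have "[(1 - s ^ t) * it (Suc i) - k = (1 - s ^ t) * (s ^ t * it i + k) - k] (mod int q)"
      unfolding itS by (intro cong_diff cong_mult) (auto simp: cong_def)
    also have "(1 - s ^ t) * (s ^ t * it i + k) - k = s ^ t * ((1 - s ^ t) * it i - k)"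
      by (simp add: algebra_simps)
    also have "[s ^ t * ((1 - s ^ t) * it i - k) = s ^ t * (s ^ (t * i) * w)] (mod int q)"
      by (intro cong_mult Suc cong_refl)
    also have "s ^ t * (s ^ (t * i) * w) = s ^ (t * Suc i) * w" by (simp add: power_add)
    finally show ?case .
  qed (simp add: it0 w_def)
  have "\<not> int q dvd w" using z0(2) unfolding w_def by (simp add: cong_iff_dvd_diff)
  then have cw: "coprime w (int q)"
    using q by (metis coprime_commute prime_imp_coprime prime_nat_int_transfer)
  have "inj_on it {..<p}"
  proof (rule inj_onI)
    fix i j assume ij: "i \<in> {..<p}" "j \<in> {..<p}" "it i = it j"
    then have "[s ^ (t * i) * w = s ^ (t * j) * w] (mod int q)"
      using cong_trans[OF cong_sym[OF inv[of i]]] inv[of j] by metis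
    then have "[s ^ (t * i) = s ^ (t * j)] (mod int q)" using cw cong_mult_rcancel by blast
    then have "[t * i = t * j] (mod p)" by (simp add: s_pow_cong_iff)
    moreover have "coprime t p" using t p by (metis coprime_commute prime_imp_coprime)
    ultimately have "[i = j] (mod p)" by (simp add: cong_mult_lcancel_nat)
    then show "i = j" using ij by (simp add: cong_def)
  qed
  then have "p = card (it ` {..<p})" by (simp add: card_image)
  also have "\<dots> \<le> card Z" using itZ Z finite_subset by (intro card_mono) auto
  finally show ?thesis .
qed

text \<open>A new \<open>h\<close> can be appended, which translates the value set, or prepended,
  which applies an affine map with multiplier \<open>s ^ snd h\<close>. If no residue is gained, the
  new value set is invariant under an affine map of order \<open>p\<close>, so it has at least
  \<open>p\<close> residues or is a single fixed point. Two noncommuting terms exclude the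
  latter.\<close>

lemma nres_star:
  assumes g: "\<not> (p dvd snd g \<and> int q dvd fst g)" "cl g \<noteq> f"
    and hs: "\<And>h. h \<in> set hs \<Longrightarrow> \<not> p dvd snd h \<and> cl h = f"
  shows "min p (1 + length hs) \<le> nres q (vals (add_mset g (mset hs)))"
  using hs
proof (induction hs)
  case Nil
  then show ?case using nres_pos[OF q_pos vals_nonempty, of "{#g#}"] p_pos by simp
next
  case (Cons h hs)
  define M where "M = add_mset g (mset hs)"
  have eq: "add_mset g (mset (h # hs)) = M + {#h#}" unfolding M_def by simp
  have h: "\<not> p dvd snd h" "cl h = f" using Cons.prems by auto
  have IH: "min p (1 + length hs) \<le> nres q (vals M)" unfolding M_def using Cons by simp
  have "min p (1 + length (h # hs)) \<le> nres q (vals (M + {#h#}))"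
  proof (cases "p \<le> nres q (vals M) \<or> nres q (vals M) + 1 \<le> nres q (vals (M + {#h#}))")
    case True
    then show ?thesis using IH nres_vals_le_plus[of M "{#h#}"] by auto
  next
    case False
    define R where "R = (\<lambda>x. x mod int q) ` vals (M + {#h#})"
    define c where "c = s ^ dg M * fst h"
    have finR: "finite R" unfolding R_def by (rule finite_residues[OF q_pos])
    have cR: "card R \<le> nres q (vals M)" using False unfolding R_def nres_def by auto
    have 1: "(\<lambda>x. x mod int q) ` (\<lambda>x. x + c) ` vals M \<subseteq> R"
    proof -
      have "x + c \<in> vals (M + {#h#})" if "x \<in> vals M" for x
        using vals_plus[OF that valsI[of "[h]" "{#h#}"]] unfolding c_def by (simp add: val_Cons)
      then show ?thesis unfolding R_def by blast
    qed
    have R1: "(\<lambda>x. x mod int q) ` (\<lambda>x. x + c) ` vals M = R"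
      using cR nres_translate[OF q_pos, of c "vals M"] 1 finR
      by (intro card_seteq) (auto simp: nres_def)
    have closed: "(s ^ snd h * z + (fst h - s ^ snd h * c)) mod int q \<in> R" if z: "z \<in> R" for z
    proof -
      obtain x where x: "x \<in> vals M" "z = (x + c) mod int q" using z R1 by blast
      have "[s ^ snd h * z + (fst h - s ^ snd h * c) = s ^ snd h * (x + c) + (fst h - s ^ snd h * c)] (mod int q)"
        unfolding x(2) by (intro cong_add cong_mult) (auto simp: cong_def)
      also have "s ^ snd h * (x + c) + (fst h - s ^ snd h * c) = fst h + s ^ snd h * x"
        by (simp add: algebra_simps)
      finally have "(s ^ snd h * z + (fst h - s ^ snd h * c)) mod int q = (fst h + s ^ snd h * x) mod int q"
        by (simp add: cong_def)
      moreover have "fst h + s ^ snd h * x \<in> vals ({#h#} + M)"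
        using vals_plus[OF valsI[of "[h]" "{#h#}"] x(1)] by (simp add: val_Cons)
      ultimately show ?thesis unfolding R_def by (metis image_eqI union_commute)
    qed
    have RR: "R \<subseteq> {0..<int q}" unfolding R_def using q_pos by auto
    have fixed: "[(1 - s ^ snd h) * z = fst h - s ^ snd h * c] (mod int q)" if "z \<in> R" for z
    proof (rule ccontr)
      assume "\<not> ?thesis"
      from affine_orbit_card[OF RR h(1) closed that this] show False using cR False by simp
    qed
    have "card R \<le> 1"
    proof -
      have "z = z'" if "z \<in> R" "z' \<in> R" for z z'
      proof -
        have "[(1 - s ^ snd h) * z = (1 - s ^ snd h) * z'] (mod int q)"
          using fixed[OF that(1)] fixed[OF that(2)] cong_sym cong_trans by blast
        moreover have "\<not> int q dvd 1 - s ^ snd h"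
          using h(1) s_pow_eq_1_iff[of "snd h"] by (metis cong_iff_dvd_diff cong_sym)
        then have "coprime (1 - s ^ snd h) (int q)"
          using q by (metis coprime_commute prime_imp_coprime prime_nat_int_transfer)
        ultimately have "[z = z'] (mod int q)" using cong_mult_lcancel by blast
        moreover have "0 \<le> z" "z < int q" "0 \<le> z'" "z' < int q" using that RR by auto
        ultimately show ?thesis by (simp add: cong_def)
      qed
      then show ?thesis using finR by (simp add: card_le_Suc0_iff_eq)
    qed
    moreover have "nres q (vals M) \<le> card R"
      using nres_vals_le_plus[of M "{#h#}"] unfolding R_def nres_def by simp
    ultimately have "min p (1 + length hs) \<le> 1" using IH by simp
    then have "hs = []" using p_ge_3 by (cases hs) auto
    then have "M + {#h#} = {#g, h#}" unfolding M_def by (simp add: add_mset_commute)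
    moreover have "\<not> comm g h" using g h by (intro not_comm_of_cl_neq) auto
    ultimately have "2 \<le> card R" using nres_vals_noncomm_pair[of g h] unfolding R_def nres_def by metis
    then show ?thesis using \<open>card R \<le> 1\<close> by simp
  qed
  then show ?case unfolding eq .
qed

text \<open>Each \<open>g\<close> receives up to \<open>p - 1\<close> of the \<open>hs\<close>,
  where \<open>nres_star\<close> gains one residue per term; the stars are combined by
  Cauchy-Davenport.\<close>

lemma nres_stars:
  assumes "\<And>g. g \<in> set gs \<Longrightarrow> \<not> (p dvd snd g \<and> int q dvd fst g) \<and> cl g \<noteq> f"
    and "\<And>h. h \<in> set hs \<Longrightarrow> \<not> p dvd snd h \<and> cl h = f"
    and "length hs \<le> (p - 1) * length gs"
  shows "min q (1 + length hs) \<le> nres q (vals (mset gs + mset hs))"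
  using assms
proof (induction gs arbitrary: hs)
  case Nil
  then show ?case using nres_pos[OF q_pos vals_nonempty, of "{#}"] by simp
next
  case (Cons g gs)
  define h1 h2 where "h1 = take (p - 1) hs" and "h2 = drop (p - 1) hs"
  have h12: "hs = h1 @ h2" unfolding h1_def h2_def by simp
  have l1: "length h1 \<le> p - 1" unfolding h1_def by simp
  have l2: "length h2 \<le> (p - 1) * length gs" unfolding h2_def using Cons.prems(3) by simp
  have "min p (1 + length h1) \<le> nres q (vals (add_mset g (mset h1)))"
    using Cons.prems(1,2) h12 by (intro nres_star[where f = f]) auto
  then have 1: "1 + length h1 \<le> nres q (vals (add_mset g (mset h1)))" using l1 p_pos by auto
  have 2: "min q (1 + length h2) \<le> nres q (vals (mset gs + mset h2))"
    using Cons.prems h12 l2 by (intro Cons.IH) auto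
  have eq: "mset (g # gs) + mset hs = add_mset g (mset h1) + (mset gs + mset h2)"
    unfolding h12 by (simp add: union_lcomm)
  have "length hs = length h1 + length h2" unfolding h12 by simp
  then show ?case unfolding eq
    using nres_vals_plus[of "add_mset g (mset h1)" "mset gs + mset h2"] 1 2 by linarith
qed

lemma nres_choices_deg:
  assumes "\<forall>(g, h)\<in>set ps. \<not> [snd g = snd h] (mod p)"
  shows "min p (1 + length ps) \<le> nres p ((\<lambda>c. int (deg c)) ` choices ps)"
  using assms
proof (induction ps)
  case Nil
  then show ?case using p_pos by simp
next
  case (Cons gh ps)
  obtain g h where gh: "gh = (g, h)" by (cases gh)
  have "nres p {int (snd g), int (snd h)} = 2"
    using Cons.prems gh by (intro nres_two) (auto simp: cong_int_iff)
  moreover have "min p (nres p {int (snd g), int (snd h)} + nres p ((\<lambda>c. int (deg c)) ` choices ps) - 1)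
    \<le> nres p ((\<lambda>c. int (deg c)) ` choices (gh # ps))"
  proof (rule cauchy_davenport[OF p(1)])
    fix a b assume a: "a \<in> {int (snd g), int (snd h)}" and b: "b \<in> (\<lambda>c. int (deg c)) ` choices ps"
    obtain c where c: "c \<in> choices ps" "b = int (deg c)" using b by blast
    obtain x where x: "x = g \<or> x = h" "a = int (snd x)" using a by blast
    have "a + b = int (deg (x # c))" using x c by simp
    then show "\<exists>c\<in>(\<lambda>c. int (deg c)) ` choices (gh # ps). [a + b = c] (mod int p)"
      using choices_ConsI[OF c(1) x(1)] gh cong_refl by blast
  qed (use choices_nonempty in auto)
  ultimately show ?case using Cons by (auto simp: min_def split: if_splits)
qed

lemma nres_choices_val:
  assumes "\<forall>(g, h)\<in>set ps. \<not> [fst g = fst h] (mod int q) \<and> [snd g = t] (mod p) \<and> [snd h = t] (mod p)"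
  shows "min q (1 + length ps) \<le> nres q (val ` choices ps)"
  using assms
proof (induction ps)
  case Nil
  then show ?case using q_pos by simp
next
  case (Cons gh ps)
  obtain g h where gh: "gh = (g, h)" by (cases gh)
  have "nres q {fst g, fst h} = 2" using Cons.prems gh by (intro nres_two) auto
  moreover have "nres q ((\<lambda>v. s ^ t * v + 0) ` val ` choices ps) = nres q (val ` choices ps)"
    by (rule nres_affine[OF q_pos s_pow_coprime])
  moreover have "min q (nres q {fst g, fst h} + nres q ((\<lambda>v. s ^ t * v + 0) ` val ` choices ps) - 1)
    \<le> nres q (val ` choices (gh # ps))"
  proof (rule cauchy_davenport[OF q])
    fix a b assume a: "a \<in> {fst g, fst h}" and b: "b \<in> (\<lambda>v. s ^ t * v + 0) ` val ` choices ps"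
    obtain c where c: "c \<in> choices ps" "b = s ^ t * val c" using b by auto
    obtain x where x: "x = g \<or> x = h" "a = fst x" using a by blast
    have "[snd x = t] (mod p)" using x(1) Cons.prems gh by auto
    then have "[a + s ^ t * val c = fst x + s ^ snd x * val c] (mod int q)"
      using x by (intro cong_add cong_mult cong_refl s_pow_cong) (auto simp: cong_sym)
    then have "[a + b = val (x # c)] (mod int q)" unfolding c by (simp add: val_Cons)
    then show "\<exists>c\<in>val ` choices (gh # ps). [a + b = c] (mod int q)"
      using choices_ConsI[OF c(1) x(1)] gh by blast
  qed (use choices_nonempty in auto)
  ultimately show ?case using Cons by (auto simp: min_def split: if_splits)
qed

end

lemma size_filter_add_compl:
  "size (filter_mset P M) + size (filter_mset (\<lambda>x. \<not> P x) M) = size M"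
  by (metis multiset_partition size_union)

lemma size_filter_diff:
  assumes "V \<subseteq># M"
  shows "size (filter_mset P (M - V)) = size (filter_mset P M) - size (filter_mset P V)"
  using multiset_filter_mono[OF assms, of P] by (simp add: filter_diff_mset size_Diff_submset)

lemma filter_mset_size_mono: "A \<subseteq># B \<Longrightarrow> size (filter_mset P A) \<le> size (filter_mset P B)"
  by (simp add: multiset_filter_mono size_mset_mono)

lemma filter_mset_eq_empty_of_none: "(\<And>x. x \<in># M \<Longrightarrow> \<not> P x) \<Longrightarrow> filter_mset P M = {#}"
  by (metis filter_mset_cong filter_mset_False)

context affine_model
begin

lemma splits_of_sublist:
  assumes l: "mset (a @ m @ b) = S" "int q dvd val (a @ m @ b)" "p dvd deg (a @ m @ b)"
    and m: "p dvd deg m" "int q dvd val m" "m \<noteq> []" and ne: "a @ b \<noteq> []"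
  shows "splits S"
proof -
  have "p dvd deg (a @ b)" using l(3) m(1)
    by simp (metis ab_semigroup_add_class.add_ac(1) add.left_commute dvd_add_right_iff)
  moreover have "[val (a @ m @ b) = val (a @ b)] (mod int q)"
  proof -
    have "val (a @ m @ b) = val a + s ^ deg a * (val m + s ^ deg m * val b)" by (simp add: val_append)
    also have "[\<dots> = val a + s ^ deg a * (0 + 1 * val b)] (mod int q)"
      using m by (intro cong_add cong_mult cong_refl s_pow_cong_1) (simp_all add: cong_0_iff)
    finally show ?thesis by (simp add: val_append)
  qed
  then have "int q dvd val (a @ b)" using l(2) by (simp add: cong_dvd_iff)
  ultimately have "one (mset (a @ b))" unfolding one_def using valsI[of "a @ b" "mset (a @ b)"]
    by (metis dg_mset)
  moreover have "one (mset m)" unfolding one_def using valsI[of m "mset m"] m by auto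
  moreover have "S = mset m + mset (a @ b)" using l(1) by (simp add: union_lcomm)
  ultimately show ?thesis unfolding splits_def using m(3) ne by fastforce
qed

lemma val_zero_deg:
  "\<forall>g\<in>set l. p dvd snd g \<Longrightarrow> [val l = sum_list (map fst l)] (mod int q)"
proof (induction l)
  case (Cons g l)
  have "[fst g + s ^ snd g * val l = fst g + 1 * sum_list (map fst l)] (mod int q)"
    using Cons by (intro cong_add cong_mult cong_refl s_pow_cong_1) auto
  then show ?case by (simp add: val_Cons)
qed simp

lemma dg_cong_const:
  "\<forall>g\<in>#M. snd g mod p = t \<Longrightarrow> [dg M = size M * t] (mod p)"
proof (induction M)
  case (add g M)
  have "[snd g + dg M = t + size M * t] (mod p)"
    using add by (intro cong_add) (auto simp: cong_def)
  then show ?case by simp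
qed simp

lemma dg_dvd: "\<forall>g\<in>#M. p dvd snd g \<Longrightarrow> p dvd dg M"
  using dg_cong_const[of M 0] by (auto simp: cong_0_iff)

lemma cl_cong:
  assumes "[fst g = fst h] (mod int q)" "[snd g = snd h] (mod p)"
  shows "cl g = cl h"
proof -
  have dv: "p dvd snd g \<longleftrightarrow> p dvd snd h" using assms(2) by (rule cong_dvd_iff)
  have "[fst g = f * (1 - s ^ snd g)] (mod int q) \<longleftrightarrow> [fst h = f * (1 - s ^ snd h)] (mod int q)" for f
  proof -
    have e: "[f * (1 - s ^ snd g) = f * (1 - s ^ snd h)] (mod int q)"
      by (intro cong_mult cong_diff cong_refl s_pow_cong assms(2))
    show ?thesis
    proof
      assume "[fst g = f * (1 - s ^ snd g)] (mod int q)"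
      from cong_trans[OF cong_trans[OF cong_sym[OF assms(1)] this] e]
      show "[fst h = f * (1 - s ^ snd h)] (mod int q)" .
    next
      assume "[fst h = f * (1 - s ^ snd h)] (mod int q)"
      from cong_trans[OF cong_trans[OF assms(1) this] cong_sym[OF e]]
      show "[fst g = f * (1 - s ^ snd g)] (mod int q)" .
    qed
  qed
  then show ?thesis unfolding cl_def dv by simp
qed

text \<open>If the three pairwise sums of exponents all vanished modulo \<open>p\<close>, so would
  twice an exponent, although \<open>p\<close> is odd.\<close>

lemma hosts_exist:
  assumes "3 \<le> size M" "\<forall>g\<in>#M. \<not> p dvd snd g"
  obtains g h where "{#g, h#} \<subseteq># M" "\<not> p dvd snd g + snd h"
proof -
  obtain N where N: "N \<subseteq># M" "size N = 3" using mset_subset_size_exists[OF assms(1)] by blast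
  obtain l where l: "mset l = N" using ex_mset by blast
  have "length l = 3" using l N by auto
  then obtain a b c where abc: "l = [a, b, c]" by (auto simp: length_Suc_conv numeral_3_eq_3)
  have Nabc: "N = {#a, b, c#}" using l abc by simp
  have sub: "{#a, b#} \<subseteq># M" "{#a, c#} \<subseteq># M" "{#b, c#} \<subseteq># M"
  proof -
    have "{#a, b#} \<subseteq># N" "{#a, c#} \<subseteq># N" "{#b, c#} \<subseteq># N"
      unfolding Nabc by (simp_all add: add_mset_commute)
    then show "{#a, b#} \<subseteq># M" "{#a, c#} \<subseteq># M" "{#b, c#} \<subseteq># M"
      using N(1) subset_mset.order_trans by blast+
  qed
  have na: "\<not> p dvd snd a" using assms(2) sub(1) by (meson mset_subset_eq_insertD)
  have "\<not> (p dvd snd a + snd b \<and> p dvd snd a + snd c \<and> p dvd snd b + snd c)"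
  proof
    assume d: "p dvd snd a + snd b \<and> p dvd snd a + snd c \<and> p dvd snd b + snd c"
    then have "p dvd (snd a + snd b) + (snd a + snd c)"
      using dvd_add[of p "snd a + snd b" "snd a + snd c"] by blast
    moreover have "(snd a + snd b) + (snd a + snd c) = 2 * snd a + (snd b + snd c)" by simp
    ultimately have "p dvd 2 * snd a" using d by (metis dvd_add_left_iff)
    then have "p dvd 2 \<or> p dvd snd a" using p(1) by (simp add: prime_dvd_mult_iff)
    then show False using na p_ge_3 by (auto dest: dvd_imp_le)
  qed
  then show thesis using that sub by blast
qed

subsection \<open>Splitting long product-one sequences\<close>

context
  fixes S :: "(int \<times> nat) multiset"
  assumes S_one: "one S" and S_size: "2 * q + 1 \<le> size S" and no_split: "\<not> splits S"
begin

text \<open>\<open>Qs\<close> holds the translations of the supposed counterexample,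
  \<open>Ns\<close> the other terms, \<open>K c\<close> the terms of one key. The bounds below feed
  each other: sufficiently many non-translations act as hosts, small classes allow noncommuting
  pairs, and in the end almost all terms have the same exponent modulo \<open>p\<close>.\<close>

definition Qs where "Qs = filter_mset (\<lambda>g. p dvd snd g) S"
definition Ns where "Ns = filter_mset (\<lambda>g. \<not> p dvd snd g) S"
definition K where "K c = filter_mset (\<lambda>g. cl g = c) S"

lemma S_parts: "S = Qs + Ns" "size S = size Qs + size Ns"
  unfolding Qs_def Ns_def by (auto simp: size_filter_add_compl)

lemma dg_S: "p dvd dg S" using S_one unfolding one_def by simp

lemma Qs_mem: "g \<in># Qs \<Longrightarrow> p dvd snd g" and Ns_mem: "g \<in># Ns \<Longrightarrow> \<not> p dvd snd g"
  unfolding Qs_def Ns_def by auto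

lemma K_mem: "c \<noteq> - 1 \<Longrightarrow> g \<in># K c \<Longrightarrow> \<not> p dvd snd g \<and> cl g = c"
  unfolding K_def using cl_eq_minus_1_iff[of g] by auto

lemma Ns_cl: "Ns = filter_mset (\<lambda>g. cl g \<noteq> - 1) S"
  unfolding Ns_def by (rule filter_mset_cong) (auto simp: cl_eq_minus_1_iff)

lemma dg_Qs: "p dvd dg Qs" using Qs_mem by (intro dg_dvd) auto

lemma dg_Ns: "p dvd dg Ns"
  using dg_S dg_Qs S_parts(1) by (metis dg_simps(3) dvd_add_right_iff)

lemma ordering: obtains l where "mset l = S" "int q dvd val l" "p dvd deg l"
proof -
  obtain v where v: "v \<in> vals S" "int q dvd v" using S_one unfolding one_def by blast
  then obtain l where "mset l = S" "v = val l" by (auto elim: valsE)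
  then show thesis using that v dg_S by (metis dg_mset)
qed

lemma no_identity: "g \<in># S \<Longrightarrow> \<not> (p dvd snd g \<and> int q dvd fst g)"
proof
  assume g: "g \<in># S" "p dvd snd g \<and> int q dvd fst g"
  obtain l where l: "mset l = S" "int q dvd val l" "p dvd deg l" by (rule ordering)
  have "g \<in> set l" using g(1) l(1) by auto
  then obtain a b where ab: "l = a @ [g] @ b" using split_list by fastforce
  have "length l = size S" using l(1) by auto
  then have "a @ b \<noteq> []" using ab S_size q_pos by auto
  then have "splits S" using l g(2) unfolding ab by (intro splits_of_sublist[of a "[g]" b]) (auto simp: val_Cons)
  then show False using no_split by simp
qed

lemma Qs_nonzero: "X \<subseteq># Qs \<Longrightarrow> \<forall>g\<in>#X. p dvd snd g \<and> \<not> int q dvd fst g"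
  using no_identity Qs_mem unfolding Qs_def by (metis mem_Collect_eq mset_subset_eqD set_mset_filter)

lemma no_full: "V \<subseteq># S \<Longrightarrow> V \<noteq> {#} \<Longrightarrow> one V \<Longrightarrow> T \<subseteq># S - V \<Longrightarrow> nres q (vals T) \<noteq> q"
  using splits_of_full[OF dg_S] no_split by blast

lemma no_classes:
  "V \<subseteq># S \<Longrightarrow> V \<noteq> {#} \<Longrightarrow> one V \<Longrightarrow> T \<subseteq># S - V \<Longrightarrow> q + 1 \<le> size T \<Longrightarrow>
    (\<And>c. q + 1 \<le> 2 * size (filter_mset (\<lambda>g. cl g \<noteq> c) T)) \<Longrightarrow> False"
  using splits_of_classes[OF dg_S no_identity] no_split by blast

lemma one_in_Qs:
  assumes "X \<subseteq># Qs" "q \<le> size X"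
  obtains V where "V \<subseteq># X" "V \<noteq> {#}" "one V" "size V \<le> q"
proof -
  obtain U where U: "U \<subseteq># X" "size U = q" using mset_subset_size_exists[OF assms(2)] by blast
  have "p dvd dg U" using U(1) assms(1) Qs_mem by (intro dg_dvd) (meson mset_subset_eqD)
  then obtain V where V: "V \<subseteq># U" "V \<noteq> {#}" "one V" using exists_one_of_size[of U] U(2) by auto
  moreover have "size V \<le> q" using V(1) U(2) size_mset_mono by metis
  ultimately show thesis using that U(1) subset_mset.order_trans by blast
qed

text \<open>The value of a sequence of translations does not depend on the order, so removing a
  product-one \<open>V\<close> leaves a product-one sequence. A single non-translation contradicts
  the total exponent.\<close>

lemma Ns_size_ge_2: "2 \<le> size Ns"
proof (rule ccontr)
  assume "\<not> ?thesis"
  then consider "size Ns = 0" | "size Ns = 1" by linarith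
  then show False
  proof cases
    case 1
    then have SQ: "S = Qs" using S_parts(1) by simp
    obtain V where V: "V \<subseteq># S" "V \<noteq> {#}" "one V" "size V \<le> q"
      using one_in_Qs[of S] SQ S_size by auto
    obtain l' where l': "mset l' = S - V" using ex_mset by blast
    obtain v where v: "v \<in> vals V" "int q dvd v" using V(3) unfolding one_def by blast
    then obtain lv where lv: "mset lv = V" "v = val lv" by (auto elim: valsE)
    obtain l where l: "mset l = S" "int q dvd val l" "p dvd deg l" by (rule ordering)
    have all: "\<forall>g\<in>set m. p dvd snd g" if "mset m \<subseteq># S" for m
      using that SQ Qs_mem by (metis mset_subset_eqD set_mset_mset)
    have "mset (lv @ l') = mset l" using lv l' l V(1) by simp
    then have "sum_list (map fst (lv @ l')) = sum_list (map fst l)"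
      by (metis mset_map sum_mset_sum_list)
    moreover have "[val (lv @ l') = sum_list (map fst (lv @ l'))] (mod int q)"
      "[val l = sum_list (map fst l)] (mod int q)"
      using all[of "lv @ l'"] all[of l] lv l' l V(1) by (intro val_zero_deg; simp)+
    ultimately have "[val (lv @ l') = val l] (mod int q)" by (metis cong_sym cong_trans)
    then have d: "int q dvd val (lv @ l')" using l(2) by (simp add: cong_dvd_iff)
    have "mset l' \<noteq> {#}"
      using V(1,4) S_size l' size_Diff_submset[OF V(1)] q_pos by auto
    then have "splits S"
      using splits_of_sublist[of "[]" lv l' S] d lv l' V dg_S v unfolding one_def
      by (metis append_Nil dg_mset mset.simps(1) mset_append subset_mset.add_diff_inverse)
    then show False using no_split by simp
  next
    case 2
    then obtain g where g: "Ns = {#g#}" using size_1_singleton_mset by blast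
    then show False using dg_Ns Ns_mem[of g] by simp
  qed
qed

text \<open>With two non-translations there are at least \<open>2 * q - 1\<close> translations:
  \<open>q\<close> of them contain \<open>V\<close>, and \<open>q - 1\<close> others inserted around
  a single host reach all residues.\<close>

lemma Ns_size_ge_3: "3 \<le> size Ns"
proof (rule ccontr)
  assume "\<not> ?thesis"
  then have two: "size Ns = 2" using Ns_size_ge_2 by simp
  then obtain h where h: "h \<in># Ns" by (metis multiset_nonemptyE size_empty zero_neq_numeral)
  have mQ: "2 * q - 1 \<le> size Qs" using S_parts(2) S_size two by simp
  then have "q - 1 \<le> size Qs" by linarith
  then obtain X where X: "X \<subseteq># Qs" "size X = q - 1" using mset_subset_size_exists by blast
  have "q \<le> size (Qs - X)" using X mQ by (simp add: size_Diff_submset)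
  then obtain V where V: "V \<subseteq># Qs - X" "V \<noteq> {#}" "one V"
    using one_in_Qs[OF diff_subset_eq_self] by blast
  have "nres q (vals (mset [h] + X)) = q"
    using h Ns_mem Qs_nonzero[OF X(1)] X(2) nres_stops_single[of h] by (intro nres_vals_hosted) auto
  moreover have "mset [h] + X \<subseteq># S - V"
  proof -
    have "V + X \<subseteq># Qs" using V(1) subset_mset.le_diff_conv2[OF X(1), of V] by simp
    moreover have "mset [h] \<subseteq># Ns" using h by simp
    ultimately have "(V + X) + mset [h] \<subseteq># Qs + Ns" by (rule subset_mset.add_mono)
    then have "(V + X) + mset [h] \<subseteq># S" by (simp only: S_parts(1)[symmetric])
    then have le: "(mset [h] + X) + V \<subseteq># S" by (simp add: ac_simps)
    moreover have "V \<subseteq># S" using le mset_subset_eq_add_right subset_mset.order_trans by blast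
    ultimately show ?thesis using subset_mset.le_diff_conv2 by blast
  qed
  moreover have "V \<subseteq># S" using V(1) S_parts(1)
    by (metis diff_subset_eq_self mset_subset_eq_add_left subset_mset.order_trans)
  ultimately show False using no_full V by blast
qed

text \<open>Two of the three non-translations outside \<open>V\<close> have exponents that are not
  opposite. They offer three stops, and \<open>(q - 1) / 2\<close> translations then reach every
  residue.\<close>

lemma hosted_contradiction:
  assumes V: "V \<subseteq># S" "V \<noteq> {#}" "one V" and N: "3 \<le> size (filter_mset (\<lambda>g. \<not> p dvd snd g) (S - V))"
    and X: "X \<subseteq># Qs" "X \<subseteq># S - V" "q - 1 = 2 * size X"
  shows False
proof -
  let ?M = "filter_mset (\<lambda>g. \<not> p dvd snd g) (S - V)"
  have M: "\<forall>g\<in>#?M. \<not> p dvd snd g" by (simp only: set_mset_filter) blast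
  obtain g h where gh: "{#g, h#} \<subseteq># ?M" "\<not> p dvd snd g + snd h"
    by (rule hosts_exist[OF N M])
  have "g \<in># ?M" "h \<in># ?M" by (rule mset_subset_eqD[OF gh(1)]; simp)+
  then have m: "\<not> p dvd snd g" "\<not> p dvd snd h" using M by blast+
  have "nres q (vals (mset [g, h] + X)) = q"
    using m Qs_nonzero[OF X(1)] X(3) nres_stops_two[OF m gh(2)] by (intro nres_vals_hosted) auto
  moreover have "mset [g, h] + X \<subseteq># S - V"
  proof -
    have "filter_mset (\<lambda>g. p dvd snd g) X = X"
      using Qs_nonzero[OF X(1)] by (simp add: filter_mset_eq_conv)
    then have "X \<subseteq># filter_mset (\<lambda>g. p dvd snd g) (S - V)" using multiset_filter_mono[OF X(2)] by metis
    then have "{#g, h#} + X \<subseteq># ?M + filter_mset (\<lambda>g. p dvd snd g) (S - V)"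
      using gh(1) by (rule subset_mset.add_mono[rotated])
    also have "\<dots> = S - V" by (metis multiset_partition add.commute)
    finally show ?thesis by simp
  qed
  ultimately show False using no_full V by blast
qed

lemma half_q: obtains h where "q = 2 * h + 1" using q_ge(2) oddE by blast

text \<open>The threshold \<open>(3 * q - 1) / 2\<close> consists of \<open>q\<close> translations
  that contain \<open>V\<close> and \<open>(q - 1) / 2\<close> to be hosted.\<close>

lemma Qs_size_less: "2 * size Qs < 3 * q - 1"
proof (rule ccontr)
  assume big: "\<not> ?thesis"
  obtain h where h: "q = 2 * h + 1" by (rule half_q)
  have "h \<le> size Qs" using big h by linarith
  then obtain X where X: "X \<subseteq># Qs" "size X = h" using mset_subset_size_exists by blast
  have "q \<le> size (Qs - X)" using X big h by (simp add: size_Diff_submset)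
  then obtain V where V: "V \<subseteq># Qs - X" "V \<noteq> {#}" "one V"
    using one_in_Qs[OF diff_subset_eq_self] by blast
  have VQ: "V \<subseteq># Qs" using V(1) by (meson diff_subset_eq_self subset_mset.order_trans)
  have VX: "V + X \<subseteq># Qs" using V(1) subset_mset.le_diff_conv2[OF X(1), of V] by simp
  have QS: "Qs \<subseteq># S" unfolding Qs_def by simp
  show False
  proof (rule hosted_contradiction[of V X])
    show "V \<subseteq># S" using VQ QS subset_mset.order_trans by blast
    have e: "filter_mset (\<lambda>g. \<not> p dvd snd g) V = {#}"
      using VQ Qs_mem by (intro filter_mset_eq_empty_of_none) (auto dest: mset_subset_eqD)
    show "3 \<le> size (filter_mset (\<lambda>g. \<not> p dvd snd g) (S - V))"
      unfolding size_filter_diff[OF \<open>V \<subseteq># S\<close>] e using Ns_size_ge_3 unfolding Ns_def by simp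
    have "X + V \<subseteq># S" using VX QS subset_mset.order_trans by (metis union_commute)
    then show "X \<subseteq># S - V" using \<open>V \<subseteq># S\<close> by (simp add: subset_mset.le_diff_conv2)
  qed (use V X h in auto)
qed

lemma Ns_size_ge: "q + 5 \<le> 2 * size Ns"
proof -
  obtain h where h: "q = 2 * h + 1" by (rule half_q)
  then show ?thesis using Qs_size_less S_size S_parts(2) by presburger
qed

lemma size_K: "size (filter_mset (\<lambda>g. cl g \<noteq> c) S) = size S - size (K c)" "size (K c) \<le> size S"
  using size_filter_add_compl[of "\<lambda>g. cl g = c" S] unfolding K_def by auto

lemma size_filter_K:
  assumes "V \<subseteq># S"
  shows "size S - size V - size (K c) \<le> size (filter_mset (\<lambda>g. cl g \<noteq> c) (S - V))"
proof -
  have "size (S - V) = size S - size V" using assms by (rule size_Diff_submset)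
  moreover have "size (filter_mset (\<lambda>g. cl g = c) (S - V)) \<le> size (K c)"
    unfolding K_def by (rule filter_mset_size_mono) simp
  ultimately show ?thesis using size_filter_add_compl[of "\<lambda>g. cl g = c" "S - V"] by simp
qed

lemma size_filter_Ns:
  assumes "V \<subseteq># S"
  shows "size (filter_mset (\<lambda>g. cl g \<noteq> - 1) (S - V)) = size Ns - size (filter_mset (\<lambda>g. cl g \<noteq> - 1) V)"
  unfolding size_filter_diff[OF assms] Ns_cl ..

lemma one_in_K:
  assumes "c \<noteq> - 1" "M \<subseteq># K c" "p \<le> size M"
  obtains V where "V \<subseteq># M" "V \<subseteq># S" "V \<noteq> {#}" "size V \<le> p" "one V"
proof -
  have "\<And>g. g \<in># M \<Longrightarrow> \<not> p dvd snd g \<and> cl g = c" using K_mem[OF assms(1)] assms(2) by (meson mset_subset_eqD)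
  then obtain V where V: "V \<subseteq># M" "V \<noteq> {#}" "size V \<le> p" "one V" using one_in_class[OF assms(3)] by blast
  moreover have "M \<subseteq># S" using assms(2) unfolding K_def by (meson multiset_filter_subset subset_mset.order_trans)
  ultimately show thesis using that subset_mset.order_trans by blast
qed

text \<open>In a product-one ordering, \<open>p\<close> consecutive terms of one class would contain
  a block of exponent zero. Its maps share a fixed point, so the block has product one and could be
  cut out.\<close>

lemma K_run_bound:
  assumes c: "c \<noteq> - 1"
  shows "size (K c) \<le> (p - 1) * (size S - size (K c) + 1)"
proof -
  obtain l where l: "mset l = S" "int q dvd val l" "p dvd deg l" by (rule ordering)
  have "length m \<le> p - 1" if abm: "l = a @ m @ b" and cm: "\<forall>g\<in>set m. cl g = c" for a m b
  proof (rule ccontr)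
    assume "\<not> ?thesis"
    then have "p \<le> length m" by simp
    then obtain a' m' b' where m': "m = a' @ m' @ b'" "m' \<noteq> []" "length m' \<le> p" "p dvd deg m'"
      by (rule zero_deg_sublist_exists)
    have l': "l = (a @ a') @ m' @ (b' @ b)" using abm m'(1) by simp
    have "\<not> p dvd snd g \<and> cl g = c" if "g \<in> set m'" for g
      using that cm m'(1) c cl_eq_minus_1_iff[of g] by auto
    then have "[val m' = c * (1 - s ^ deg m')] (mod int q)" by (rule val_same_class)
    also have "[c * (1 - s ^ deg m') = c * (1 - 1)] (mod int q)"
      by (intro cong_mult cong_diff cong_refl s_pow_cong_1 m'(4))
    finally have "int q dvd val m'" by (simp add: cong_0_iff)
    moreover have "(a @ a') @ (b' @ b) \<noteq> []"
    proof
      assume "(a @ a') @ (b' @ b) = []"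
      then have "length l \<le> p" using l' m'(3) by simp
      moreover have "length l = size S" using l(1) by auto
      ultimately show False using S_size q_ge(1) by simp
    qed
    ultimately have "splits S" using splits_of_sublist[of "a @ a'" m' "b' @ b" S] l m' unfolding l' by blast
    then show False using no_split by simp
  qed
  then have "length (filter (\<lambda>g. cl g = c) l) \<le> (p - 1) * (length (filter (\<lambda>x. cl x \<noteq> c) l) + 1)"
    by (rule filter_run_bound)
  moreover have "length (filter P l) = size (filter_mset P S)" for P
  proof -
    have "mset (filter P l) = filter_mset P S" using l(1) by (simp add: mset_filter)
    then show ?thesis by (metis size_mset)
  qed
  ultimately show ?thesis unfolding size_K(1)[symmetric] by (simp add: K_def)
qed

text \<open>The threshold is \<open>p + (q + 1) / 2\<close>: a product-one \<open>V\<close> of at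
  most \<open>p\<close> terms of \<open>K c\<close> leaves \<open>(q + 1) / 2\<close> terms of the
  class. Enough noncommuting pairs exist unless fewer than \<open>(q + 1) / 2\<close> terms lie
  outside \<open>K c\<close>; then stars centred at those few terms reach all residues.\<close>

lemma K_size_less:
  assumes c: "c \<noteq> - 1"
  shows "2 * size (K c) < 2 * p + q + 1"
proof (rule ccontr)
  assume "\<not> ?thesis"
  then have big: "2 * p + q + 1 \<le> 2 * size (K c)" by simp
  have KS: "K c \<subseteq># S" unfolding K_def by simp
  show False
  proof (cases "q + 1 \<le> 2 * (size S - size (K c))")
    case True
    have "p \<le> size (K c)" using big by simp
    then obtain V where V: "V \<subseteq># K c" "V \<subseteq># S" "V \<noteq> {#}" "size V \<le> p" "one V"
      by (rule one_in_K[OF c subset_mset.order_refl])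
    show False
    proof (rule no_classes[OF V(2,3,5) subset_mset.order_refl])
      have "size (S - V) = size S - size V" using V(2) by (rule size_Diff_submset)
      then show "q + 1 \<le> size (S - V)" using V(4) S_size q_ge(1) by simp
      fix c'
      show "q + 1 \<le> 2 * size (filter_mset (\<lambda>g. cl g \<noteq> c') (S - V))"
      proof (cases "c' = c")
        case True
        have e: "filter_mset (\<lambda>g. cl g \<noteq> c) V = {#}"
          using V(1) K_mem[OF c] by (intro filter_mset_eq_empty_of_none) (auto dest: mset_subset_eqD)
        show ?thesis unfolding True size_filter_diff[OF V(2)] e size_K(1)
          using \<open>q + 1 \<le> 2 * (size S - size (K c))\<close> by simp
      next
        case False
        have "K c - V \<subseteq># filter_mset (\<lambda>g. cl g \<noteq> c') (S - V)"
        proof -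
          have "filter_mset (\<lambda>g. cl g \<noteq> c') (K c - V) = K c - V"
            using False K_mem[OF c] by (intro iffD2[OF filter_mset_eq_conv]) (auto dest!: in_diffD)
          moreover have "K c - V \<subseteq># S - V" using KS by (simp add: subseteq_mset_def diff_le_mono)
          ultimately show ?thesis by (metis multiset_filter_mono)
        qed
        then have "size (K c - V) \<le> size (filter_mset (\<lambda>g. cl g \<noteq> c') (S - V))" by (rule size_mset_mono)
        moreover have "size (K c - V) = size (K c) - size V" using V(1) by (rule size_Diff_submset)
        ultimately show ?thesis using big V(4) by linarith
      qed
    qed
  next
    case False
    define j where "j = size S - size (K c)"
    have j: "2 * j \<le> q" "size (K c) + j = size S" unfolding j_def using False size_K(2) by auto
    have Kbig: "3 * q + 2 \<le> 2 * size (K c)" using j S_size by linarith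
    have run: "size (K c) \<le> (p - 1) * (j + 1)" using K_run_bound[OF c] unfolding j_def .
    \<comment> \<open>If \<open>(p - 1) * j\<close> were at most \<open>q - 2\<close>, then
      \<open>j\<close> would be at most half of it and \<open>p - 1\<close> less than
      \<open>q / 2\<close>, too little for the run bound.\<close>
    have stars: "q - 1 \<le> (p - 1) * j"
    proof -
      define A where "A = (p - 1) * j"
      have "size (K c) \<le> A + (p - 1)" using run unfolding A_def by simp
      then have 1: "2 * q + 1 \<le> A + (p - 1) + j" using j S_size by linarith
      have "2 * j \<le> (p - 1) * j" using p_ge_3 by (intro mult_le_mono1) simp
      then have "2 * j \<le> A" unfolding A_def .
      then show ?thesis using 1 q_ge(1) unfolding A_def[symmetric] by linarith
    qed
    obtain H where H: "H \<subseteq># K c" "size H = q - 1"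
      using mset_subset_size_exists[of "q - 1" "K c"] Kbig by force
    have "size (K c - H) = size (K c) - (q - 1)" using H by (simp add: size_Diff_submset)
    then have "p \<le> size (K c - H)" using Kbig q_ge(1) by linarith
    then obtain V where V: "V \<subseteq># K c - H" "V \<subseteq># S" "V \<noteq> {#}" "size V \<le> p" "one V"
      by (rule one_in_K[OF c diff_subset_eq_self])
    obtain gs where gs: "mset gs = filter_mset (\<lambda>g. cl g \<noteq> c) S" using ex_mset by blast
    obtain hs where hs: "mset hs = H" using ex_mset by blast
    have lens: "length gs = j" "length hs = q - 1"
      using gs hs H(2) size_K(1)[of c] unfolding j_def by (metis size_mset)+
    have "min q (1 + length hs) \<le> nres q (vals (mset gs + mset hs))"
    proof (rule nres_stars)
      fix g assume "g \<in> set gs"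
      then have "g \<in># filter_mset (\<lambda>g. cl g \<noteq> c) S" using gs by (metis set_mset_mset)
      then show "\<not> (p dvd snd g \<and> int q dvd fst g) \<and> cl g \<noteq> c" using no_identity by auto
    next
      fix h assume "h \<in> set hs"
      then show "\<not> p dvd snd h \<and> cl h = c" using hs H(1) K_mem[OF c] by (metis mset_subset_eqD set_mset_mset)
    next
      show "length hs \<le> (p - 1) * length gs" using stars lens by simp
    qed
    then have "nres q (vals (mset gs + mset hs)) = q"
      using lens nres_le[OF q_pos, of "vals (mset gs + mset hs)"] q_pos by simp
    moreover have "mset gs + mset hs \<subseteq># S - V"
    proof -
      have "V + H \<subseteq># K c" using V(1) subset_mset.le_diff_conv2[OF H(1), of V] by simp
      then have "mset gs + (V + H) \<subseteq># filter_mset (\<lambda>g. cl g \<noteq> c) S + K c"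
        using gs by (intro subset_mset.add_mono) auto
      also have "\<dots> = S" unfolding K_def by (metis (no_types) add.commute multiset_partition)
      finally have "(mset gs + mset hs) + V \<subseteq># S" unfolding hs by (simp add: ac_simps)
      then show ?thesis using subset_mset.le_diff_conv2[OF V(2)] by blast
    qed
    ultimately show False using no_full V by blast
  qed
qed

text \<open>A class of \<open>p\<close> terms contains a product-one \<open>V\<close> of at most
  \<open>p\<close> terms, short enough for the weaker bound \<open>K_size_less\<close> to control
  all classes of non-translations outside it. If too few non-translations remain for pairs, there
  are enough translations to be hosted.\<close>

lemma K_size_less_p:
  assumes c: "c \<noteq> - 1"
  shows "size (K c) < p"
proof (rule ccontr)
  assume "\<not> ?thesis"
  then have "p \<le> size (K c)" by simp
  then obtain V where V: "V \<subseteq># K c" "V \<subseteq># S" "V \<noteq> {#}" "size V \<le> p" "one V"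
    by (rule one_in_K[OF c subset_mset.order_refl])
  have VN: "\<And>g. g \<in># V \<Longrightarrow> \<not> p dvd snd g" using V(1) K_mem[OF c] by (meson mset_subset_eqD)
  have szd: "size (S - V) = size S - size V" using V(2) by (rule size_Diff_submset)
  have "filter_mset (\<lambda>g. cl g \<noteq> - 1) V = V"
    using VN by (intro iffD2[OF filter_mset_eq_conv]) (auto simp: cl_eq_minus_1_iff)
  then have NV: "size (filter_mset (\<lambda>g. cl g \<noteq> - 1) (S - V)) = size Ns - size V"
    using size_filter_Ns[OF V(2)] by simp
  show False
  proof (cases "q + 1 \<le> 2 * (size Ns - size V)")
    case True
    show False
    proof (rule no_classes[OF V(2,3,5) subset_mset.order_refl])
      show "q + 1 \<le> size (S - V)" using szd V(4) S_size q_ge(1) by simp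
      fix c'
      show "q + 1 \<le> 2 * size (filter_mset (\<lambda>g. cl g \<noteq> c') (S - V))"
      proof (cases "c' = - 1")
        case True
        then show ?thesis using NV \<open>q + 1 \<le> 2 * (size Ns - size V)\<close> by simp
      next
        case False
        show ?thesis using K_size_less[OF False] size_filter_K[OF V(2), of c'] V(4) S_size q_ge(1) by linarith
      qed
    qed
  next
    case False
    obtain h where h: "q = 2 * h + 1" by (rule half_q)
    have "h \<le> size Qs" using False S_parts(2) S_size V(4) h q_ge(1) by linarith
    then obtain X where X: "X \<subseteq># Qs" "size X = h" using mset_subset_size_exists by blast
    show False
    proof (rule hosted_contradiction[OF V(2,3,5) _ X(1)])
      have e: "filter_mset (\<lambda>g. \<not> p dvd snd g) (S - V) = filter_mset (\<lambda>g. cl g \<noteq> - 1) (S - V)"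
        by (rule filter_mset_cong) (auto simp: cl_eq_minus_1_iff)
      show "3 \<le> size (filter_mset (\<lambda>g. \<not> p dvd snd g) (S - V))"
        unfolding e NV using Ns_size_ge V(4) q_ge(1) by linarith
      have "filter_mset (\<lambda>g. \<not> p dvd snd g) V = V" using VN by (intro iffD2[OF filter_mset_eq_conv]) auto
      then have "V \<subseteq># Ns" unfolding Ns_def using multiset_filter_mono[OF V(2)] by metis
      then have "X + V \<subseteq># Qs + Ns" using X(1) by (intro subset_mset.add_mono)
      then have "X + V \<subseteq># S" by (simp only: S_parts(1)[symmetric])
      then show "X \<subseteq># S - V" using subset_mset.le_diff_conv2[OF V(2)] by blast
      show "q - 1 = 2 * size X" using X(2) h by simp
    qed
  qed
qed

text \<open>The \<open>q\<close> terms of \<open>U\<close> contain \<open>V\<close>, and the terms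
  of \<open>S - U\<close> form the pairs. Classes of non-translations are by now too small to
  obstruct the pairing, so the last hypothesis only has to control the translations.\<close>

lemma zero_deg_contradiction:
  assumes U: "U \<subseteq># S" "p dvd dg U" "size U = q"
    and N: "q + 1 \<le> 2 * (size Ns - size (filter_mset (\<lambda>g. cl g \<noteq> - 1) U))"
  shows False
proof -
  have "q \<le> size U" using U(3) by simp
  then obtain V where V: "V \<subseteq># U" "V \<noteq> {#}" "one V" using exists_one_of_size[OF U(2)] by blast
  have VS: "V \<subseteq># S" using V(1) U(1) subset_mset.order_trans by blast
  have "size (S - U) = size S - q" using U by (simp add: size_Diff_submset)
  show False
  proof (rule no_classes[OF VS V(2,3)])
    show "S - U \<subseteq># S - V" using V(1) by (simp add: subseteq_mset_def diff_le_mono2)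
    show "q + 1 \<le> size (S - U)" using \<open>size (S - U) = size S - q\<close> S_size by simp
    fix c
    show "q + 1 \<le> 2 * size (filter_mset (\<lambda>g. cl g \<noteq> c) (S - U))"
    proof (cases "c = - 1")
      case True
      then show ?thesis using N size_filter_Ns[OF U(1)] by simp
    next
      case False
      show ?thesis using K_size_less_p[OF False] size_filter_K[OF U(1), of c] U(3) S_size q_ge(1) by linarith
    qed
  qed
qed

text \<open>Translations have exponent zero and can pad a subsequence of \<open>Ns\<close> of
  exponent zero to exactly \<open>q\<close> terms. \<open>zero_deg_sub_size\<close> meets a
  prescribed size up to an excess of \<open>p - 1\<close>, so \<open>p - 1\<close> translations give
  the required room.\<close>

lemma Qs_size_less_p: "size Qs < p - 1"
proof (rule ccontr)
  assume "\<not> ?thesis"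
  then have big: "p - 1 \<le> size Qs" by simp
  have "\<exists>W. W \<subseteq># Ns \<and> p dvd dg W \<and> q - size Qs \<le> size W \<and> size W \<le> q \<and> q + 1 \<le> 2 * (size Ns - size W)"
  proof (cases "q \<le> size Qs")
    case True
    then show ?thesis using Ns_size_ge by (intro exI[of _ "{#}"]) auto
  next
    case False
    have "q - size Qs \<le> size Ns" using S_parts(2) S_size by linarith
    then obtain W where W: "W \<subseteq># Ns" "p dvd dg W" "q - size Qs \<le> size W" "size W < q - size Qs + p"
      by (rule zero_deg_sub_size[OF dg_Ns])
    have "size W \<le> q" using W(4) big False by linarith
    moreover have "q + 1 \<le> 2 * (size Ns - size W)" using W(4) False S_parts(2) S_size q_ge(1) by linarith
    ultimately show ?thesis using W by blast
  qed
  then obtain W where W: "W \<subseteq># Ns" "p dvd dg W" "q - size Qs \<le> size W" "size W \<le> q"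
    "q + 1 \<le> 2 * (size Ns - size W)" by blast
  have "q - size W \<le> size Qs" using W(3) by linarith
  then obtain X where X: "X \<subseteq># Qs" "size X = q - size W" using mset_subset_size_exists by blast
  show False
  proof (rule zero_deg_contradiction[of "X + W"])
    have "X + W \<subseteq># Qs + Ns" using X W by (intro subset_mset.add_mono)
    then show "X + W \<subseteq># S" by (simp only: S_parts(1)[symmetric])
    have "p dvd dg X" using X(1) Qs_mem by (intro dg_dvd) (meson mset_subset_eqD)
    then show "p dvd dg (X + W)" using W(2) by simp
    show "size (X + W) = q" using X(2) W(4) by simp
    have e: "filter_mset (\<lambda>g. cl g \<noteq> - 1) X = {#}"
      using X(1) Qs_mem by (intro filter_mset_eq_empty_of_none) (auto simp: cl_eq_minus_1_iff dest: mset_subset_eqD)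
    have "size (filter_mset (\<lambda>g. cl g \<noteq> - 1) (X + W)) \<le> size W"
      unfolding filter_union_mset e by (simp add: size_filter_mset_lesseq)
    then show "q + 1 \<le> 2 * (size Ns - size (filter_mset (\<lambda>g. cl g \<noteq> - 1) (X + W)))"
      using W(5) by linarith
  qed
qed

lemma Ns_minus_size:
  assumes "size V \<le> q"
  shows "q + 1 \<le> 2 * (size Ns - size (filter_mset (\<lambda>g. cl g \<noteq> - 1) V))"
proof -
  define f where "f = size (filter_mset (\<lambda>g. cl g \<noteq> - 1) V)"
  have f: "f \<le> q" using size_filter_mset_lesseq[of "\<lambda>g. cl g \<noteq> - 1" V] assms unfolding f_def by linarith
  have "size Qs + 2 \<le> p" using Qs_size_less_p by linarith
  then have "2 * q + 3 \<le> size Ns + p" using S_parts(2) S_size by linarith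
  then have "q + 1 \<le> 2 * (size Ns - f)" using f q_ge(1) by linarith
  then show ?thesis unfolding f_def .
qed

text \<open>Otherwise there are \<open>p - 1\<close> disjoint pairs with different exponents.
  Choosing one term of each reaches every exponent modulo \<open>p\<close>, so
  \<open>q - (p - 1)\<close> further terms can be completed to \<open>q\<close> terms of exponent
  zero.\<close>

lemma dominant_exponent: "\<exists>t. size (filter_mset (\<lambda>g. snd g mod p \<noteq> t) S) < p - 1"
proof (rule ccontr)
  assume "\<not> ?thesis"
  then have c: "p - 1 \<le> size (filter_mset (\<lambda>g. snd g mod p \<noteq> t) S)" for t by (meson not_le)
  have "2 * (p - 1) \<le> size S" using S_size q_ge(1) by linarith
  then obtain ps where ps: "length ps = p - 1" "\<forall>(g, h)\<in>set ps. snd g mod p \<noteq> snd h mod p"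
    "mset (concat (map (\<lambda>(g, h). [g, h]) ps)) \<subseteq># S"
    using disjoint_pairs_by_key[of "p - 1" S "\<lambda>g. snd g mod p"] c by blast
  let ?P = "mset (concat (map (\<lambda>(g, h). [g, h]) ps))"
  have "size ?P = 2 * length ps"
    by (induction ps) auto
  then have "size (S - ?P) = size S - 2 * (p - 1)" using ps by (simp add: size_Diff_submset)
  then have "q - (p - 1) \<le> size (S - ?P)" using S_size q_ge(1) p_ge_3 by linarith
  then obtain F where F: "F \<subseteq># S - ?P" "size F = q - (p - 1)" using mset_subset_size_exists by blast
  have "min p (1 + length ps) \<le> nres p ((\<lambda>c. int (deg c)) ` choices ps)"
    using ps(2) by (intro nres_choices_deg) (auto simp: cong_def)
  then have "nres p ((\<lambda>c. int (deg c)) ` choices ps) = p"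
    using ps(1) p_pos nres_le[OF p_pos, of "(\<lambda>c. int (deg c)) ` choices ps"] by simp
  then obtain x where x: "x \<in> (\<lambda>c. int (deg c)) ` choices ps" "[x = - int (dg F)] (mod int p)"
    using nres_full_obtain[OF p_pos] by metis
  then obtain c where c: "c \<in> choices ps" "[int (deg c) = - int (dg F)] (mod int p)" by blast
  show False
  proof (rule zero_deg_contradiction[of "F + mset c"])
    have "F + mset c \<subseteq># F + ?P" using choices_subset[OF c(1)] by simp
    also have "F + ?P \<subseteq># S" using F(1) subset_mset.le_diff_conv2[OF ps(3)] by blast
    finally show "F + mset c \<subseteq># S" .
    have "[int (dg F) + int (deg c) = int (dg F) + - int (dg F)] (mod int p)"
      using c(2) by (intro cong_add) auto
    then have "int p dvd int (dg F + deg c)" by (simp add: cong_0_iff)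
    then show "p dvd dg (F + mset c)" by (simp only: int_dvd_int_iff dg_simps dg_mset)
    show sz: "size (F + mset c) = q" using F(2) choices_length[OF c(1)] ps(1) q_ge(1) by simp
    show "q + 1 \<le> 2 * (size Ns - size (filter_mset (\<lambda>g. cl g \<noteq> - 1) (F + mset c)))"
      by (rule Ns_minus_size) (simp only: sz)
  qed
qed

lemma short_one_contradiction:
  assumes V: "V \<subseteq># S" "V \<noteq> {#}" "one V" "size V \<le> q - 1"
  shows False
proof (rule no_classes[OF V(1-3) subset_mset.order_refl])
  have "size (S - V) = size S - size V" using V(1) by (rule size_Diff_submset)
  then show "q + 1 \<le> size (S - V)" using V(4) S_size by linarith
  fix c
  show "q + 1 \<le> 2 * size (filter_mset (\<lambda>g. cl g \<noteq> c) (S - V))"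
  proof (cases "c = - 1")
    case True
    then show ?thesis using size_filter_Ns[OF V(1)] Ns_minus_size[of V] V(4) by simp
  next
    case False
    show ?thesis using K_size_less_p[OF False] size_filter_K[OF V(1), of c] V(4) S_size q_ge(1) by linarith
  qed
qed

text \<open>Terms of the dominant exponent have total exponent zero whenever their number is a
  multiple of \<open>p\<close>, and fewer than \<open>p\<close> of them share a translation part,
  since such terms lie in one class. A set \<open>U\<close> of \<open>q - 1 - p\<close> of them has
  at least \<open>q - p\<close> subsequence values, and choices from \<open>p\<close> pairs with
  different translation parts give at least \<open>p + 1\<close> values. The first set meets the
  negatives of the second, producing a product-one subsequence of at most \<open>q - 1\<close>
  terms.\<close>

lemma split_contradiction: False
proof -
  obtain t where t: "size (filter_mset (\<lambda>g. snd g mod p \<noteq> t) S) < p - 1" using dominant_exponent by blast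
  define Os where "Os = filter_mset (\<lambda>g. snd g mod p = t) S"
  have Osz: "size S - (p - 2) \<le> size Os"
    using t size_filter_add_compl[of "\<lambda>g. snd g mod p = t" S] unfolding Os_def by linarith
  have OS: "Os \<subseteq># S" unfolding Os_def by simp
  have Omem: "snd g mod p = t" if "g \<in># Os" for g using that unfolding Os_def by simp
  have t0: "t \<noteq> 0"
  proof
    assume "t = 0"
    then have "Os = Qs" unfolding Os_def Qs_def by (simp add: dvd_eq_mod_eq_0)
    then have "size Os = size Qs" by simp
    then show False using Qs_size_less_p Osz S_size q_ge(1) by linarith
  qed
  have Odg: "p dvd dg M" if "M \<subseteq># Os" "p dvd size M" for M
  proof -
    have "[dg M = size M * t] (mod p)" using that(1) Omem by (intro dg_cong_const) (meson mset_subset_eqD)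
    then show ?thesis using that(2) by (simp add: cong_dvd_iff)
  qed
  obtain m where m: "q - 1 = p * m" using pq by blast
  have m1: "m \<ge> 1" using m q_ge(1) p_pos by (cases m) auto
  \<comment> \<open>\<open>k = q - 1 - p\<close> is still a multiple of \<open>p\<close>, so
    \<open>U\<close> has exponent zero, and \<open>p\<close> chosen terms can be added without
    exceeding \<open>q - 1\<close>.\<close>
  define k where "k = p * (m - 1)"
  have k: "k + p = q - 1" using m m1 unfolding k_def by (cases m) auto
  have "k \<le> size Os" using Osz k S_size q_ge(1) by linarith
  then obtain U where U: "U \<subseteq># Os" "size U = k" using mset_subset_size_exists by blast
  define R where "R = Os - U"
  have Rsz: "size R = size Os - k" unfolding R_def using U by (simp add: size_Diff_submset)
  have RO: "R \<subseteq># Os" unfolding R_def by simp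
  have Rx: "p \<le> size (filter_mset (\<lambda>g. fst g mod int q \<noteq> x) R)" for x
  proof -
    have "size (filter_mset (\<lambda>g. fst g mod int q = x) R) \<le> p - 1"
    proof (cases "filter_mset (\<lambda>g. fst g mod int q = x) R = {#}")
      case False
      then obtain g where "g \<in># filter_mset (\<lambda>g. fst g mod int q = x) R" by blast
      then have g: "g \<in># R" "fst g mod int q = x" by auto
      have gt: "snd g mod p = t" using g(1) RO Omem by (meson mset_subset_eqD)
      have "\<not> p dvd snd g" using gt t0 by auto
      then have c: "cl g \<noteq> - 1" by (simp add: cl_eq_minus_1_iff)
      have "filter_mset (\<lambda>h. fst h mod int q = x) R \<subseteq># K (cl g)"
      proof -
        have "filter_mset (\<lambda>h. cl h = cl g) (filter_mset (\<lambda>h. fst h mod int q = x) R)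
          = filter_mset (\<lambda>h. fst h mod int q = x) R"
        proof (rule iffD2[OF filter_mset_eq_conv], intro conjI ballI)
          fix h assume "h \<in># filter_mset (\<lambda>h. fst h mod int q = x) R"
          then have h: "h \<in># R" "fst h mod int q = x" by auto
          have "snd h mod p = t" using h(1) RO Omem by (meson mset_subset_eqD)
          then show "cl h = cl g" using h(2) g(2) gt by (intro cl_cong) (auto simp: cong_def)
        qed auto
        moreover have "filter_mset (\<lambda>h. fst h mod int q = x) R \<subseteq># S"
          using RO OS by (meson multiset_filter_subset subset_mset.order_trans)
        ultimately show ?thesis unfolding K_def by (metis multiset_filter_mono)
      qed
      then have "size (filter_mset (\<lambda>h. fst h mod int q = x) R) \<le> size (K (cl g))" by (rule size_mset_mono)
      then show ?thesis using K_size_less_p[OF c] by linarith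
    next
      case True
      show ?thesis unfolding True by simp
    qed
    then show ?thesis
      using size_filter_add_compl[of "\<lambda>g. fst g mod int q = x" R] Rsz Osz k S_size q_ge(1) by linarith
  qed
  have "2 * p \<le> size R" using Rsz Osz k S_size q_ge(1) by linarith
  then obtain ps where ps: "length ps = p" "\<forall>(g, h)\<in>set ps. fst g mod int q \<noteq> fst h mod int q"
    "mset (concat (map (\<lambda>(g, h). [g, h]) ps)) \<subseteq># R"
    using disjoint_pairs_by_key[of p R "\<lambda>g. fst g mod int q"] Rx by blast
  have psR: "g \<in># R \<and> h \<in># R" if "(g, h) \<in> set ps" for g h
  proof -
    have "[g, h] \<in> (\<lambda>(g, h). [g, h]) ` set ps" using that by (rule rev_image_eqI) simp
    then have "g \<in># mset (concat (map (\<lambda>(g, h). [g, h]) ps))" "h \<in># mset (concat (map (\<lambda>(g, h). [g, h]) ps))"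
      unfolding set_mset_mset set_concat set_map by (meson UN_I list.set_intros)+
    then show ?thesis using ps(3) by (meson mset_subset_eqD)
  qed
  have "min q (1 + length ps) \<le> nres q (val ` choices ps)"
  proof (rule nres_choices_val[where t = t], clarify)
    fix a b a' b' assume mem: "((a, b), a', b') \<in> set ps"
    have "snd (a, b) mod p = t" "snd (a', b') mod p = t"
      using psR[OF mem] RO Omem by (meson mset_subset_eqD)+
    then show "\<not> [fst (a, b) = fst (a', b')] (mod int q) \<and> [snd (a, b) = t] (mod p) \<and> [snd (a', b') = t] (mod p)"
      using ps(2) mem by (auto simp: cong_def)
  qed
  then have big: "p + 1 \<le> nres q (val ` choices ps)" using ps(1) q_ge(1) by linarith
  have "min q (1 + size U) \<le> nres q (zsums U)"
  proof (rule nres_zsums)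
    show "p dvd dg U" using U by (intro Odg) (auto simp: k_def)
    fix V assume V: "V \<subseteq># U" "V \<noteq> {#}"
    show "\<not> one V"
    proof
      assume "one V"
      moreover have "V \<subseteq># S" using V(1) U(1) OS by (meson subset_mset.order_trans)
      moreover have "size V \<le> q - 1" using size_mset_mono[OF V(1)] U(2) k by linarith
      ultimately show False using short_one_contradiction V(2) by blast
    qed
  qed
  then have "q - p \<le> nres q (zsums U)" using U(2) k q_ge(1) by linarith
  moreover have "nres q ((\<lambda>x. (- 1) * x + 0) ` val ` choices ps) = nres q (val ` choices ps)"
    using q_pos by (intro nres_affine) auto
  ultimately have "nres q (zsums U) + nres q ((\<lambda>x. (- 1) * x + 0) ` val ` choices ps) > q"
    using big q_ge(1) by linarith
  then obtain a b' where ab': "a \<in> zsums U" "b' \<in> (\<lambda>x. (- 1) * x + 0) ` val ` choices ps" "[a = b'] (mod int q)"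
    by (rule nres_pigeonhole[OF q_pos])
  then obtain c where ac: "a \<in> zsums U" "c \<in> choices ps" "[a = - val c] (mod int q)" by auto
  have csz: "size (mset c) = p" using choices_length[OF ac(2)] ps(1) by simp
  have cR: "mset c \<subseteq># R" using choices_subset[OF ac(2)] ps(3) subset_mset.order_trans by blast
  have "p dvd dg (mset c)" using cR RO csz by (intro Odg) (auto intro: subset_mset.order_trans)
  then obtain V v where V: "mset c \<subseteq># V" "V \<subseteq># U + mset c" "p dvd dg V" "v \<in> vals V"
    "[a + val c = v] (mod int q)"
    using zsums_plus(2)[OF ac(1) valsI[OF refl, of c]] by blast
  have "[a + val c = - val c + val c] (mod int q)" using ac(3) by (intro cong_add) auto
  then have "[v = 0] (mod int q)" using cong_trans[OF cong_sym[OF V(5)]] by simp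
  then have "one V" using V unfolding one_def by (auto simp: cong_0_iff)
  moreover have "V \<subseteq># S"
  proof -
    have "U + mset c \<subseteq># U + R" using cR by simp
    also have "U + R = Os" unfolding R_def using U(1) by simp
    finally show ?thesis using V(2) OS by (meson subset_mset.order_trans)
  qed
  moreover have "V \<noteq> {#}" using V(1) csz p_pos by auto
  moreover have "size V \<le> q - 1" using size_mset_mono[OF V(2)] U(2) csz k by simp
  ultimately show False using short_one_contradiction by blast
qed

end

theorem one_splits: "one S \<Longrightarrow> 2 * q + 1 \<le> size S \<Longrightarrow> splits S"
  using split_contradiction by blast

section \<open>Exponents modulo a prime power\<close>

lemma one_sum_list: "(\<And>M. M \<in> set Ms \<Longrightarrow> one M) \<Longrightarrow> one (sum_list Ms)"
proof (induction Ms)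
  case Nil
  have "val [] \<in> vals {#}" by (rule valsI) simp
  then show ?case unfolding one_def by auto
qed (simp add: one_plus)

lemma one_decompose:
  "one S \<Longrightarrow> \<exists>Ms. sum_list Ms = S \<and> (\<forall>M\<in>set Ms. one M \<and> M \<noteq> {#} \<and> size M \<le> 2 * q)"
proof (induction "size S" arbitrary: S rule: less_induct)
  case less
  consider "S = {#}" | "S \<noteq> {#}" "size S \<le> 2 * q" | "2 * q + 1 \<le> size S" by linarith
  then show ?case
  proof cases
    case 1 then show ?thesis by (intro exI[of _ "[]"]) simp
  next
    case 2 then show ?thesis using less.prems by (intro exI[of _ "[S]"]) simp
  next
    case 3
    then obtain T U where TU: "S = T + U" "T \<noteq> {#}" "U \<noteq> {#}" "one T" "one U"
      using one_splits[OF less.prems] unfolding splits_def by blast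
    have "size T < size S" "size U < size S" using TU by (simp_all add: nonempty_has_size)
    then obtain Ms Ns where "sum_list Ms = T" "\<forall>M\<in>set Ms. one M \<and> M \<noteq> {#} \<and> size M \<le> 2 * q"
      "sum_list Ns = U" "\<forall>M\<in>set Ns. one M \<and> M \<noteq> {#} \<and> size M \<le> 2 * q"
      using less.hyps TU(4,5) by metis
    then show ?thesis using TU(1) by (intro exI[of _ "Ms @ Ns"]) auto
  qed
qed

text \<open>There are more than \<open>p ^ k\<close> product-one pieces of length at most
  \<open>2 * q\<close>. Their exponents are multiples of \<open>p\<close>, so prefix sums take at
  most \<open>p ^ k\<close> values modulo \<open>p ^ Suc k\<close>, and two of them agree.\<close>

lemma splits_prime_power:
  assumes dS: "p ^ Suc k dvd dg S" and vS: "\<exists>v\<in>vals S. int q dvd v" and big: "2 * q * p ^ k < size S"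
  shows "\<exists>T U. S = T + U \<and> T \<noteq> {#} \<and> U \<noteq> {#} \<and> p ^ Suc k dvd dg T \<and> p ^ Suc k dvd dg U \<and>
    (\<exists>v\<in>vals T. int q dvd v) \<and> (\<exists>v\<in>vals U. int q dvd v)"
proof -
  have "p dvd dg S" using dS by (simp add: dvd_mult_left)
  then have "one S" using vS unfolding one_def by blast
  then obtain Ms where Ms: "sum_list Ms = S" "\<And>M. M \<in> set Ms \<Longrightarrow> one M \<and> M \<noteq> {#} \<and> size M \<le> 2 * q"
    using one_decompose by blast
  have "size (sum_list Ms) \<le> 2 * q * length Ms" using Ms(2)
  proof (induction Ms)
    case (Cons M Ms)
    have "size M \<le> 2 * q" "size (sum_list Ms) \<le> 2 * q * length Ms" using Cons by auto
    then show ?case by simp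
  qed simp
  then have "size S \<le> 2 * q * length Ms" unfolding Ms(1) .
  with big have "2 * q * p ^ k < 2 * q * length Ms" by (rule less_le_trans)
  then have len: "p ^ k < length Ms" by (metis mult_less_cancel1)
  \<comment> \<open>Prefixes of 0 to \<open>p ^ k\<close> pieces. The list is longer than that, so
    pieces remain behind the second cut and \<open>U\<close> is nonempty.\<close>
  let ?f = "\<lambda>i. dg (sum_list (take i Ms)) mod p ^ Suc k"
  have "?f ` {..p ^ k} \<subseteq> (\<lambda>x. p * x) ` {..<p ^ k}"
  proof (rule image_subsetI)
    fix i
    have "one (sum_list (take i Ms))" using Ms(2) by (intro one_sum_list) (auto dest: in_set_takeD)
    then have "p dvd dg (sum_list (take i Ms))" unfolding one_def by simp
    then have "p dvd ?f i" by (simp add: dvd_mod)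
    then obtain x where x: "?f i = p * x" by blast
    moreover have "?f i < p * p ^ k" using p_pos by simp
    ultimately have "x < p ^ k" by simp
    then show "?f i \<in> (\<lambda>x. p * x) ` {..<p ^ k}" using x by blast
  qed
  then have "card (?f ` {..p ^ k}) \<le> card ((\<lambda>x. p * x) ` {..<p ^ k})" by (intro card_mono) auto
  also have "\<dots> \<le> p ^ k" using card_image_le[of "{..<p ^ k}"] by fastforce
  finally have "\<not> inj_on ?f {..p ^ k}" using pigeonhole[of ?f "{..p ^ k}"] by simp
  then obtain i j where ij: "i < j" "j \<le> p ^ k" "?f i = ?f j"
    unfolding inj_on_def by (metis atMost_iff linorder_neqE_nat)
  define As Bs Cs where "As = take i Ms" and "Bs = drop i (take j Ms)" and "Cs = drop j Ms"
  have tj: "take j Ms = As @ Bs"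
    unfolding As_def Bs_def using ij(1) by (metis append_take_drop_id less_imp_le_nat min.absorb1 take_take)
  then have Mseq: "Ms = As @ Bs @ Cs" unfolding Cs_def by (metis append.assoc append_take_drop_id)
  define T U where "T = sum_list Bs" and "U = sum_list As + sum_list Cs"
  have STU: "S = T + U" using Ms(1) unfolding Mseq T_def U_def by (simp add: ac_simps)
  have "[dg (sum_list As) + dg T = dg (sum_list As) + 0] (mod p ^ Suc k)"
    using ij(3) tj unfolding cong_def As_def[symmetric] T_def by simp
  then have dT: "p ^ Suc k dvd dg T" by (simp only: cong_add_lcancel_nat cong_0_iff)
  then have dU: "p ^ Suc k dvd dg U" using dS unfolding STU by (simp only: dg_simps dvd_add_right_iff)
  have "one T" unfolding T_def using Ms(2) Mseq by (intro one_sum_list) auto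
  moreover have "one U" unfolding U_def using Ms(2) Mseq by (intro one_plus one_sum_list) auto
  moreover have ne: "sum_list Ns \<noteq> {#}" if "Ns \<noteq> []" "set Ns \<subseteq> set Ms" for Ns
    using that Ms(2) by (cases Ns) auto
  have sub: "set Bs \<subseteq> set Ms" "set Cs \<subseteq> set Ms" by (subst Mseq, auto)+
  have "Bs \<noteq> []" "Cs \<noteq> []" unfolding Bs_def Cs_def using ij len by auto
  then have "sum_list Bs \<noteq> {#}" "sum_list Cs \<noteq> {#}" using ne sub by blast+
  then have "T \<noteq> {#}" "U \<noteq> {#}" unfolding T_def U_def by auto
  ultimately show ?thesis using STU dT dU unfolding one_def by blast
qed

end

section \<open>Zero sums of pairs of residues\<close>

text \<open>The alternating sum over all subsets is an iterated finite difference, one for each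
  element of \<open>N\<close>. Each difference lowers the degree, so a product of fewer affine forms
  than elements gives 0.\<close>

lemma alternating_affine_products:
  fixes N :: "'i set" and fs :: "(int \<times> ('i \<Rightarrow> int)) list"
  assumes "finite N" "length fs < card N"
  shows "(\<Sum>I\<in>Pow N. (- 1) ^ card I * (\<Prod>(c, a)\<leftarrow>fs. c + (\<Sum>i\<in>I. a i))) = 0"
  using assms
proof (induction N arbitrary: fs rule: finite_induct)
  case (insert x N)
  define F where "F = (\<lambda>fs (I :: 'i set). \<Prod>(c, a)\<leftarrow>fs. (c :: int) + (\<Sum>i\<in>I. a i))"
  define sh where "sh = map (\<lambda>(c, a). (c + a x :: int, a :: 'i \<Rightarrow> int))"
  have F_append: "F (gs @ hs) I = F gs I * F hs I" for gs hs I unfolding F_def by simp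
  have F_Cons: "F (f # hs) I = F [f] I * F hs I" for f hs I unfolding F_def by simp
  have F_sh: "F (sh hs) I = F hs (insert x I)" if "I \<in> Pow N" for hs I
  proof -
    have "x \<notin> I" "finite I" using that insert.hyps finite_subset by auto
    then show ?thesis unfolding F_def sh_def
      by (induction hs) (auto simp: algebra_simps)
  qed
  have zero: "(\<Sum>I\<in>Pow N. (- 1) ^ card I * F gs I) = 0" if "length gs < card N" for gs
    using insert.IH[OF that] unfolding F_def .
  \<comment> \<open>Telescoping: the factors are shifted one at a time, and each replacement
    contributes a product with one factor fewer, to which \<open>zero\<close> applies.
    \<open>gs\<close> collects the factors already passed.\<close>
  have claim: "(\<Sum>I\<in>Pow N. (- 1) ^ card I * (F gs I * (F hs I - F (sh hs) I))) = 0"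
    if "length gs + length hs \<le> card N" for gs hs
    using that
  proof (induction hs arbitrary: gs)
    case Nil
    then show ?case by (simp add: F_def sh_def)
  next
    case (Cons f hs)
    obtain c a where f: "f = (c, a)" by (cases f)
    have shC: "sh (f # hs) = (c + a x, a) # sh hs" unfolding sh_def f by simp
    have d: "F [(c + a x, a)] I = F [f] I + a x" for I unfolding F_def f by simp
    have eq: "F gs I * (F (f # hs) I - F (sh (f # hs)) I)
      = F (gs @ [f]) I * (F hs I - F (sh hs) I) - a x * F (gs @ sh hs) I" for I
      unfolding shC F_Cons[of f hs] F_Cons[of "(c + a x, a)" "sh hs"] F_append d by (simp add: algebra_simps)
    have "(\<Sum>I\<in>Pow N. (- 1) ^ card I * (F gs I * (F (f # hs) I - F (sh (f # hs)) I)))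
      = (\<Sum>I\<in>Pow N. (- 1) ^ card I * (F (gs @ [f]) I * (F hs I - F (sh hs) I)))
        - a x * (\<Sum>I\<in>Pow N. (- 1) ^ card I * F (gs @ sh hs) I)"
      unfolding eq sum_distrib_left sum_subtractf[symmetric]
      by (rule sum.cong[OF refl]) (simp add: algebra_simps)
    also have "\<dots> = 0"
      using Cons.IH[of "gs @ [f]"] Cons.prems zero[of "gs @ sh hs"] by (simp add: sh_def)
    finally show ?case .
  qed
  have inj: "inj_on (insert x) (Pow N)" 
    using insert.hyps(2) by (intro inj_onI) (metis PowD insert_ident subsetD)
  have disj: "Pow N \<inter> insert x ` Pow N = {}" using insert.hyps by blast
  have "(\<Sum>I\<in>Pow (insert x N). (- 1) ^ card I * F fs I)
    = (\<Sum>I\<in>Pow N. (- 1) ^ card I * F fs I) + (\<Sum>I\<in>insert x ` Pow N. (- 1) ^ card I * F fs I)"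
    unfolding Pow_insert using insert.hyps disj by (intro sum.union_disjoint) auto
  also have "(\<Sum>I\<in>insert x ` Pow N. (- 1) ^ card I * F fs I)
    = (\<Sum>I\<in>Pow N. (- 1) ^ card (insert x I) * F fs (insert x I))"
    by (simp add: sum.reindex[OF inj])
  also have "\<dots> = (\<Sum>I\<in>Pow N. - ((- 1) ^ card I * F (sh fs) I))"
  proof (rule sum.cong[OF refl])
    fix I assume I: "I \<in> Pow N"
    then have "x \<notin> I" "finite I" using insert.hyps finite_subset by auto
    then show "(- 1) ^ card (insert x I) * F fs (insert x I) = - ((- 1) ^ card I * F (sh fs) I)"
      using F_sh[OF I] by simp
  qed
  also have "(\<Sum>I\<in>Pow N. (- 1) ^ card I * F fs I) + \<dots>
    = (\<Sum>I\<in>Pow N. (- 1) ^ card I * (F [] I * (F fs I - F (sh fs) I)))"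
    by (simp add: F_def sum_negf sum_subtractf algebra_simps)
  also have "\<dots> = 0" using insert.prems insert.hyps by (intro claim) auto
  finally show ?case unfolding F_def .
qed simp

lemma fermat_int:
  fixes x :: int
  assumes "prime l" "\<not> int l dvd x"
  shows "[x ^ (l - 1) = 1] (mod int l)"
proof -
  define y where "y = nat (x mod int l)"
  have "int l > 0" using assms(1) prime_gt_0_nat by simp
  then have y: "int y = x mod int l" unfolding y_def by simp
  have "\<not> l dvd y" using assms(2) y by (metis dvd_mod_iff dvd_refl int_dvd_int_iff)
  then have "[y ^ (l - 1) = 1] (mod l)" using fermat_theorem[OF assms(1)] by simp
  then have "[int (y ^ (l - 1)) = int 1] (mod int l)" by (simp only: cong_int_iff)
  then have "[(x mod int l) ^ (l - 1) = 1] (mod int l)" using y by simp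
  moreover have "[x ^ (l - 1) = (x mod int l) ^ (l - 1)] (mod int l)"
    by (intro cong_pow) (simp add: cong_def)
  ultimately show ?thesis using cong_trans by blast
qed

text \<open>Olson's bound for the Davenport constant of a product of two cyclic groups of prime order, by
  the polynomial method: the product below has degree \<open>2 (l - 1)\<close> in the indicator variables
  of \<open>I\<close>, so its alternating sum over all \<open>I\<close> vanishes.\<close>

lemma zero_sum_pair_exists:
  fixes a b :: "nat \<Rightarrow> int"
  assumes l: "prime l" and N: "finite N" "2 * l - 1 \<le> card N"
  shows "\<exists>I. I \<subseteq> N \<and> I \<noteq> {} \<and> int l dvd (\<Sum>i\<in>I. a i) \<and> int l dvd (\<Sum>i\<in>I. b i)"
proof (rule ccontr)
  assume none: "\<not> ?thesis"
  let ?A = "\<lambda>I. \<Sum>i\<in>I. a i" and ?B = "\<lambda>I. \<Sum>i\<in>I. b i"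
  have l2: "l \<ge> 2" using l prime_ge_2_nat by blast
  define G where "G = (\<lambda>m n. \<Sum>I\<in>Pow N. (- 1) ^ card I * (?A I ^ m * ?B I ^ n))"
  have G0: "G m n = 0" if "m + n < card N" for m n
    using alternating_affine_products[OF N(1), of "replicate m (0, a) @ replicate n (0, b)"] that
    unfolding G_def by simp
  \<comment> \<open>By Fermat's theorem a factor vanishes modulo \<open>l\<close> unless its sum is
    divisible by \<open>l\<close>. Under the assumption \<open>none\<close> only
    \<open>I = {}\<close> survives, with the value 1.\<close>
  define f where "f = (\<lambda>I. (- 1) ^ card I * ((1 - ?A I ^ (l - 1)) * (1 - ?B I ^ (l - 1))))"
  have "(\<Sum>I\<in>Pow N. f I) = G 0 0 - G (l - 1) 0 - G 0 (l - 1) + G (l - 1) (l - 1)"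
    unfolding f_def G_def by (simp add: algebra_simps sum.distrib sum_subtractf)
  also have "\<dots> = 0" using N(2) l2 by (simp add: G0)
  finally have S0: "(\<Sum>I\<in>Pow N. f I) = 0" .
  have z: "[f I = 0] (mod int l)" if I: "I \<in> Pow N - {{}}" for I
  proof -
    have "\<not> int l dvd ?A I \<or> \<not> int l dvd ?B I" using none I by blast
    then have "[1 - ?A I ^ (l - 1) = 0] (mod int l) \<or> [1 - ?B I ^ (l - 1) = 0] (mod int l)"
      using fermat_int[OF l] by (metis cong_diff_iff_cong_0 cong_sym)
    then show ?thesis unfolding f_def by (auto simp: cong_0_iff)
  qed
  have "(\<Sum>I\<in>Pow N. f I) = f {} + (\<Sum>I\<in>Pow N - {{}}. f I)"
    using N(1) by (intro sum.remove) auto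
  moreover have "f {} = 1"
  proof -
    have z0: "(0 :: int) ^ (l - 1) = 0" using l2 by (intro zero_power) simp
    have "f {} = (1 - 0 ^ (l - 1)) * (1 - 0 ^ (l - 1))" unfolding f_def by simp
    then show ?thesis unfolding z0 by simp
  qed
  moreover have "int l dvd (\<Sum>I\<in>Pow N - {{}}. f I)" using z by (intro dvd_sum) (auto simp: cong_0_iff)
  ultimately have "int l dvd 1" using S0 by (metis add.commute add_diff_cancel_left' diff_0 dvd_minus_iff)
  then show False using l2 by simp
qed

section \<open>Subgroups of given index\<close>

text \<open>Used to lift a regrouping of block products to a reordering of the blocks
  themselves.\<close>

lemma mset_map_eq_obtain:
  "mset (map f xs) = mset ys \<Longrightarrow> \<exists>xs'. mset xs' = mset xs \<and> map f xs' = ys"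
proof (induction ys arbitrary: xs)
  case (Cons y ys)
  have "y \<in> set (map f xs)" using Cons.prems by (metis list.set_intros(1) mset_eq_setD)
  then obtain x where x: "x \<in> set xs" "f x = y" by auto
  have m: "mset xs = add_mset x (mset (remove1 x xs))" using x by simp
  have "mset (map f (remove1 x xs)) = mset ys"
    by (metis (no_types) Cons.prems m x(2) add_mset_add_mset_same_iff image_mset_add_mset mset.simps(2) mset_map)
  then obtain xs' where xs': "mset xs' = mset (remove1 x xs)" "map f xs' = ys" using Cons.IH by blast
  have "mset (x # xs') = mset xs" unfolding mset.simps(2) xs'(1) m[symmetric] ..
  moreover have "map f (x # xs') = y # ys" using xs'(2) x(2) by simp
  ultimately show ?case by (intro exI[of _ "x # xs'"] conjI)
qed simp

context group
begin

abbreviation gprod :: "'a list \<Rightarrow> 'a" where "gprod xs \<equiv> foldr (\<otimes>) xs \<one>"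

lemma gprod_concat:
  "(\<And>B. B \<in> set Bs \<Longrightarrow> set B \<subseteq> carrier G) \<Longrightarrow> gprod (concat Bs) = gprod (map gprod Bs)"
proof (induction Bs)
  case (Cons B Bs)
  have "gprod (B @ concat Bs) = gprod B \<otimes> gprod (concat Bs)"
    using Cons.prems by (intro foldr_mult_append) auto
  then show ?case using Cons by simp
qed simp

text \<open>Cut at every prefix with product in \<open>H\<close>; between consecutive cuts the
  product lies in \<open>H\<close> again. The count includes the empty prefix in place of the full
  one.\<close>

lemma blocks_in_subgroup:
  assumes H: "subgroup H G" and xs: "set xs \<subseteq> carrier G" "gprod xs \<in> H"
  shows "\<exists>Bs. concat Bs = xs \<and> [] \<notin> set Bs \<and> (\<forall>B\<in>set Bs. gprod B \<in> H) \<and>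
    length Bs = card {i. i < length xs \<and> gprod (take i xs) \<in> H}"
  using xs
proof (induction "length xs" arbitrary: xs rule: less_induct)
  case less
  interpret H: subgroup H G by (rule H)
  show ?case
  proof (cases "xs = []")
    case True
    then show ?thesis by (intro exI[of _ "[]"]) simp
  next
    case False
    define n where "n = length xs"
    let ?Q = "\<lambda>j. 1 \<le> j \<and> gprod (take j xs) \<in> H"
    have Qn: "?Q n" using less.prems False by (cases xs) (auto simp: n_def)
    define j where "j = (LEAST j. ?Q j)"
    have j: "?Q j" and jl: "\<And>i. i < j \<Longrightarrow> \<not> ?Q i" and jn: "j \<le> n"
      unfolding j_def using LeastI[of ?Q, OF Qn] not_less_Least[of _ ?Q] Least_le[of ?Q, OF Qn] by auto
    define B r where "B = take j xs" and "r = drop j xs"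
    have xBr: "xs = B @ r" unfolding B_def r_def by simp
    have carr: "set B \<subseteq> carrier G" "set r \<subseteq> carrier G" using less.prems(1) xBr by auto
    have gB: "gprod B \<in> H" using j unfolding B_def by simp
    have eqv: "gprod (B @ ys) \<in> H \<longleftrightarrow> gprod ys \<in> H" if ys: "set ys \<subseteq> carrier G" for ys
    proof -
      have e: "gprod (B @ ys) = gprod B \<otimes> gprod ys" using carr(1) ys by (rule foldr_mult_append)
      have yc: "gprod ys \<in> carrier G" using ys by (rule foldr_mult_closed)
      show ?thesis
      proof
        assume "gprod (B @ ys) \<in> H"
        then have "inv (gprod B) \<otimes> (gprod B \<otimes> gprod ys) \<in> H" using gB e by auto
        then show "gprod ys \<in> H" using yc gB H.mem_carrier by (simp add: m_assoc[symmetric])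
      next
        assume "gprod ys \<in> H" then show "gprod (B @ ys) \<in> H" unfolding e using gB by simp
      qed
    qed
    have "length r < length xs" using j jn False unfolding r_def n_def by auto
    moreover have "gprod r \<in> H" using eqv[OF carr(2)] less.prems(2) xBr by metis
    ultimately obtain Bs where Bs: "concat Bs = r" "[] \<notin> set Bs" "\<forall>B\<in>set Bs. gprod B \<in> H"
      "length Bs = card {i. i < length r \<and> gprod (take i r) \<in> H}"
      using less.hyps carr(2) by blast
    have "{i. i < length xs \<and> gprod (take i xs) \<in> H}
      = insert 0 ((\<lambda>i. j + i) ` {i. i < length r \<and> gprod (take i r) \<in> H})" (is "?L = ?R")
    proof (intro equalityI subsetI)
      fix i assume i: "i \<in> ?L"
      show "i \<in> ?R"
      proof (cases "i < j")
        case True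
        then have "i = 0" using jl[OF True] i by (cases i) auto
        then show ?thesis by simp
      next
        case F: False
        have "take i xs = B @ take (i - j) r" unfolding xBr using F jn
          by (simp add: B_def n_def)
        moreover have "set (take (i - j) r) \<subseteq> carrier G" using carr(2) by (meson set_take_subset subset_trans)
        ultimately have "gprod (take (i - j) r) \<in> H" using i eqv by (metis (mono_tags, lifting) mem_Collect_eq)
        moreover have "i - j < length r" using i F unfolding r_def by auto
        ultimately show ?thesis using F by (intro insertI2 image_eqI[of _ _ "i - j"]) auto
      qed
    next
      fix i assume "i \<in> ?R"
      then consider "i = 0" | i' where "i = j + i'" "i' < length r" "gprod (take i' r) \<in> H" by blast
      then show "i \<in> ?L"
      proof cases
        case 1 then show ?thesis using False by simp
      next
        case 2
        have "take i xs = B @ take i' r" unfolding xBr 2(1) using jn by (simp add: B_def n_def)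
        moreover have "set (take i' r) \<subseteq> carrier G" using carr(2) by (meson set_take_subset subset_trans)
        ultimately have "gprod (take i xs) \<in> H" using eqv 2(3) by metis
        then show ?thesis using 2 jn unfolding r_def n_def by auto
      qed
    qed
    moreover have "0 \<notin> (\<lambda>i. j + i) ` {i. i < length r \<and> gprod (take i r) \<in> H}" using j by auto
    ultimately have "card {i. i < length xs \<and> gprod (take i xs) \<in> H} = Suc (length Bs)"
      unfolding Bs(4) by (simp add: card_image)
    moreover have "B \<noteq> []" unfolding B_def using j False by auto
    ultimately show ?thesis using Bs xBr gB by (intro exI[of _ "B # Bs"]) auto
  qed
qed

text \<open>Prefix products of a product-one ordering that lie in the same left coset of \<open>H\<close> cut the
  ordering into blocks whose products lie in \<open>H\<close>.\<close>

lemma minimal_product_one_index_bound: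
  assumes fin: "finite (carrier G)" and H: "subgroup H G"
    and N: "\<And>S. set_mset S \<subseteq> H \<Longrightarrow> minimal_product_one G S \<Longrightarrow> size S \<le> N"
    and S: "minimal_product_one G S"
  shows "size S * card H \<le> N * order G"
proof (rule ccontr)
  assume neg: "\<not> ?thesis"
  interpret H: subgroup H G by (rule H)
  obtain xs where xs: "mset xs = S" "gprod xs = \<one>" "set xs \<subseteq> carrier G"
    using S unfolding minimal_product_one_def product_one_def by auto
  define n where "n = length xs"
  have nS: "n = size S" unfolding n_def using xs(1) by auto
  define P where "P = (\<lambda>i. gprod (take i xs))"
  have Pc: "P i \<in> carrier G" for i
    unfolding P_def using xs(3) by (intro foldr_mult_closed) (meson set_take_subset subset_trans)
  have finR: "finite (rcosets H)" using fin rcosets_subset_PowG[OF H] by (meson finite_Pow_iff finite_subset)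
  have lag: "card (rcosets H) * card H = order G" using lagrange[OF H] by simp
  \<comment> \<open>\<open>H #> inv (P i)\<close> encodes the left coset of \<open>P i\<close>: two
    of these agree iff \<open>inv (P i) \<otimes> P j\<close> lies in \<open>H\<close>.\<close>
  define f where "f = (\<lambda>i. H #> inv (P i))"
  have fR: "f i \<in> rcosets H" for i unfolding f_def RCOSETS_def using Pc by auto
  have "\<exists>C\<in>rcosets H. N < card {i. i < n \<and> f i = C}"
  proof (rule ccontr)
    assume "\<not> ?thesis"
    then have le: "\<And>C. C \<in> rcosets H \<Longrightarrow> card {i. i < n \<and> f i = C} \<le> N" by (meson not_le)
    have "{..<n} \<subseteq> (\<Union>C\<in>rcosets H. {i. i < n \<and> f i = C})" using fR by auto
    then have "card {..<n} \<le> card (\<Union>C\<in>rcosets H. {i. i < n \<and> f i = C})"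
      using finR by (intro card_mono) auto
    also have "\<dots> \<le> (\<Sum>C\<in>rcosets H. card {i. i < n \<and> f i = C})" by (rule card_UN_le[OF finR])
    also have "\<dots> \<le> (\<Sum>C\<in>rcosets H. N)" using le by (rule sum_mono)
    finally have "n \<le> card (rcosets H) * N" by simp
    then have "n * card H \<le> card (rcosets H) * N * card H" by (rule mult_le_mono1)
    also have "\<dots> = N * order G" using lag by (metis mult.assoc mult.commute)
    finally show False using neg nS by simp
  qed
  then obtain C where C: "N < card {i. i < n \<and> f i = C}" by blast
  define I where "I = {i. i < n \<and> f i = C}"
  have "card I \<noteq> 0" using C unfolding I_def by linarith
  then have finI: "finite I" and neI: "I \<noteq> {}" by (auto intro: card_ge_0_finite)
  define i0 where "i0 = Min I"
  have i0: "i0 \<in> I" "\<And>i. i \<in> I \<Longrightarrow> i0 \<le> i" unfolding i0_def using finI neI by auto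
  have i0n: "i0 < n" "f i0 = C" using i0(1) unfolding I_def by auto
  \<comment> \<open>Rotated to start at the first index of the chosen coset, so that the prefix
    products at its other indices lie in \<open>H\<close> itself.\<close>
  define ys where "ys = drop i0 xs @ take i0 xs"
  have ysS: "mset ys = S" unfolding ys_def using xs(1) by (metis append_take_drop_id mset_append union_commute)
  have carr: "set (drop i0 xs) \<subseteq> carrier G" "set (take i0 xs) \<subseteq> carrier G"
    using xs(3) by (meson set_drop_subset set_take_subset subset_trans)+
  have total: "P i0 \<otimes> gprod (drop i0 xs) = \<one>"
    unfolding P_def foldr_mult_append[OF carr(2,1), symmetric] using xs(2) by simp
  have dc: "gprod (drop i0 xs) \<in> carrier G" using carr(1) by (rule foldr_mult_closed)
  have "gprod ys = gprod (drop i0 xs) \<otimes> P i0" unfolding ys_def P_def using carr by (rule foldr_mult_append)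
  also have "\<dots> = \<one>" using total Pc dc by (metis inv_comm)
  finally have ys1: "gprod ys = \<one>" .
  have ysc: "set ys \<subseteq> carrier G" unfolding ys_def using carr by auto
  have "(\<lambda>i. i - i0) ` I \<subseteq> {i. i < length ys \<and> gprod (take i ys) \<in> H}"
  proof (rule image_subsetI)
    fix i assume i: "i \<in> I"
    then have ii: "i0 \<le> i" "i < n" "f i = C" using i0(2) unfolding I_def by auto
    have lenys: "length ys = n" unfolding ys_def n_def by simp
    have "take (i - i0) ys = take (i - i0) (drop i0 xs)" unfolding ys_def using ii by (simp add: n_def)
    moreover have "take i xs = take i0 xs @ take (i - i0) (drop i0 xs)"
      using ii(1) by (metis le_add_diff_inverse take_add)
    moreover have tc: "set (take (i - i0) (drop i0 xs)) \<subseteq> carrier G"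
      using carr(1) by (meson set_take_subset subset_trans)
    ultimately have Pi: "P i = P i0 \<otimes> gprod (take (i - i0) ys)"
      unfolding P_def using foldr_mult_append[OF carr(2) tc] by simp
    have gc: "gprod (take (i - i0) ys) \<in> carrier G" using ysc by (intro foldr_mult_closed) (meson set_take_subset subset_trans)
    have "inv (P i0) \<in> H #> inv (P i0)" using Pc H by (intro rcos_self) auto
    then have "inv (P i0) \<in> H #> inv (P i)" using ii(3) i0n(2) unfolding f_def by simp
    then obtain h where h: "h \<in> H" "inv (P i0) = h \<otimes> inv (P i)" unfolding r_coset_def by auto
    have hc: "h \<in> carrier G" using h(1) by (rule H.mem_carrier)
    have "inv (P i0) \<otimes> P i = h" unfolding h(2) using hc Pc by (simp add: m_assoc)
    then have "gprod (take (i - i0) ys) = h" unfolding Pi using Pc gc by (simp add: m_assoc[symmetric])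
    then show "i - i0 \<in> {i. i < length ys \<and> gprod (take i ys) \<in> H}" using h(1) ii lenys by auto
  qed
  moreover have "inj_on (\<lambda>i. i - i0) I" by (rule inj_onI) (metis i0(2) eq_diff_iff)
  ultimately have "card I \<le> card {i. i < length ys \<and> gprod (take i ys) \<in> H}"
    by (intro card_inj_on_le[of "\<lambda>i. i - i0"]) auto
  then have big: "N < card {i. i < length ys \<and> gprod (take i ys) \<in> H}" using C unfolding I_def by simp
  obtain Bs where Bs: "concat Bs = ys" "[] \<notin> set Bs" "\<forall>B\<in>set Bs. gprod B \<in> H"
      "length Bs = card {i. i < length ys \<and> gprod (take i ys) \<in> H}"
    using blocks_in_subgroup[OF H ysc] ys1 by auto
  have Bc: "set B \<subseteq> carrier G" if "B \<in> set Bs" for B using that Bs(1) ysc by (metis UN_upper set_concat subset_trans)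
  define cs where "cs = map gprod Bs"
  have "gprod (concat Bs) = gprod cs" unfolding cs_def by (rule gprod_concat) (rule Bc)
  then have cs1: "gprod cs = \<one>" using Bs(1) ys1 by (metis trans)
  have csH: "set cs \<subseteq> H" unfolding cs_def using Bs(3) by auto
  have csG: "set cs \<subseteq> carrier G" using csH H.subset by blast
  have po: "product_one G (mset cs)" using product_oneI[OF csG cs1] .
  have "N < size (mset cs)" unfolding cs_def using big Bs(4) by simp
  then have "\<not> minimal_product_one G (mset cs)" using N[of "mset cs"] csH by (metis leD set_mset_mset)
  moreover have "mset cs \<noteq> {#}" using \<open>N < size (mset cs)\<close> by auto
  ultimately obtain T U where TU: "mset cs = T + U" "T \<noteq> {#}" "U \<noteq> {#}" "product_one G T" "product_one G U"
    using po unfolding minimal_product_one_def by blast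
  obtain ts us where ts: "mset ts = T" "gprod ts = \<one>" and us: "mset us = U" "gprod us = \<one>"
    using TU(4,5) unfolding product_one_def by blast
  obtain Bs' where Bs': "mset Bs' = mset Bs" "map gprod Bs' = ts @ us"
    using mset_map_eq_obtain[of gprod Bs "ts @ us"] TU(1) ts us unfolding cs_def by auto
  define B1 B2 where "B1 = take (length ts) Bs'" and "B2 = drop (length ts) Bs'"
  have B12: "Bs' = B1 @ B2" unfolding B1_def B2_def by simp
  have m1: "map gprod B1 = ts" and m2: "map gprod B2 = us"
    unfolding B1_def B2_def using Bs'(2) by (metis append_eq_conv_conj take_map, metis append_eq_conv_conj drop_map)
  have sB: "set B1 \<subseteq> set Bs" "set B2 \<subseteq> set Bs" using Bs'(1) B12 by (metis mset_eq_setD set_append Un_upper1 Un_upper2)+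
  have one: "product_one G (mset (concat B))" if "set B \<subseteq> set Bs" "gprod (map gprod B) = \<one>" for B
  proof (rule product_oneI)
    show "set (concat B) \<subseteq> carrier G" using that(1) Bc by auto
    have "gprod (concat B) = gprod (map gprod B)" using that(1) Bc by (intro gprod_concat) blast
    then show "gprod (concat B) = \<one>" using that(2) by (rule trans)
  qed
  have ne: "mset (concat B) \<noteq> {#}" if "set B \<subseteq> set Bs" "B \<noteq> []" for B
    using that Bs(2) by (cases B) auto
  have "mset (concat Bs) = mset (concat Bs')" using Bs'(1)
    by (metis mset_concat mset_map sum_mset_sum_list)
  then have "S = mset (concat B1) + mset (concat B2)" using Bs(1) ysS B12 by simp
  moreover have "B1 \<noteq> []" "B2 \<noteq> []" using m1 m2 ts us TU(2,3) by auto
  ultimately show False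
    using S one[OF sB(1)] one[OF sB(2)] ne[OF sB(1)] ne[OF sB(2)] m1 m2 ts us
    unfolding minimal_product_one_def by metis
qed

end

section \<open>Minimal noncyclic groups\<close>

text \<open>Factor \<open>s ^ R - 1\<close> as \<open>s - 1\<close> times a geometric sum. Modulo a
  prime divisor of \<open>m\<close> the sum is \<open>R\<close>, so it is coprime to
  \<open>m\<close>, and \<open>m\<close> divides \<open>s - 1\<close>.\<close>

lemma cong_1_of_power_cong_1:
  fixes s m R :: nat
  assumes m0: "m > 0" and pw: "[s ^ R = 1] (mod m)" and pr: "\<And>l. prime l \<Longrightarrow> l dvd m \<Longrightarrow> [s = 1] (mod l) \<and> \<not> l dvd R"
  shows "[s = 1] (mod m)"
proof -
  let ?S = "\<Sum>i<R. int s ^ i"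
  have "coprime ?S (int m)"
  proof (rule ccontr)
    assume "\<not> coprime ?S (int m)"
    then obtain c where c: "c dvd ?S" "c dvd int m" "\<not> is_unit c" by (rule not_coprimeE)
    have "c \<noteq> 0" using c(2) m0 by auto
    then obtain l' where "prime l'" "l' dvd c" using c(3) prime_divisor_exists by blast
    then have l': "prime l'" "l' dvd ?S" "l' dvd int m" using c(1,2) dvd_trans by blast+
    define l where "l = nat l'"
    have ll: "int l = l'" unfolding l_def using l'(1) prime_ge_0_int by simp
    then have pl: "prime l" using l'(1) by (metis prime_nat_int_transfer)
    have d: "int l dvd ?S" "int l dvd int m" using l'(2,3) ll by auto
    then have lm: "l dvd m" by simp
    have "[s = 1] (mod l)" using pr[OF pl lm] by simp
    then have s1: "[int s = 1] (mod int l)" by (metis cong_int_iff of_nat_1)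
    have "[?S = (\<Sum>i<R. 1)] (mod int l)"
      by (rule cong_sum) (use cong_pow[OF s1] in simp)
    then have "int l dvd int R" using d(1) by (simp add: cong_dvd_iff)
    then show False using pr[OF pl lm] by simp
  qed
  moreover have "int m dvd (int s - 1) * ?S"
  proof -
    have "[int (s ^ R) = int 1] (mod int m)" using pw by (simp only: cong_int_iff)
    then have "int m dvd int s ^ R - 1" by (simp add: cong_iff_dvd_diff)
    then show ?thesis by (simp add: power_diff_1_eq)
  qed
  ultimately have "int m dvd int s - 1" by (metis coprime_commute coprime_dvd_mult_left_iff)
  then have "[int s = int 1] (mod int m)" by (simp add: cong_iff_dvd_diff)
  then show ?thesis by (simp only: cong_int_iff)
qed

text \<open>With \<open>s = 1 + d\<close> and \<open>r\<close> dividing \<open>d\<close>, the powers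
  are \<open>1 + i * d\<close> modulo \<open>r ^ 2\<close>. Their sum exceeds \<open>r\<close> by
  \<open>d * r * (r - 1) / 2\<close>, which vanishes because \<open>r\<close> is odd.\<close>

lemma geometric_sum_cong_prime_square:
  fixes s r :: nat
  assumes r: "odd r" and s: "[s = 1] (mod r)"
  shows "[(\<Sum>i<r. s ^ i) = r] (mod r ^ 2)"
proof -
  define d where "d = int s - 1"
  have "[int s = int 1] (mod int r)" using s by (simp only: cong_int_iff)
  then have rd: "int r dvd d" unfolding d_def by (simp add: cong_iff_dvd_diff)
  then have d2: "int r ^ 2 dvd d * d" by (metis mult_dvd_mono power2_eq_square)
  have pw: "[int s ^ i = 1 + int i * d] (mod int r ^ 2)" for i
  proof (induction i)
    case (Suc i)
    have "[int s * int s ^ i = int s * (1 + int i * d)] (mod int r ^ 2)" by (intro cong_mult Suc cong_refl)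
    also have "int s * (1 + int i * d) = 1 + int (Suc i) * d + int i * (d * d)"
      unfolding d_def by (simp add: algebra_simps)
    also have "[\<dots> = 1 + int (Suc i) * d + 0] (mod int r ^ 2)"
      using d2 by (intro cong_add cong_refl) (simp add: cong_0_iff)
    finally show ?case by simp
  qed simp
  obtain h where h: "r = 2 * h + 1" using r oddE by blast
  have tri: "(\<Sum>i<n. int i) * 2 = int n * (int n - 1)" for n
    by (induction n) (auto simp: algebra_simps)
  have "(\<Sum>i<r. int i) = int r * int h" using tri[of r] h by (simp add: algebra_simps)
  then have z: "int r ^ 2 dvd (\<Sum>i<r. int i) * d"
    using rd by (metis dvd_triv_left mult_dvd_mono power2_eq_square)
  have "[(\<Sum>i<r. int s ^ i) = (\<Sum>i<r. 1 + int i * d)] (mod int r ^ 2)"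
    by (rule cong_sum) (rule pw)
  also have "(\<Sum>i<r. 1 + int i * d) = int r + (\<Sum>i<r. int i) * d"
    by (simp add: sum.distrib sum_distrib_right)
  also have "[\<dots> = int r + 0] (mod int r ^ 2)"
    using z by (intro cong_add cong_refl) (simp add: cong_0_iff)
  finally have "[int (\<Sum>i<r. s ^ i) = int r] (mod int (r ^ 2))" by simp
  then show ?thesis by (simp only: cong_int_iff)
qed

section \<open>Cyclic subgroups, centralizers and conjugation\<close>

context group
begin

lemma inv_cancel_left [simp]:
  "g \<in> carrier G \<Longrightarrow> y \<in> carrier G \<Longrightarrow> inv g \<otimes> (g \<otimes> y) = y"
  "g \<in> carrier G \<Longrightarrow> y \<in> carrier G \<Longrightarrow> g \<otimes> (inv g \<otimes> y) = y"
  by (simp_all add: m_assoc[symmetric])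

lemma semicommuting_pow:
  fixes s t n :: nat
  assumes c: "a \<in> carrier G" "b \<in> carrier G" and ba: "b \<otimes> a = a [^] s \<otimes> b"
  shows "b [^] t \<otimes> a [^] n = a [^] (s ^ t * n) \<otimes> b [^] t"
proof -
  have 1: "b \<otimes> a [^] n = a [^] (s * n) \<otimes> b" for n :: nat
  proof (induction n)
    case (Suc n)
    have "b \<otimes> a [^] Suc n = (b \<otimes> a [^] n) \<otimes> a" using c by (simp add: m_assoc)
    also have "\<dots> = a [^] (s * n) \<otimes> (b \<otimes> a)" unfolding Suc using c by (simp add: m_assoc)
    also have "\<dots> = (a [^] (s * n) \<otimes> a [^] s) \<otimes> b" unfolding ba using c by (simp add: m_assoc)
    also have "\<dots> = a [^] (s * Suc n) \<otimes> b" using c by (simp add: nat_pow_mult algebra_simps)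
    finally show ?case .
  qed (use c in simp)
  show ?thesis
  proof (induction t arbitrary: n)
    case (Suc t)
    have "b [^] Suc t \<otimes> a [^] n = b [^] t \<otimes> (b \<otimes> a [^] n)" using c by (simp add: m_assoc)
    also have "\<dots> = (b [^] t \<otimes> a [^] (s * n)) \<otimes> b" unfolding 1 using c by (simp add: m_assoc)
    also have "\<dots> = a [^] (s ^ t * (s * n)) \<otimes> b [^] t \<otimes> b" unfolding Suc ..
    also have "\<dots> = a [^] (s ^ Suc t * n) \<otimes> b [^] Suc t" using c by (simp add: m_assoc algebra_simps)
    finally show ?case .
  qed (use c in simp)
qed

lemma semicommuting_mult_pow:
  fixes s n k :: nat
  assumes c: "a \<in> carrier G" "b \<in> carrier G" and ba: "b \<otimes> a = a [^] s \<otimes> b"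
  shows "(a [^] k \<otimes> b) [^] n = a [^] (k * (\<Sum>i<n. s ^ i)) \<otimes> b [^] n"
proof (induction n)
  case (Suc n)
  let ?e = "k * (\<Sum>i<n. s ^ i)"
  have "(a [^] k \<otimes> b) [^] Suc n = (a [^] ?e \<otimes> b [^] n) \<otimes> (a [^] k \<otimes> b)" using Suc by simp
  also have "\<dots> = a [^] ?e \<otimes> (b [^] n \<otimes> a [^] k) \<otimes> b" using c by (simp add: m_assoc)
  also have "\<dots> = (a [^] ?e \<otimes> a [^] (s ^ n * k)) \<otimes> (b [^] n \<otimes> b)"
    unfolding semicommuting_pow[OF c ba] using c by (simp add: m_assoc)
  also have "\<dots> = a [^] (k * (\<Sum>i<Suc n. s ^ i)) \<otimes> b [^] Suc n"
    using c by (simp add: nat_pow_mult algebra_simps)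
  finally show ?case .
qed (use c in simp)

lemma pow_inverse:
  assumes "finite (carrier G)" "g \<in> carrier G"
  shows "inv g = g [^] (ord g - 1)"
proof -
  have "ord g \<ge> 1" using ord_ge_1 assms by blast
  then have "g [^] (ord g - 1) \<otimes> g = g [^] ord g" by (metis Suc_diff_1 less_eq_Suc_le One_nat_def nat_pow_Suc)
  also have "\<dots> = \<one>" using assms(2) by simp
  finally show ?thesis using assms(2) by (intro inv_equality) auto
qed

lemma finite_closed_subgroup:
  assumes fin: "finite (carrier G)" and A: "A \<subseteq> carrier G" "\<one> \<in> A"
    and cl: "\<And>x y. x \<in> A \<Longrightarrow> y \<in> A \<Longrightarrow> x \<otimes> y \<in> A"
  shows "subgroup A G"
proof (rule subgroupI)
  fix g assume g: "g \<in> A"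
  have "g [^] n \<in> A" for n :: nat by (induction n) (use A g cl in auto)
  then show "inv g \<in> A" using pow_inverse[OF fin] g A(1) by auto
qed (use A cl in auto)

text \<open>Stated for subsets, so that it means the same in the group and in a subgroup; natural
  exponents suffice in finite groups.\<close>

definition is_cyclic :: "'a set \<Rightarrow> bool" where
  "is_cyclic K \<longleftrightarrow> (\<exists>x\<in>K. K \<subseteq> range (\<lambda>n::nat. x [^] n))"

lemma is_cyclic_commute:
  assumes "is_cyclic K" "K \<subseteq> carrier G" "x \<in> K" "y \<in> K"
  shows "x \<otimes> y = y \<otimes> x"
proof -
  obtain g where g: "g \<in> K" "K \<subseteq> range (\<lambda>n::nat. g [^] n)" using assms(1) unfolding is_cyclic_def by blast
  then obtain m n :: nat where "x = g [^] m" "y = g [^] n" using assms(3,4) by blast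
  then show ?thesis using g assms(2) by (auto simp: nat_pow_mult add.commute)
qed

lemma commuting_coprime_cyclic:
  fixes i t :: nat
  assumes c: "u \<in> carrier G" "w \<in> carrier G" "u \<otimes> w = w \<otimes> u" and co: "coprime (ord u) (ord w)"
  shows "u [^] i \<otimes> w [^] t \<in> range (\<lambda>n::nat. (u \<otimes> w) [^] n)"
proof -
  obtain n where n: "[n = i] (mod ord u)" "[n = t] (mod ord w)"
    using binary_chinese_remainder_nat[OF co] by blast
  have pe: "x [^] n = x [^] j" if "x \<in> carrier G" "[n = j] (mod ord x)" for x j
  proof -
    have "[int n = int j] (mod int (ord x))" using that(2) by (simp add: cong_int_iff)
    then have "int (ord x) dvd int j - int n" by (metis cong_iff_dvd_diff cong_sym)
    then show ?thesis using int_pow_eq[OF that(1), of "int n" "int j"] by (simp add: int_pow_int)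
  qed
  have "(u \<otimes> w) [^] n = u [^] n \<otimes> w [^] n" using c by (intro pow_mult_distrib) auto
  then have "(u \<otimes> w) [^] n = u [^] i \<otimes> w [^] t" using pe[OF c(1) n(1)] pe[OF c(2) n(2)] by simp
  then show ?thesis by (metis rangeI)
qed

definition centralizer :: "'a \<Rightarrow> 'a set" where
  "centralizer x = {h \<in> carrier G. h \<otimes> x = x \<otimes> h}"

definition center :: "'a set" where
  "center = {z \<in> carrier G. \<forall>h\<in>carrier G. z \<otimes> h = h \<otimes> z}"

definition conj_by :: "'a \<Rightarrow> 'a \<Rightarrow> 'a" where
  "conj_by g x = g \<otimes> x \<otimes> inv g"

lemma conj_by_closed [simp]: "g \<in> carrier G \<Longrightarrow> x \<in> carrier G \<Longrightarrow> conj_by g x \<in> carrier G"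
  unfolding conj_by_def by simp

lemma conj_by_mult: "g \<in> carrier G \<Longrightarrow> x \<in> carrier G \<Longrightarrow> y \<in> carrier G \<Longrightarrow> conj_by g (x \<otimes> y) = conj_by g x \<otimes> conj_by g y"
  unfolding conj_by_def by (simp add: m_assoc)

lemma conj_by_conj_by: "g \<in> carrier G \<Longrightarrow> h \<in> carrier G \<Longrightarrow> x \<in> carrier G \<Longrightarrow> conj_by g (conj_by h x) = conj_by (g \<otimes> h) x"
  unfolding conj_by_def by (simp add: m_assoc inv_mult_group)

lemma conj_by_one [simp]: "x \<in> carrier G \<Longrightarrow> conj_by \<one> x = x"
  unfolding conj_by_def by simp

lemma conj_by_inv: "g \<in> carrier G \<Longrightarrow> x \<in> carrier G \<Longrightarrow> conj_by (inv g) (conj_by g x) = x"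
  "g \<in> carrier G \<Longrightarrow> x \<in> carrier G \<Longrightarrow> conj_by g (conj_by (inv g) x) = x"
  by (simp_all add: conj_by_conj_by)

lemma conj_by_inj: "g \<in> carrier G \<Longrightarrow> x \<in> carrier G \<Longrightarrow> y \<in> carrier G \<Longrightarrow> conj_by g x = conj_by g y \<longleftrightarrow> x = y"
  by (metis conj_by_inv(1))

lemma conj_by_centralizer_iff:
  assumes "g \<in> carrier G" "x \<in> carrier G" "y \<in> carrier G"
  shows "conj_by g y \<in> centralizer (conj_by g x) \<longleftrightarrow> y \<in> centralizer x"
proof -
  have "conj_by g y \<otimes> conj_by g x = conj_by g x \<otimes> conj_by g y \<longleftrightarrow> y \<otimes> x = x \<otimes> y"
    using assms conj_by_inj[of g "y \<otimes> x" "x \<otimes> y"] by (simp add: conj_by_mult)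
  then show ?thesis unfolding centralizer_def using assms by simp
qed

lemma conj_by_commute: "g \<in> carrier G \<Longrightarrow> x \<in> centralizer g \<Longrightarrow> conj_by g x = x"
proof -
  assume g: "g \<in> carrier G" and x: "x \<in> centralizer g"
  then have xc: "x \<in> carrier G" and eq: "x \<otimes> g = g \<otimes> x" unfolding centralizer_def by auto
  have "conj_by g x = x \<otimes> g \<otimes> inv g" unfolding conj_by_def eq ..
  also have "\<dots> = x" using g xc by (simp add: m_assoc)
  finally show ?thesis .
qed

lemma conj_by_center: "g \<in> carrier G \<Longrightarrow> z \<in> center \<Longrightarrow> conj_by g z = z"
  by (intro conj_by_commute) (auto simp: center_def centralizer_def)

lemma conj_by_notin_center: "g \<in> carrier G \<Longrightarrow> x \<in> carrier G \<Longrightarrow> x \<notin> center \<Longrightarrow> conj_by g x \<notin> center"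
  using conj_by_center[of "inv g" "conj_by g x"] conj_by_inv(1)[of g x] by auto

lemma centralizer_subgroup:
  assumes "x \<in> carrier G"
  shows "subgroup (centralizer x) G"
proof (rule subgroupI)
  show "centralizer x \<subseteq> carrier G" unfolding centralizer_def by auto
  show "centralizer x \<noteq> {}" unfolding centralizer_def using assms by auto
  fix a assume a: "a \<in> centralizer x"
  then have ac: "a \<in> carrier G" "a \<otimes> x = x \<otimes> a" unfolding centralizer_def by auto
  have "inv a \<otimes> (a \<otimes> x) \<otimes> inv a = inv a \<otimes> (x \<otimes> a) \<otimes> inv a" using ac(2) by simp
  then have "x \<otimes> inv a = inv a \<otimes> x" using ac(1) assms by (simp add: m_assoc)
  then show "inv a \<in> centralizer x" unfolding centralizer_def using ac by auto
  fix b assume b: "b \<in> centralizer x"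
  then have bc: "b \<in> carrier G" "b \<otimes> x = x \<otimes> b" unfolding centralizer_def by auto
  have "a \<otimes> b \<otimes> x = a \<otimes> (x \<otimes> b)" using ac bc assms by (simp add: m_assoc)
  also have "\<dots> = x \<otimes> (a \<otimes> b)" using ac bc assms by (metis m_assoc)
  finally show "a \<otimes> b \<in> centralizer x" unfolding centralizer_def using ac bc by auto
qed

text \<open>Outside the center, the centralizers partition the group. If no centralizer were normal, the
  conjugates of a single one would cover at least half of the group and still not all noncentral
  elements, which leaves no room for the conjugates of a second one.\<close>

lemma cyclic_maximal_normal_exists:
  assumes fin: "finite (carrier G)" and nc: "\<not> is_cyclic (carrier G)"
    and min: "\<And>K. subgroup K G \<Longrightarrow> K \<noteq> carrier G \<Longrightarrow> is_cyclic K"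
  shows "\<exists>M. subgroup M G \<and> M \<noteq> carrier G \<and> (\<forall>g\<in>carrier G. \<forall>m\<in>M. conj_by g m \<in> M) \<and>
    (\<forall>K. subgroup K G \<longrightarrow> M \<subseteq> K \<longrightarrow> K = M \<or> K = carrier G)"
proof (cases "center = carrier G")
  \<comment> \<open>In the abelian case any proper subgroup of largest order is normal and
    maximal.\<close>
  case True
  let ?P = "\<lambda>M. subgroup M G \<and> M \<noteq> carrier G"
  have triv: "?P {\<one>}"
  proof
    show "subgroup {\<one>} G" by (rule triv_subgroup)
    show "{\<one>} \<noteq> carrier G"
    proof
      assume e: "{\<one>} = carrier G"
      have "is_cyclic {\<one>}" unfolding is_cyclic_def by (auto intro: range_eqI[of _ _ 0])
      then show False using nc e by simp
    qed
  qed
  have bnd: "\<forall>M. ?P M \<longrightarrow> card M < Suc (card (carrier G))"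
    using fin by (auto intro!: card_mono le_imp_less_Suc dest: subgroup.subset)
  obtain M where M: "?P M" and mx: "\<And>K. ?P K \<Longrightarrow> card K \<le> card M"
    using ex_has_greatest_nat[of ?P "{\<one>}" card "Suc (card (carrier G))"] triv bnd by blast
  have "conj_by g m = m" if "g \<in> carrier G" "m \<in> M" for g m
    using that M True by (intro conj_by_center) (auto dest: subgroup.mem_carrier)
  moreover have "K = M \<or> K = carrier G" if "subgroup K G" "M \<subseteq> K" for K
    using mx[of K] that fin by (metis card_seteq finite_subset subgroup.subset)
  ultimately show ?thesis using M by (intro exI[of _ M]) auto
next
  case False
  have zc: "center \<subseteq> carrier G" unfolding center_def by auto
  have finz: "finite center" using zc fin finite_subset by blast
  have Csub: "centralizer x \<subseteq> carrier G" for x unfolding centralizer_def by auto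
  have finC: "finite (centralizer x)" for x using Csub fin finite_subset by blast
  have Cne: "centralizer x \<noteq> carrier G" if "x \<in> carrier G - center" for x
  proof
    assume e: "centralizer x = carrier G"
    have "h \<otimes> x = x \<otimes> h" if "h \<in> carrier G" for h using that e[symmetric] unfolding centralizer_def by blast
    then show False using that unfolding center_def by auto
  qed
  have Ccom: "a \<otimes> b = b \<otimes> a" if "x \<in> carrier G - center" "a \<in> centralizer x" "b \<in> centralizer x" for a b x
    using is_cyclic_commute[OF min[OF centralizer_subgroup Cne]] that Csub by blast
  have xC: "x \<in> centralizer x" if "x \<in> carrier G" for x using that unfolding centralizer_def by simp
  have zC: "center \<subseteq> centralizer x" if "x \<in> carrier G" for x using that unfolding center_def centralizer_def by auto
  have Ceq: "centralizer y = centralizer x" if x: "x \<in> carrier G - center" and y: "y \<in> centralizer x" "y \<notin> center" for x y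
  proof -
    have yG: "y \<in> carrier G - center" using y Csub by blast
    have 1: "centralizer x \<subseteq> centralizer y" using Ccom[OF x _ y(1)] Csub unfolding centralizer_def by blast
    then have "x \<in> centralizer y" using xC x by blast
    then have "centralizer y \<subseteq> centralizer x" using Ccom[OF yG _ \<open>x \<in> centralizer y\<close>] Csub unfolding centralizer_def by blast
    then show ?thesis using 1 by blast
  qed
  have Cmax: "K = centralizer x \<or> K = carrier G" if x: "x \<in> carrier G - center" and K: "subgroup K G" "centralizer x \<subseteq> K" for K x
  proof (rule disjCI)
    assume "K \<noteq> carrier G"
    then have "is_cyclic K" using min K by blast
    then have "K \<subseteq> centralizer x" using is_cyclic_commute[of K _ x] K subgroup.subset[OF K(1)] xC x unfolding centralizer_def by blast
    then show "K = centralizer x" using K by blast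
  qed
  show ?thesis
  proof (rule ccontr)
    assume none: "\<not> ?thesis"
    \<comment> \<open>The normalizer \<open>Nn\<close> contains the centralizer, which is maximal
      but not normal; so the centralizer is its own normalizer.\<close>
    have selfn: "g \<in> centralizer x"
      if x: "x \<in> carrier G - center" and g: "g \<in> carrier G" "\<And>c. c \<in> centralizer x \<Longrightarrow> conj_by g c \<in> centralizer x" for x g
    proof -
      define Nn where "Nn = {g \<in> carrier G. \<forall>c\<in>centralizer x. conj_by g c \<in> centralizer x}"
      have "subgroup Nn G"
      proof (rule finite_closed_subgroup[OF fin])
        show "Nn \<subseteq> carrier G" unfolding Nn_def by auto
        show "\<one> \<in> Nn" unfolding Nn_def using Csub[of x] by (auto simp: subset_iff)
        fix a b assume "a \<in> Nn" "b \<in> Nn"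
        then show "a \<otimes> b \<in> Nn" unfolding Nn_def using Csub[of x] by (auto simp: conj_by_conj_by[symmetric] subset_iff)
      qed
      moreover have "centralizer x \<subseteq> Nn"
      proof
        fix h assume h: "h \<in> centralizer x"
        have "conj_by h c = c" if "c \<in> centralizer x" for c
          using Ccom[OF x that h] h that Csub[of x] by (intro conj_by_commute) (auto simp: centralizer_def)
        then show "h \<in> Nn" unfolding Nn_def using h Csub by auto
      qed
      ultimately have "Nn = centralizer x \<or> Nn = carrier G" using Cmax[OF x] by blast
      moreover have "Nn \<noteq> carrier G"
      proof
        assume "Nn = carrier G"
        then have "\<forall>g\<in>carrier G. \<forall>m\<in>centralizer x. conj_by g m \<in> centralizer x" unfolding Nn_def by blast
        then show False using none centralizer_subgroup[of x] Cne[OF x] Cmax[OF x] x by blast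
      qed
      ultimately show ?thesis using g unfolding Nn_def by blast
    qed
    define CC where "CC x = (\<lambda>(g, c). conj_by g c) ` (carrier G \<times> (centralizer x - center))" for x
    have Ccj: "centralizer (conj_by g c) = conj_by g ` centralizer c" if "g \<in> carrier G" "c \<in> carrier G" for g c
    proof (intro equalityI subsetI)
      fix y assume y: "y \<in> centralizer (conj_by g c)"
      have yc: "y \<in> carrier G" using y Csub by blast
      have "y = conj_by g (conj_by (inv g) y)" using conj_by_inv(2) that yc by simp
      moreover have "conj_by (inv g) y \<in> centralizer c"
        using conj_by_centralizer_iff[of g c "conj_by (inv g) y"] y that yc conj_by_inv(2)[of g y] by simp
      ultimately show "y \<in> conj_by g ` centralizer c" by blast
    next
      fix y assume "y \<in> conj_by g ` centralizer c"
      then show "y \<in> centralizer (conj_by g c)" using conj_by_centralizer_iff[OF that] Csub by blast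
    qed
    \<comment> \<open>Each conjugate arises from exactly \<open>card (centralizer x)\<close> pairs
      \<open>(g, c)\<close>: the possible \<open>g\<close> form a coset of the self-normalizing
      centralizer, and \<open>c\<close> is determined.\<close>
    have cnt: "card (CC x) * card (centralizer x) = card (carrier G) * (card (centralizer x) - card center)"
      if x: "x \<in> carrier G - center" for x
    proof -
      define A where "A = carrier G \<times> (centralizer x - center)"
      define \<phi> where "\<phi> = (\<lambda>(g, c). conj_by g c)"
      have finA: "finite A" unfolding A_def using fin finC by simp
      have cardA: "card A = card (carrier G) * (card (centralizer x) - card center)"
        unfolding A_def using card_Diff_subset[OF finz zC] x by (simp add: card_cartesian_product)
      have fib: "card {a \<in> A. \<phi> a = y} = card (centralizer x)" if y: "y \<in> \<phi> ` A" for y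
      proof -
        obtain g0 c0 where gc: "g0 \<in> carrier G" "c0 \<in> centralizer x" "c0 \<notin> center" "y = conj_by g0 c0"
          using y unfolding A_def \<phi>_def by auto
        have c0: "c0 \<in> carrier G" using gc Csub by blast
        have "{a \<in> A. \<phi> a = y} = (\<lambda>h. (g0 \<otimes> h, c0)) ` centralizer x"
        proof (intro equalityI subsetI)
          fix a assume a: "a \<in> {a \<in> A. \<phi> a = y}"
          obtain g c where gcc: "a = (g, c)" "g \<in> carrier G" "c \<in> centralizer x" "c \<notin> center" "conj_by g c = conj_by g0 c0"
            using a gc(4) unfolding A_def \<phi>_def by auto
          have cc: "c \<in> carrier G" using gcc Csub by blast
          define d where "d = inv g0 \<otimes> g"
          have dG: "d \<in> carrier G" unfolding d_def using gc gcc by simp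
          have dc: "conj_by d c = c0"
            unfolding d_def using gc gcc c0 cc conj_by_conj_by[of "inv g0" g c] conj_by_inv(1)[of g0 c0] by simp
          have "conj_by d ` centralizer x = centralizer x"
            using Ccj[OF dG cc] dc Ceq[OF x gcc(3,4)] Ceq[OF x gc(2,3)] by simp
          then have dx: "d \<in> centralizer x" using selfn[OF x dG] by blast
          then have "c = c0" using dc conj_by_commute[OF dG, of c] Ccom[OF x gcc(3) dx] cc unfolding centralizer_def by auto
          moreover have "g = g0 \<otimes> d" unfolding d_def using gc gcc by simp
          ultimately show "a \<in> (\<lambda>h. (g0 \<otimes> h, c0)) ` centralizer x" using gcc(1) dx by blast
        next
          fix a assume "a \<in> (\<lambda>h. (g0 \<otimes> h, c0)) ` centralizer x"
          then obtain h where h: "h \<in> centralizer x" "a = (g0 \<otimes> h, c0)" by blast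
          have hG: "h \<in> carrier G" using h Csub by blast
          have "conj_by h c0 = c0" using Ccom[OF x gc(2) h(1)] c0 by (intro conj_by_commute[OF hG]) (auto simp: centralizer_def)
          then have "conj_by (g0 \<otimes> h) c0 = y" using gc hG c0 by (simp add: conj_by_conj_by[symmetric])
          then show "a \<in> {a \<in> A. \<phi> a = y}" using h gc hG unfolding A_def \<phi>_def by auto
        qed
        moreover have "inj_on (\<lambda>h. (g0 \<otimes> h, c0)) (centralizer x)"
          using gc Csub[of x] by (intro inj_onI) (auto simp: subset_iff)
        ultimately show ?thesis by (simp add: card_image)
      qed
      have "card A = (\<Sum>y\<in>\<phi> ` A. card {a \<in> A. \<phi> a = y})"
        using sum.image_gen[OF finA, of "\<lambda>_. 1 :: nat" \<phi>] by simp
      also have "\<dots> = card (\<phi> ` A) * card (centralizer x)" using fib by simp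
      finally show ?thesis using cardA unfolding CC_def A_def \<phi>_def by simp
    qed
    have CCsub: "CC x \<subseteq> carrier G - center" for x
    proof
      fix w assume "w \<in> CC x"
      then obtain g c where gc: "g \<in> carrier G" "c \<in> centralizer x" "c \<notin> center" "w = conj_by g c" unfolding CC_def by auto
      have "c \<in> carrier G" using gc(2) Csub by blast
      then show "w \<in> carrier G - center" using conj_by_notin_center gc by simp
    qed
    \<comment> \<open>Translating the center by \<open>x\<close> stays in the centralizer and avoids
      the center.\<close>
    have Cbig: "2 * card center \<le> card (centralizer x)" if x: "x \<in> carrier G - center" for x
    proof -
      have "(\<lambda>z. x \<otimes> z) ` center \<subseteq> centralizer x - center"
      proof (rule image_subsetI)
        fix z assume z: "z \<in> center"
        have zG: "z \<in> carrier G" using z zc by blast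
        have "x \<otimes> z \<in> centralizer x" using xC zC x z by (intro subgroup.m_closed[OF centralizer_subgroup]) auto
        moreover have "x \<otimes> z \<notin> center"
        proof
          assume xz: "x \<otimes> z \<in> center"
          have "x \<otimes> h = h \<otimes> x" if h: "h \<in> carrier G" for h
          proof -
            have "x \<otimes> h \<otimes> z = x \<otimes> z \<otimes> h" using h x z zG unfolding center_def by (simp add: m_assoc)
            also have "\<dots> = h \<otimes> x \<otimes> z" using xz h x zG unfolding center_def by (simp add: m_assoc)
            finally show ?thesis using h x zG by simp
          qed
          then show False using x unfolding center_def by blast
        qed
        ultimately show "x \<otimes> z \<in> centralizer x - center" by blast
      qed
      moreover have "inj_on (\<lambda>z. x \<otimes> z) center" using x zc by (intro inj_onI) (auto simp: subset_iff)
      ultimately have "card center \<le> card (centralizer x - center)" using finC by (meson card_inj_on_le finite_Diff)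
      then show ?thesis using card_Diff_subset[OF finz zC, of x] x card_mono[OF finC zC, of x] by simp
    qed
    have half: "card (carrier G) \<le> 2 * card (CC x)" if x: "x \<in> carrier G - center" for x
    proof -
      define c where "c = card (centralizer x)"
      have c0: "c > 0" unfolding c_def using xC x finC by (metis DiffD1 card_gt_0_iff empty_iff)
      have "card (carrier G) * c \<le> card (carrier G) * (2 * (c - card center))"
        using Cbig[OF x] unfolding c_def by (intro mult_le_mono2) simp
      also have "\<dots> = 2 * card (CC x) * c" using cnt[OF x] unfolding c_def by simp
      finally show ?thesis using c0 by simp
    qed
    obtain x where x: "x \<in> carrier G - center" using False zc by blast
    \<comment> \<open>Equality would turn the count \<open>cnt\<close> into
      \<open>z * c = g * z\<close>, so the centralizer would be the whole group.\<close>
    have "CC x \<noteq> carrier G - center"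
    proof
      assume e: "CC x = carrier G - center"
      define c z g where "c = card (centralizer x)" and "z = card center" and "g = card (carrier G)"
      have "card (CC x) = g - z" unfolding e g_def z_def using zc finz by (simp add: card_Diff_subset)
      then have "(g - z) * c = g * (c - z)" using cnt[OF x] unfolding c_def z_def g_def by simp
      then have "g * c - z * c = g * c - g * z" by (simp add: algebra_simps diff_mult_distrib diff_mult_distrib2)
      moreover have "z \<le> g" "z \<le> c" unfolding z_def g_def c_def
        using card_mono[OF fin zc] card_mono[OF finC zC] x by auto
      then have "z * c \<le> g * c" "g * z \<le> g * c" by simp_all
      ultimately have zcg: "z * c = g * z" by linarith
      have "\<one> \<in> center" unfolding center_def by simp
      then have "z > 0" unfolding z_def using finz by (auto simp: card_gt_0_iff)
      then have "c = g" using zcg by (metis mult.commute mult_cancel1 less_irrefl)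
      then show False using Cne[OF x] card_subset_eq[OF fin Csub] unfolding c_def g_def by blast
    qed
    then obtain y where y: "y \<in> carrier G - center" "y \<notin> CC x" using CCsub by blast
    have "CC x \<inter> CC y = {}"
    proof (rule ccontr)
      assume "CC x \<inter> CC y \<noteq> {}"
      then obtain w where "w \<in> CC x" "w \<in> CC y" by blast
      then obtain g c g' c' where gc: "g \<in> carrier G" "c \<in> centralizer x" "c \<notin> center" "w = conj_by g c"
        and gc': "g' \<in> carrier G" "c' \<in> centralizer y" "c' \<notin> center" "w = conj_by g' c'"
        unfolding CC_def by auto
      have cc: "c \<in> carrier G" "c' \<in> carrier G" using gc gc' Csub by blast+
      have "conj_by g ` centralizer x = conj_by g' ` centralizer y"
        using Ccj[OF gc(1) cc(1)] Ccj[OF gc'(1) cc(2)] gc gc' Ceq[OF x gc(2,3)] Ceq[OF y(1) gc'(2,3)] by simp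
      then have "conj_by g' y \<in> conj_by g ` centralizer x" using xC y(1) by blast
      then obtain v where v: "v \<in> centralizer x" "conj_by g' y = conj_by g v" by blast
      have vG: "v \<in> carrier G" using v Csub by blast
      have yv: "y = conj_by (inv g' \<otimes> g) v"
        using conj_by_inv(1)[of g' y] v(2) gc gc' y(1) vG conj_by_conj_by[of "inv g'" g v] by simp
      have "v \<notin> center" using yv y(1) conj_by_center[of "inv g' \<otimes> g" v] gc gc' by auto
      then have "y \<in> CC x" unfolding CC_def using yv v(1) gc gc' by auto
      then show False using y(2) by simp
    qed
    then have "card (CC x) + card (CC y) = card (CC x \<union> CC y)"
      using CCsub fin by (intro card_Un_disjoint[symmetric]) (auto intro: finite_subset)
    also have "\<dots> \<le> card (carrier G - center)" using CCsub fin by (intro card_mono) auto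
    also have "\<dots> < card (carrier G)"
    proof (rule psubset_card_mono[OF fin])
      have "\<one> \<in> center" unfolding center_def by simp
      then show "carrier G - center \<subset> carrier G" using one_closed by blast
    qed
    finally show False using half[OF x] half[OF y(1)] by linarith
  qed
qed

section \<open>Words in two elements and elements of prime power order\<close>

lemma nat_pow_eq_iff:
  fixes i j :: nat
  assumes "x \<in> carrier G"
  shows "x [^] i = x [^] j \<longleftrightarrow> [i = j] (mod ord x)"
proof -
  have "x [^] i = x [^] j \<longleftrightarrow> int (ord x) dvd int j - int i"
    using int_pow_eq[OF assms, of "int i" "int j"] by (simp add: int_pow_int)
  also have "\<dots> \<longleftrightarrow> [i = j] (mod ord x)"
    by (metis cong_iff_dvd_diff cong_int_iff cong_sym)
  finally show ?thesis .
qed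

lemma subgroup_nat_pow: "subgroup H G \<Longrightarrow> x \<in> H \<Longrightarrow> x [^] (n::nat) \<in> H"
  by (induction n) (auto intro: subgroup.one_closed subgroup.m_closed)

definition pows :: "'a \<Rightarrow> 'a \<Rightarrow> 'a set" where
  "pows a b = range (\<lambda>(i::nat, t::nat). a [^] i \<otimes> b [^] t)"

lemma powsI: "a [^] (i::nat) \<otimes> b [^] (t::nat) \<in> pows a b"
  unfolding pows_def by (rule image_eqI[of _ _ "(i, t)"]) auto

lemma powsE:
  assumes "g \<in> pows a b" obtains i t :: nat where "g = a [^] i \<otimes> b [^] t"
  using assms unfolding pows_def by auto

lemma semicommuting_mult:
  fixes s i j t t' :: nat
  assumes c: "a \<in> carrier G" "b \<in> carrier G" and ba: "b \<otimes> a = a [^] s \<otimes> b"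
  shows "(a [^] i \<otimes> b [^] t) \<otimes> (a [^] j \<otimes> b [^] t') = a [^] (i + s ^ t * j) \<otimes> b [^] (t + t')"
proof -
  have "(a [^] i \<otimes> b [^] t) \<otimes> (a [^] j \<otimes> b [^] t') = a [^] i \<otimes> (b [^] t \<otimes> a [^] j) \<otimes> b [^] t'"
    using c by (simp add: m_assoc)
  also have "\<dots> = (a [^] i \<otimes> a [^] (s ^ t * j)) \<otimes> (b [^] t \<otimes> b [^] t')"
    unfolding semicommuting_pow[OF c ba] using c by (simp add: m_assoc)
  finally show ?thesis using c by (simp add: nat_pow_mult)
qed

lemma pows_subgroup:
  fixes s :: nat
  assumes fin: "finite (carrier G)" and c: "a \<in> carrier G" "b \<in> carrier G" and ba: "b \<otimes> a = a [^] s \<otimes> b"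
  shows "subgroup (pows a b) G"
proof (rule finite_closed_subgroup[OF fin])
  show "pows a b \<subseteq> carrier G" using c by (auto elim!: powsE)
  show "\<one> \<in> pows a b" using powsI[of a 0 b 0] by simp
  fix v w assume "v \<in> pows a b" "w \<in> pows a b"
  then show "v \<otimes> w \<in> pows a b" by (elim powsE) (simp add: semicommuting_mult[OF c ba] powsI)
qed

lemma mem_subgroup_of_coprime_pow:
  fixes i j :: nat
  assumes M: "subgroup M G" and h: "h \<in> carrier G" "h [^] i \<in> M" "h [^] j \<in> M" and co: "coprime i j"
    and j: "j > 1"
  shows "h \<in> M"
proof -
  obtain z where z: "[i * z = 1] (mod j)" using cong_solve_coprime_nat[OF co] by auto
  have "i * z mod j = 1" using z j unfolding cong_def by simp
  then obtain w where e: "i * z = 1 + j * w" by (metis mult_div_mod_eq add.commute)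
  have "(h [^] i) [^] z = h \<otimes> (h [^] j) [^] w"
    unfolding nat_pow_pow[OF h(1)] e nat_pow_mult[OF h(1), symmetric] using h(1) by simp
  then have "h = (h [^] i) [^] z \<otimes> inv ((h [^] j) [^] w)" using h(1) by (simp add: m_assoc)
  moreover have "(h [^] i) [^] z \<in> M" "(h [^] j) [^] w \<in> M" using subgroup_nat_pow[OF M] h by auto
  ultimately show ?thesis using M by (metis subgroup.m_closed subgroup.m_inv_closed)
qed

text \<open>Let \<open>i\<close> be the least positive exponent with \<open>g [^] i\<close> in
  \<open>M\<close> and \<open>r\<close> a prime factor of \<open>i\<close>; then
  \<open>h = g [^] (i / r)\<close> lies outside \<open>M\<close> and its \<open>r\<close>-th power
  inside. Raising \<open>h\<close> to the part of its order prime to \<open>r\<close> makes the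
  order a power of \<open>r\<close> and stays outside \<open>M\<close>.\<close>

lemma prime_power_order_outside:
  assumes fin: "finite (carrier G)" and M: "subgroup M G" and g: "g \<in> carrier G" "g \<notin> M"
  obtains n r k :: nat where "g [^] n \<notin> M" "prime r" "r dvd order G" "(g [^] n) [^] r \<in> M" "(g [^] n) [^] (r ^ k) = \<one>"
proof -
  let ?Q = "\<lambda>i::nat. 1 \<le> i \<and> g [^] i \<in> M"
  define i where "i = (LEAST i. ?Q i)"
  have Q0: "?Q (ord g)" using g ord_ge_1[OF fin] subgroup.one_closed[OF M] by simp
  have i: "?Q i" and il: "\<And>j. j < i \<Longrightarrow> \<not> ?Q j"
    unfolding i_def using LeastI[of ?Q, OF Q0] not_less_Least[of _ ?Q] by auto
  have "i \<noteq> 1" using i g by auto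
  then obtain r where r: "prime r" "r dvd i" using prime_factor_nat by blast
  then obtain i' where i': "i = i' * r" by (metis dvd_div_mult_self)
  have r2: "r \<ge> 2" using r prime_ge_2_nat by blast
  have "1 \<le> i'" "i' < i" using i i' r2 by (auto simp: Suc_le_eq)
  define h where "h = g [^] i'"
  have h: "h \<in> carrier G" "h \<notin> M" "h [^] r \<in> M"
    using il[OF \<open>i' < i\<close>] \<open>1 \<le> i'\<close> g i unfolding h_def i' by (auto simp: nat_pow_pow)
  have "ord h \<noteq> 0" using ord_ge_1[OF fin h(1)] by simp
  moreover have "\<not> is_unit r" using r2 by simp
  ultimately obtain N where N: "ord h = r ^ multiplicity r (ord h) * N" "\<not> r dvd N"
    by (rule multiplicity_decompose')
  define k where "k = multiplicity r (ord h)"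
  define b where "b = h [^] N"
  have co: "coprime N r" using N(2) r(1) by (metis coprime_commute prime_imp_coprime)
  have "b \<notin> M" using mem_subgroup_of_coprime_pow[OF M h(1) _ h(3) co] h(2) r2 unfolding b_def by auto
  moreover have bk: "b [^] (r ^ k) = \<one>"
    unfolding b_def k_def using h(1) N(1) by (simp add: nat_pow_pow mult.commute pow_eq_id)
  moreover have "b [^] r \<in> M"
  proof -
    have "b [^] r = (h [^] r) [^] N" unfolding b_def using h(1) by (simp add: nat_pow_pow mult.commute)
    then show ?thesis using subgroup_nat_pow[OF M h(3)] by simp
  qed
  moreover have "b \<in> carrier G" unfolding b_def using h by simp
  moreover have "r dvd order G"
  proof -
    have "k \<noteq> 0"
    proof
      assume "k = 0"
      then have "b = \<one>" using bk \<open>b \<in> carrier G\<close> by simp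
      then show False using \<open>b \<notin> M\<close> subgroup.one_closed[OF M] by simp
    qed
    then have "r dvd ord h" using N(1) unfolding k_def by (metis dvd_mult2 dvd_power gr0I)
    then show ?thesis using ord_dvd_group_order[OF h(1)] dvd_trans by blast
  qed
  ultimately show thesis using that[of "i' * N" r k] r(1) unfolding b_def h_def using g by (simp add: nat_pow_pow)
qed

text \<open>Let \<open>x\<close> generate the cyclic normal maximal subgroup \<open>M\<close> and let \<open>b \<notin> M\<close> have order a power of \<open>r\<close>,
  with \<open>b\<^sup>r \<in> M\<close>. If \<open>b\<close> centralizes all elements of prime order of \<open>M\<close>, it centralizes the part of \<open>M\<close> of
  order prime to \<open>r\<close>, and since \<open>1 + s + \<dots> + s\<^bsup>r-1\<^esup> \<equiv> r\<close> modulo \<open>r\<^sup>2\<close>, some product of \<open>b\<close> with an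
  element of \<open>M\<close> has order \<open>r\<close>; otherwise the whole group would be cyclic.\<close>

lemma minimal_noncyclic_cases:
  assumes fin: "finite (carrier G)" and odd: "odd (order G)" and nc: "\<not> is_cyclic (carrier G)"
    and min: "\<And>K. subgroup K G \<Longrightarrow> K \<noteq> carrier G \<Longrightarrow> is_cyclic K"
  shows "(\<exists>(l::nat) c d. prime l \<and> c \<in> carrier G \<and> d \<in> carrier G \<and> c \<otimes> d = d \<otimes> c \<and>
      c [^] l = \<one> \<and> d [^] l = \<one> \<and> c \<noteq> \<one> \<and> d \<notin> range (\<lambda>n::nat. c [^] n)) \<or>
    (\<exists>(q::nat) a b (s::nat). prime q \<and> a \<in> carrier G \<and> b \<in> carrier G \<and> a [^] q = \<one> \<and> a \<noteq> \<one> \<and>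
      b \<otimes> a = a [^] s \<otimes> b \<and> a [^] s \<noteq> a)"
proof -
  have "\<exists>M. subgroup M G \<and> M \<noteq> carrier G \<and> (\<forall>g\<in>carrier G. \<forall>m\<in>M. conj_by g m \<in> M) \<and>
    (\<forall>K. subgroup K G \<longrightarrow> M \<subseteq> K \<longrightarrow> K = M \<or> K = carrier G)"
    by (rule cyclic_maximal_normal_exists[OF fin nc]) (rule min)
  then obtain M where MM: "subgroup M G \<and> M \<noteq> carrier G \<and> (\<forall>g\<in>carrier G. \<forall>m\<in>M. conj_by g m \<in> M) \<and>
    (\<forall>K. subgroup K G \<longrightarrow> M \<subseteq> K \<longrightarrow> K = M \<or> K = carrier G)"
    by (elim exE)
  have M: "subgroup M G" "M \<noteq> carrier G" and nor: "\<And>g m. g \<in> carrier G \<Longrightarrow> m \<in> M \<Longrightarrow> conj_by g m \<in> M"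
    and mx: "\<And>K. subgroup K G \<Longrightarrow> M \<subseteq> K \<Longrightarrow> K = M \<or> K = carrier G"
    using MM by simp_all
  interpret M: subgroup M G by (rule M(1))
  obtain x where x: "x \<in> M" and Mx: "M \<subseteq> range (\<lambda>n::nat. x [^] n)" using min[OF M] unfolding is_cyclic_def by blast
  have xG: "x \<in> carrier G" using x by simp
  have xM: "x [^] n \<in> M" for n :: nat using subgroup_nat_pow[OF M(1) x] .
  define m where "m = ord x"
  have m0: "m > 0" unfolding m_def using ord_ge_1[OF fin xG] by simp
  have xeq: "x [^] i = x [^] j \<longleftrightarrow> [i = j] (mod m)" for i j :: nat
    unfolding m_def by (rule nat_pow_eq_iff[OF xG])
  have x1: "x [^] i = \<one> \<longleftrightarrow> m dvd i" for i :: nat unfolding m_def by (rule pow_eq_id[OF xG])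
  obtain g where g: "g \<in> carrier G" "g \<notin> M" using M subgroup.subset by blast
  obtain n r k :: nat where bM: "g [^] n \<notin> M" and r: "prime r" "r dvd order G"
    and brM': "(g [^] n) [^] r \<in> M" and bk': "(g [^] n) [^] (r ^ k) = \<one>"
    using prime_power_order_outside[OF fin M(1) g] .
  define b where "b = g [^] n"
  have b: "b \<in> carrier G" "b \<notin> M" and brM: "b [^] r \<in> M" and bk: "b [^] (r ^ k) = \<one>"
    using bM brM' bk' g unfolding b_def by auto
  have r_odd: "odd r" using r(2) odd dvd_trans by blast
  have r2: "r \<ge> 2" using r(1) prime_ge_2_nat by blast
  obtain s :: nat where s: "conj_by b x = x [^] s" using nor[OF b(1) x] Mx by blast
  have bx: "b \<otimes> x = x [^] s \<otimes> b" unfolding s[symmetric] conj_by_def using b xG by (simp add: m_assoc)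
  have bxn: "b \<otimes> x [^] n = x [^] (s * n) \<otimes> b" for n :: nat
    using semicommuting_pow[OF xG b(1) bx, of 1 n] b by simp
  show ?thesis
  proof (cases "\<exists>l. prime l \<and> l dvd m \<and> (x [^] (m div l)) [^] s \<noteq> x [^] (m div l)")
    case True
    then obtain l where l: "prime l" "l dvd m" and ne: "(x [^] (m div l)) [^] s \<noteq> x [^] (m div l)" by blast
    define a where "a = x [^] (m div l)"
    have "a [^] l = \<one>" unfolding a_def using xG l by (simp add: nat_pow_pow x1)
    moreover have "a \<noteq> \<one>"
    proof
      assume "a = \<one>"
      then have "m dvd m div l" unfolding a_def x1 .
      moreover have "0 < m div l" using l(2) m0 by (metis dvd_div_eq_0_iff gr0I less_irrefl)
      ultimately have "m \<le> m div l" using dvd_imp_le by blast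
      then show False using m0 prime_gt_1_nat[OF l(1)] by (meson div_less_dividend not_le)
    qed
    moreover have "b \<otimes> a = a [^] s \<otimes> b"
      unfolding a_def bxn using xG by (simp add: nat_pow_pow mult.commute)
    moreover have "a \<in> carrier G" unfolding a_def using xG by simp
    ultimately show ?thesis using l(1) b(1) ne unfolding a_def by blast
  next
    case False
    have fixl: "(x [^] (m div l)) [^] s = x [^] (m div l)" if "prime l" "l dvd m" for l using False that by blast
    have s1: "[s = 1] (mod l)" if l: "prime l" "l dvd m" for l
    proof -
      have m: "m = m div l * l" using l(2) by simp
      have "[m div l * s = m div l * 1] (mod m)"
        using fixl[OF l] xG by (simp add: nat_pow_pow xeq)
      then have "[m div l * s = m div l * 1] (mod (m div l * l))" using m by simp
      moreover have "m div l \<noteq> 0" using m m0 by (metis mult_eq_0_iff less_irrefl)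
      ultimately show ?thesis by (simp add: cong_def mult_mod_right[symmetric])
    qed
    have "m \<noteq> 0" "\<not> is_unit r" using m0 r2 by auto
    then obtain m' where m': "m = r ^ multiplicity r m * m'" "\<not> r dvd m'" by (rule multiplicity_decompose')
    define j where "j = multiplicity r m"
    have mj: "m = r ^ j * m'" unfolding j_def by (rule m'(1))
    have m'0: "m' > 0" using mj m0 by simp
    have cor: "coprime (r ^ n) m'" for n using r(1) m'(2) by (simp add: prime_imp_coprime)
    \<comment> \<open>Generators of the parts of \<open>M\<close> of orders \<open>r ^ j\<close> and
      \<open>m'\<close>.\<close>
    define y u where "y = x [^] m'" and "u = x [^] (r ^ j)"
    have yG: "y \<in> carrier G" and uG: "u \<in> carrier G" unfolding y_def u_def using xG by auto
    have y1: "y [^] n = \<one>" if "r ^ j dvd n" for n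
      unfolding y_def using xG that mj by (simp add: nat_pow_pow x1 mult.commute)
    have yM: "y [^] n \<in> M" for n :: nat unfolding y_def using xM subgroup_nat_pow[OF M(1)] by blast
    have sm': "[s = 1] (mod m')"
    proof (rule cong_1_of_power_cong_1[OF m'0, of _ "r ^ k"])
      have "x [^] (1::nat) = x [^] (s ^ (r ^ k))"
        using semicommuting_pow[OF xG b(1) bx, of "r ^ k" 1] bk xG by simp
      then have "[s ^ (r ^ k) = 1] (mod m)" using xeq cong_sym by blast
      then show "[s ^ (r ^ k) = 1] (mod m')" using mj by (metis cong_modulus_mult_nat mult.commute)
      fix l assume l: "prime l" "l dvd m'"
      have "l dvd m" using l mj by simp
      moreover have "\<not> l dvd r ^ k"
        using l r(1) m'(2) by (metis prime_dvd_power primes_dvd_imp_eq)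
      ultimately show "[s = 1] (mod l) \<and> \<not> l dvd r ^ k" using s1[OF l(1)] by blast
    qed
    have bu: "b \<otimes> u = u \<otimes> b"
    proof -
      have "[s * r ^ j = 1 * r ^ j] (mod m)" unfolding mj using sm'
        by (simp add: cong_def mult.commute mult_mod_right[symmetric])
      then have "x [^] (s * r ^ j) = u" unfolding u_def xeq by simp
      then show ?thesis using bxn[of "r ^ j"] unfolding u_def by simp
    qed
    obtain f :: nat where f: "b [^] r = x [^] f" using brM Mx by blast
    have "x [^] (f * r ^ k) = (b [^] r) [^] (r ^ k)" unfolding f using xG by (simp add: nat_pow_pow)
    also have "\<dots> = (b [^] (r ^ k)) [^] r" using b(1) by (simp add: nat_pow_pow mult.commute)
    finally have "m dvd f * r ^ k" unfolding x1[symmetric] bk by simp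
    then have "m' dvd f * r ^ k" using mj by (metis dvd_mult_right)
    then have "m' dvd f" using cor[of k] by (metis coprime_commute coprime_dvd_mult_left_iff)
    then obtain e where e: "f = m' * e" by blast
    have bre: "b [^] r = y [^] e" unfolding f e y_def using xG by (simp add: nat_pow_pow)
    \<comment> \<open>If \<open>y\<close> were a power of \<open>b\<close>, then \<open>u\<close>
      and \<open>b\<close> would generate a subgroup containing \<open>x\<close> and
      \<open>b\<close>, hence everything. But \<open>u\<close> and \<open>b\<close> commute and have
      coprime orders, so the group would be cyclic.\<close>
    have noty: False if yb: "y \<in> range (\<lambda>n::nat. b [^] n)"
    proof -
      obtain t :: nat where t: "y = b [^] t" using yb by blast
      define K where "K = pows u b"
      have ub: "u [^] i \<otimes> b [^] n \<in> K" for i n :: nat unfolding K_def by (rule powsI)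
      have KG: "subgroup K G" unfolding K_def using bu uG by (intro pows_subgroup[OF fin uG b(1), of 1]) simp
      obtain \<alpha> where al: "[r ^ j * \<alpha> = 1] (mod m')" using cong_solve_coprime_nat[OF cor[of j]] by auto
      obtain \<beta> where be: "[m' * \<beta> = 1] (mod r ^ j)"
        using cong_solve_coprime_nat[of m' "r ^ j"] cor[of j] by (auto simp: coprime_commute)
      have "[r ^ j * \<alpha> + m' * \<beta> = 0 + 1] (mod r ^ j)" using be by (intro cong_add) (simp_all add: cong_0_iff)
      moreover have "[r ^ j * \<alpha> + m' * \<beta> = 1 + 0] (mod m')" using al by (intro cong_add) (simp_all add: cong_0_iff)
      ultimately have "[r ^ j * \<alpha> + m' * \<beta> = 1] (mod m)"
        unfolding mj using coprime_cong_mult_nat cor[of j] by (metis add.right_neutral add_0)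
      then have "x [^] (r ^ j * \<alpha> + m' * \<beta>) = x [^] (1::nat)" by (simp only: xeq)
      then have "x = u [^] \<alpha> \<otimes> y [^] \<beta>" unfolding u_def y_def using xG by (simp add: nat_pow_pow nat_pow_mult)
      then have "x = u [^] \<alpha> \<otimes> b [^] (t * \<beta>)" unfolding t using b by (simp add: nat_pow_pow)
      then have "x \<in> K" using ub by metis
      then have "M \<subseteq> K" using Mx subgroup_nat_pow[OF KG] by blast
      moreover have "b \<in> K" using ub[of 0 1] b by simp
      ultimately have KK: "K = carrier G" using mx[OF KG] b(2) by blast
      have "ord u dvd m'" using pow_eq_id[OF uG, of m'] xG mj unfolding u_def by (simp add: nat_pow_pow x1)
      moreover have "ord b dvd r ^ k" using bk b(1) by (simp add: pow_eq_id)
      ultimately have "coprime (ord u) (ord b)" using cor[of k] by (metis coprime_commute coprime_divisors)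
      then have "u [^] i \<otimes> b [^] n \<in> range (\<lambda>n::nat. (u \<otimes> b) [^] n)" for i n :: nat
        using commuting_coprime_cyclic[OF uG b(1) bu[symmetric]] by blast
      then have "K \<subseteq> range (\<lambda>n::nat. (u \<otimes> b) [^] n)" unfolding K_def by (auto elim!: powsE)
      then have "is_cyclic (carrier G)" unfolding is_cyclic_def KK using uG b by blast
      then show False using nc by simp
    qed
    \<comment> \<open>Otherwise \<open>e\<close> is invertible modulo the order of \<open>y\<close>,
      and \<open>y\<close> would be a power of \<open>b [^] r = y [^] e\<close>.\<close>
    have "r dvd e"
    proof (rule ccontr)
      assume "\<not> r dvd e"
      then have "coprime e (r ^ j)" using r(1) by (metis coprime_commute coprime_power_right_iff prime_imp_coprime)
      then obtain z where z: "[e * z = 1] (mod r ^ j)" using cong_solve_coprime_nat by fastforce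
      have "ord y dvd r ^ j" using y1[of "r ^ j"] pow_eq_id[OF yG] by simp
      then have "y [^] (e * z) = y [^] (1::nat)" using z nat_pow_eq_iff[OF yG] cong_dvd_modulus_nat by blast
      then have "b [^] (r * z) = y" using bre yG b by (simp add: nat_pow_pow[symmetric])
      then show False using noty by blast
    qed
    then obtain e' where e': "e = r * e'" by blast
    have "j \<noteq> 0"
    proof
      assume "j = 0"
      then have "y = \<one>" using y1[of 1] yG by simp
      then have "y = b [^] (0::nat)" by simp
      then show False using noty by blast
    qed
    then have rm: "r dvd m" unfolding mj by simp
    define \<sigma> where "\<sigma> = (\<Sum>i<r. s ^ i)"
    have sig: "[\<sigma> = r] (mod r * r)"
      using geometric_sum_cong_prime_square[OF r_odd s1[OF r(1) rm]] unfolding \<sigma>_def power2_eq_square .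
    then have "r dvd \<sigma>" by (meson cong_dvd_iff cong_modulus_mult_nat dvd_refl)
    then obtain \<tau> where tau: "\<sigma> = r * \<tau>" by blast
    have "[r * \<tau> = r * 1] (mod r * r)" using sig unfolding tau by simp
    then have "[\<tau> = 1] (mod r)" using r2 by (simp add: cong_def mult_mod_right[symmetric])
    then have "\<not> r dvd \<tau>" using r2 cong_dvd_iff[of \<tau> 1 r] by auto
    then have "coprime \<tau> (r ^ j)" using r(1) by (metis coprime_commute coprime_power_right_iff prime_imp_coprime)
    then obtain z where z: "[\<tau> * z = 1] (mod r ^ j)" using cong_solve_coprime_nat by fastforce
    \<comment> \<open>Solves \<open>\<kappa> * \<tau> + e' = 0\<close> modulo \<open>r ^ j\<close>,
      with \<open>r ^ j - 1\<close> in the role of -1, so that the \<open>r\<close>-th power of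
      \<open>y [^] \<kappa> \<otimes> b\<close> becomes trivial.\<close>
    define \<kappa> where "\<kappa> = z * (e' * (r ^ j - 1))"
    have "r ^ j dvd \<kappa> * \<tau> + e'"
    proof -
      have "[\<tau> * z * (e' * (r ^ j - 1)) + e' = 1 * (e' * (r ^ j - 1)) + e'] (mod r ^ j)"
        using z by (intro cong_add cong_mult cong_refl)
      moreover have "1 * (e' * (r ^ j - 1)) + e' = e' * r ^ j"
        using r2 by (simp add: diff_mult_distrib2)
      ultimately have "[\<kappa> * \<tau> + e' = e' * r ^ j] (mod r ^ j)" unfolding \<kappa>_def by (simp add: ac_simps)
      then show ?thesis by (simp add: cong_dvd_iff)
    qed
    then have dv: "r ^ j dvd r * (\<kappa> * \<tau> + e')" by simp
    define c where "c = y [^] \<kappa> \<otimes> b"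
    have cG: "c \<in> carrier G" unfolding c_def using yG b by simp
    have by': "b \<otimes> y = y [^] s \<otimes> b" unfolding y_def bxn using xG by (simp add: nat_pow_pow mult.commute)
    have "c [^] r = y [^] (\<kappa> * \<sigma>) \<otimes> y [^] e"
      unfolding c_def \<sigma>_def bre[symmetric] by (rule semicommuting_mult_pow[OF yG b(1) by'])
    also have "\<dots> = y [^] (r * (\<kappa> * \<tau> + e'))" using yG unfolding tau e' by (simp add: nat_pow_mult algebra_simps)
    also have "\<dots> = \<one>" by (rule y1[OF dv])
    finally have cr: "c [^] r = \<one>" .
    have cM: "c \<notin> M"
    proof
      assume "c \<in> M"
      then have "inv (y [^] \<kappa>) \<otimes> c \<in> M" using yM by blast
      then show False using b(2) unfolding c_def using yG b(1) by simp
    qed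
    define a where "a = x [^] (m div r)"
    have aG: "a \<in> carrier G" unfolding a_def using xG by simp
    have ar: "a [^] r = \<one>" unfolding a_def using xG rm by (simp add: nat_pow_pow x1)
    have a1: "a \<noteq> \<one>"
    proof
      assume "a = \<one>"
      then have "m dvd m div r" unfolding a_def x1 .
      moreover have "0 < m div r" using rm m0 by (metis dvd_div_eq_0_iff gr0I less_irrefl)
      ultimately have "m \<le> m div r" using dvd_imp_le by blast
      then show False using m0 r2 by (meson div_less_dividend not_le one_less_numeral_iff semiring_norm(76) less_le_trans)
    qed
    have ba: "b \<otimes> a = a \<otimes> b"
      using bxn[of "m div r"] fixl[OF r(1) rm] xG unfolding a_def by (simp add: nat_pow_pow mult.commute)
    have ya: "y [^] \<kappa> \<otimes> a = a \<otimes> y [^] \<kappa>"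
      unfolding a_def y_def using xG by (simp add: nat_pow_pow nat_pow_mult add.commute)
    have "a \<otimes> c = (y [^] \<kappa> \<otimes> a) \<otimes> b" unfolding c_def ya using aG yG b by (simp add: m_assoc)
    also have "\<dots> = y [^] \<kappa> \<otimes> (b \<otimes> a)" unfolding ba using aG yG b by (simp add: m_assoc)
    also have "\<dots> = c \<otimes> a" unfolding c_def using aG yG b by (simp add: m_assoc)
    finally have ac: "a \<otimes> c = c \<otimes> a" .
    have "c \<notin> range (\<lambda>n::nat. a [^] n)"
      using cM xM subgroup_nat_pow[OF M(1)] unfolding a_def by blast
    then show ?thesis using r(1) aG cG ac ar cr a1 by blast
  qed
qed

end

section \<open>Bounds for minimal product-one sequences\<close>

text \<open>If \<open>r\<close> were coprime to \<open>q - 1\<close>, a Bezout combination of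
  \<open>s ^ r = 1\<close> with Fermat's theorem would give \<open>s = 1\<close> modulo
  \<open>q\<close>.\<close>

lemma prime_dvd_pred_of_pow_cong_1:
  fixes s r q :: nat
  assumes q: "prime q" and r: "prime r" and s: "[s ^ r = 1] (mod q)" "\<not> [s = 1] (mod q)"
  shows "r dvd q - 1"
proof (rule ccontr)
  assume "\<not> r dvd q - 1"
  then have "coprime (q - 1) r" using r by (metis coprime_commute prime_imp_coprime)
  moreover have "r \<noteq> 1" using r by auto
  ultimately obtain x y where xy: "(q - 1) * x = r * y + 1" using coprime_bezout_strong by blast
  have "\<not> q dvd s"
  proof
    assume "q dvd s"
    then have "q dvd s ^ r" using r by (simp add: prime_gt_0_nat dvd_power_same dvd_trans dvd_power)
    then have "q dvd 1" using s(1) cong_dvd_iff by blast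
    then show False using q by auto
  qed
  then have "[s ^ (q - 1) = 1] (mod q)" using fermat_theorem q by blast
  then have "[(s ^ (q - 1)) ^ x = 1 ^ x] (mod q)" by (rule cong_pow)
  moreover have "(s ^ (q - 1)) ^ x = (s ^ r) ^ y * s" by (metis xy power_mult power_add power_one_right)
  moreover have "[(s ^ r) ^ y * s = 1 ^ y * s] (mod q)" using s(1) by (intro cong_mult cong_pow cong_refl)
  ultimately have "[s = 1] (mod q)" by (metis cong_sym cong_trans mult_1 power_one)
  then show False using s(2) by simp
qed

context group
begin

lemma card_pows_ge:
  fixes s m n :: nat
  assumes fin: "finite (carrier G)" and c: "a \<in> carrier G" "b \<in> carrier G" and ba: "b \<otimes> a = a [^] s \<otimes> b"
    and m: "a [^] m = \<one>" "m > 0" and n: "b [^] n = \<one>" "n > 0"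
    and triv: "\<And>i t :: nat. a [^] i \<otimes> b [^] t = \<one> \<Longrightarrow> m dvd i \<and> n dvd t"
  shows "m * n \<le> card (pows a b)"
proof -
  \<comment> \<open>With natural exponents, \<open>(e - 1) * i'\<close> stands for
    \<open>- i'\<close> modulo \<open>e\<close>.\<close>
  have key: "i = i'"
    if d: "e dvd i + (e - 1) * i'" and lt: "i < e" "i' < e" for i i' e :: nat
  proof -
    obtain e' where e': "e = Suc e'" using lt(1) by (cases e) auto
    have e2: "i + (e - 1) * i' + i' = i + e * i'" unfolding e' by simp
    have "[i + (e - 1) * i' + i' = i] (mod e)" unfolding e2 cong_def by (rule mod_mult_self2)
    moreover have "[i + (e - 1) * i' + i' = 0 + i'] (mod e)" using d by (intro cong_add cong_refl) (simp add: cong_0_iff)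
    ultimately have "[i = i'] (mod e)" by (metis add_0 cong_sym cong_trans)
    then show ?thesis using lt by (simp add: cong_def)
  qed
  have "inj_on (\<lambda>(i, t). a [^] i \<otimes> b [^] t) ({..<m} \<times> {..<n})"
  proof (rule inj_onI, clarify)
    fix i t i' t' :: nat
    assume lt: "i < m" "t < n" "i' < m" "t' < n" and eq: "a [^] i \<otimes> b [^] t = a [^] i' \<otimes> b [^] t'"
    have "a [^] (i + (m - 1) * i') \<otimes> b [^] (t + (n - 1) * t')
        = a [^] ((m - 1) * i') \<otimes> (a [^] i \<otimes> b [^] t) \<otimes> b [^] ((n - 1) * t')"
      using c by (simp add: nat_pow_mult[symmetric] m_assoc[symmetric]) (simp add: nat_pow_mult add.commute)
    also have "\<dots> = (a [^] ((m - 1) * i') \<otimes> a [^] i') \<otimes> (b [^] t' \<otimes> b [^] ((n - 1) * t'))"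
      unfolding eq using c by (simp add: m_assoc)
    also have "\<dots> = (a [^] m) [^] i' \<otimes> (b [^] n) [^] t'"
    proof -
      have "(m - 1) * i' + i' = m * i'" "t' + (n - 1) * t' = n * t'"
        using m(2) n(2) by (cases m; cases n; simp)+
      then show ?thesis using c by (simp add: nat_pow_mult nat_pow_pow)
    qed
    finally have "a [^] (i + (m - 1) * i') \<otimes> b [^] (t + (n - 1) * t') = \<one>" unfolding m(1) n(1) by simp
    then show "i = i' \<and> t = t'" using triv key lt by blast
  qed
  moreover have "(\<lambda>(i, t). a [^] i \<otimes> b [^] t) ` ({..<m} \<times> {..<n}) \<subseteq> pows a b"
    using powsI by auto
  moreover have "finite (pows a b)"
    using fin subgroup.subset[OF pows_subgroup[OF fin c ba]] finite_subset by blast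
  ultimately have "card ({..<m} \<times> {..<n}) \<le> card (pows a b)" by (rule card_inj_on_le)
  then show ?thesis by (simp add: card_cartesian_product)
qed

lemma minimal_product_one_bound_rank_two:
  fixes l :: nat
  assumes fin: "finite (carrier G)" and l: "prime l" and c: "c \<in> carrier G" "d \<in> carrier G" "c \<otimes> d = d \<otimes> c"
    and cl: "c [^] l = \<one>" "d [^] l = \<one>" "c \<noteq> \<one>" and d: "d \<notin> range (\<lambda>n::nat. c [^] n)"
    and S: "minimal_product_one G S"
  shows "size S * l \<le> 2 * order G"
proof -
  have l2: "l \<ge> 2" using l prime_ge_2_nat by blast
  have dc: "d \<otimes> c = c [^] (1::nat) \<otimes> d" using c by simp
  have "ord c dvd l" using cl(1) pow_eq_id[OF c(1)] by simp
  then have "ord c = l" using l ord_eq_1[OF c(1)] cl(3) by (metis prime_nat_iff)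
  then have c1: "c [^] i = \<one> \<longleftrightarrow> l dvd i" for i :: nat using pow_eq_id[OF c(1)] by simp
  have triv: "l dvd i \<and> l dvd t" if e: "c [^] i \<otimes> d [^] t = \<one>" for i t :: nat
  proof -
    \<comment> \<open>Otherwise a power of the relation \<open>e\<close> expresses \<open>d\<close>
      as a power of \<open>c\<close>.\<close>
    have "l dvd t"
    proof (rule ccontr)
      assume "\<not> l dvd t"
      then have "coprime t l" using l by (metis coprime_commute prime_imp_coprime)
      moreover have "l \<noteq> 1" using l2 by simp
      ultimately obtain x y where xy: "t * x = l * y + 1" using coprime_bezout_strong by blast
      have "(c [^] i \<otimes> d [^] t) [^] x = (c [^] i) [^] x \<otimes> (d [^] t) [^] x"
      proof (rule pow_mult_distrib)
        show "c [^] i \<otimes> d [^] t = d [^] t \<otimes> c [^] i"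
          using semicommuting_pow[OF c(1,2) dc, of t i] by simp
      qed (use c in auto)
      also have "(d [^] t) [^] x = d"
        unfolding nat_pow_pow[OF c(2)] xy using c(2) cl(2)
        by (simp add: nat_pow_mult[symmetric] nat_pow_pow[symmetric])
      also have "(c [^] i) [^] x = c [^] (i * x)" using c(1) by (simp add: nat_pow_pow)
      finally have e1: "c [^] (i * x) \<otimes> d = \<one>" unfolding e by simp
      have "c [^] ((l - 1) * (i * x)) \<otimes> c [^] (i * x) = \<one>"
      proof -
        have "(l - 1) * (i * x) + i * x = l * (i * x)" using l2 by (cases l) auto
        then show ?thesis using c1 c(1) by (simp add: nat_pow_mult)
      qed
      then have "d = c [^] ((l - 1) * (i * x)) \<otimes> c [^] (i * x) \<otimes> d" using c(2) by simp
      also have "\<dots> = c [^] ((l - 1) * (i * x))" using e1 c by (simp add: m_assoc)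
      finally show False using d by blast
    qed
    moreover from this have "d [^] t = \<one>" using cl(2) c(2) by (metis dvdE nat_pow_one nat_pow_pow)
    ultimately show ?thesis using e c c1 by simp
  qed
  have bound: "size S \<le> 2 * l" if SH: "set_mset S \<subseteq> pows c d" and S: "minimal_product_one G S" for S
  proof (rule ccontr)
    assume big: "\<not> size S \<le> 2 * l"
    obtain xs where xs: "mset xs = S" "gprod xs = \<one>"
      using S unfolding minimal_product_one_def product_one_def by auto
    define n where "n = length xs"
    have nl: "2 * l < n" using big xs(1) unfolding n_def by auto
    have "\<forall>i\<in>{..<n}. \<exists>e :: nat \<times> nat. xs ! i = c [^] fst e \<otimes> d [^] snd e"
    proof
      fix i assume "i \<in> {..<n}"
      then have "xs ! i \<in> pows c d" using SH xs(1) unfolding n_def by auto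
      then obtain j t :: nat where "xs ! i = c [^] j \<otimes> d [^] t" by (rule powsE)
      then show "\<exists>e :: nat \<times> nat. xs ! i = c [^] fst e \<otimes> d [^] snd e" by (intro exI[of _ "(j, t)"]) simp
    qed
    from bchoice[OF this] obtain e :: "nat \<Rightarrow> nat \<times> nat" where e: "\<forall>i\<in>{..<n}. xs ! i = c [^] fst (e i) \<otimes> d [^] snd (e i)"
      by (elim exE)
    define \<alpha> \<beta> where "\<alpha> = (\<lambda>i. fst (e i))" and "\<beta> = (\<lambda>i. snd (e i))"
    have ab: "xs ! i = c [^] \<alpha> i \<otimes> d [^] \<beta> i" if "i < n" for i using e that unfolding \<alpha>_def \<beta>_def by simp
    define \<phi> where "\<phi> = (\<lambda>i. c [^] \<alpha> i \<otimes> d [^] \<beta> i)"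
    have phiG: "\<phi> i \<in> carrier G" for i unfolding \<phi>_def using c by simp
    have gp: "gprod (map \<phi> is) = c [^] sum_list (map \<alpha> is) \<otimes> d [^] sum_list (map \<beta> is)" for "is"
    proof (induction "is")
      case (Cons i "is")
      then show ?case using semicommuting_mult[OF c(1,2) dc, of "\<alpha> i" "\<beta> i"] unfolding \<phi>_def by simp
    qed simp
    have set_prod: "gprod (map \<phi> (sorted_list_of_set I)) = c [^] (\<Sum>i\<in>I. \<alpha> i) \<otimes> d [^] (\<Sum>i\<in>I. \<beta> i)"
      if "finite I" for I
      unfolding gp using that by (simp add: sum_list_distinct_conv_sum_set)
    have xs_map: "xs = map \<phi> (sorted_list_of_set {..<n})"
      unfolding \<phi>_def using ab by (intro nth_equalityI) (auto simp: n_def lessThan_atLeast0)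
    have ms: "mset (sorted_list_of_set I) = mset_set I" for I :: "nat set"
      by (metis mset_sorted_list_of_multiset sorted_list_of_mset_set)
    have one_of: "product_one G (image_mset \<phi> (mset_set I))"
      if "finite I" "l dvd (\<Sum>i\<in>I. \<alpha> i)" "l dvd (\<Sum>i\<in>I. \<beta> i)" for I
    proof -
      have "c [^] (\<Sum>i\<in>I. \<alpha> i) = \<one>" using that c1 by simp
      moreover have "d [^] (\<Sum>i\<in>I. \<beta> i) = \<one>" using that(3) cl(2) c(2) by (metis dvdE nat_pow_one nat_pow_pow)
      ultimately have "gprod (map \<phi> (sorted_list_of_set I)) = \<one>" using set_prod[OF that(1)] by simp
      then have "product_one G (mset (map \<phi> (sorted_list_of_set I)))" using phiG by (intro product_oneI) auto
      then show ?thesis by (simp add: ms)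
    qed
    have tot: "l dvd (\<Sum>i<n. \<alpha> i)" "l dvd (\<Sum>i<n. \<beta> i)"
      using triv set_prod[of "{..<n}"] xs(2) xs_map by auto
    \<comment> \<open>Restricting the zero sum to the first \<open>2 * l - 1\<close> of more than
      \<open>2 * l\<close> terms keeps its complement nonempty.\<close>
    have "2 * l - 1 \<le> card {..<2 * l - 1}" by simp
    then obtain I where I: "I \<subseteq> {..<2 * l - 1}" "I \<noteq> {}"
      "int l dvd (\<Sum>i\<in>I. int (\<alpha> i))" "int l dvd (\<Sum>i\<in>I. int (\<beta> i))"
      using zero_sum_pair_exists[OF l finite_lessThan, of "2 * l - 1" "\<lambda>i. int (\<alpha> i)" "\<lambda>i. int (\<beta> i)"] by auto
    have finI: "finite I" using I(1) finite_subset by blast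
    have In: "I \<subseteq> {..<n}" using I(1) nl by auto
    have dI: "l dvd (\<Sum>i\<in>I. \<alpha> i)" "l dvd (\<Sum>i\<in>I. \<beta> i)"
      using I(3,4) by (simp_all add: of_nat_sum[symmetric] del: of_nat_sum)
    define J where "J = {..<n} - I"
    have finJ: "finite J" unfolding J_def by simp
    have "(\<Sum>i<n. f i) = (\<Sum>i\<in>J. f i) + (\<Sum>i\<in>I. f i)" for f :: "nat \<Rightarrow> nat"
      unfolding J_def using sum.subset_diff[OF In] by simp
    then have dJ: "l dvd (\<Sum>i\<in>J. \<alpha> i)" "l dvd (\<Sum>i\<in>J. \<beta> i)"
      using tot dI by (metis dvd_add_left_iff)+
    have "2 * l \<in> J" unfolding J_def using nl I(1) by auto
    then have Jne: "J \<noteq> {}" by blast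
    have "mset_set {..<n} = mset_set I + mset_set J"
    proof -
      have "mset_set (I \<union> J) = mset_set I + mset_set J" using finI finJ unfolding J_def by (intro mset_set_Union) auto
      moreover have "I \<union> J = {..<n}" unfolding J_def using In by blast
      ultimately show ?thesis by simp
    qed
    moreover have "S = image_mset \<phi> (mset_set {..<n})" unfolding xs(1)[symmetric] by (subst xs_map) (simp add: ms)
    ultimately have "S = image_mset \<phi> (mset_set I) + image_mset \<phi> (mset_set J)" by simp
    moreover have "image_mset \<phi> (mset_set I) \<noteq> {#}" "image_mset \<phi> (mset_set J) \<noteq> {#}"
      using finI finJ I(2) Jne by (simp_all add: mset_set_empty_iff)
    ultimately show False
      using S one_of[OF finI dI] one_of[OF finJ dJ] unfolding minimal_product_one_def by blast
  qed
  have "size S * (l * l) \<le> size S * card (pows c d)"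
    using card_pows_ge[OF fin c(1,2) dc cl(1) _ cl(2) _ triv] l2 by (intro mult_le_mono2) auto
  also have "\<dots> \<le> 2 * l * order G"
    by (rule minimal_product_one_index_bound[OF fin pows_subgroup[OF fin c(1,2) dc] bound S])
  finally have "l * (size S * l) \<le> l * (2 * order G)" by (simp add: ac_simps)
  then show ?thesis using l2 by simp
qed

text \<open>By the relation between \<open>a\<close> and \<open>b\<close>, words
  \<open>a [^] i \<otimes> b [^] t\<close> multiply like the affine maps \<open>(i, t)\<close>,
  except that exponents of \<open>b\<close> count modulo \<open>r ^ Suc k\<close> instead of
  \<open>r\<close>. So a splitting found by \<open>splits_prime_power\<close> carries over to the
  group.\<close>

lemma minimal_product_one_bound_metacyclic:
  fixes q s r k :: nat
  assumes fin: "finite (carrier G)" and q: "prime q" and r: "prime r" "odd r"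
    and c: "a \<in> carrier G" "b \<in> carrier G" and ba: "b \<otimes> a = a [^] s \<otimes> b"
    and oa: "ord a = q" and ob: "ord b = r ^ Suc k"
    and s: "[s ^ r = 1] (mod q)" "\<not> [s = 1] (mod q)"
    and S: "minimal_product_one G S"
  shows "size S * r \<le> 2 * order G"
proof -
  have rq: "r dvd q - 1" by (rule prime_dvd_pred_of_pow_cong_1[OF q r(1) s])
  have s': "[int s ^ r = 1] (mod int q)" "\<not> [int s = 1] (mod int q)"
    using s by (metis cong_int_iff of_nat_1 of_nat_power)+
  interpret A: affine_model r q "int s"
    by unfold_locales (use q r rq s' in auto)
  have q0: "q > 0" "r > 0" using q r prime_gt_0_nat by auto
  have a1: "a [^] i = \<one> \<longleftrightarrow> q dvd i" for i :: nat using pow_eq_id[OF c(1)] oa by simp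
  have b1: "b [^] i = \<one> \<longleftrightarrow> r ^ Suc k dvd i" for i :: nat using pow_eq_id[OF c(2)] ob by simp
  have "r \<noteq> q" using A.q_ge A.p_ge_3 by auto
  then have co: "coprime (r ^ Suc k) q" using q r primes_coprime by (metis coprime_power_left_iff)
  \<comment> \<open>The orders of \<open>a\<close> and \<open>b\<close> are coprime, so their powers
    meet only in the identity.\<close>
  have triv: "q dvd i \<and> r ^ Suc k dvd t" if e: "a [^] i \<otimes> b [^] t = \<one>" for i t :: nat
  proof -
    have "a [^] i = inv (b [^] t)" using e c by (metis inv_equality nat_pow_closed)
    then have bt: "b [^] t = inv (a [^] i)" using c by simp
    have "b [^] (t * q) = (inv (a [^] i)) [^] q" unfolding bt[symmetric] using c(2) by (simp add: nat_pow_pow)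
    also have "\<dots> = inv (a [^] (i * q))" using c(1) by (simp add: nat_pow_inv nat_pow_pow)
    also have "\<dots> = \<one>" using a1[of "i * q"] by simp
    finally have "r ^ Suc k dvd t * q" using b1 by blast
    then have "r ^ Suc k dvd t" using co by (metis coprime_dvd_mult_left_iff)
    moreover from this have "b [^] t = \<one>" using b1 by blast
    ultimately show ?thesis using e c a1 by simp
  qed
  \<comment> \<open>\<open>nat\<close> sends negative integers to 0, hence the sign conditions on
    the first components below.\<close>
  define \<psi> where "\<psi> = (\<lambda>(z::int, t::nat). a [^] nat z \<otimes> b [^] t)"
  have psiG: "\<psi> g \<in> carrier G" for g unfolding \<psi>_def using c by (cases g) simp
  have psi_prod: "A.val zs \<ge> 0 \<and> gprod (map \<psi> zs) = a [^] nat (A.val zs) \<otimes> b [^] A.deg zs"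
    if "\<forall>g\<in>set zs. fst g \<ge> 0" for zs using that
  proof (induction zs)
    case (Cons g zs)
    obtain z t where g: "g = (z, t)" by (cases g)
    have z0: "z \<ge> 0" and IH: "A.val zs \<ge> 0" "gprod (map \<psi> zs) = a [^] nat (A.val zs) \<otimes> b [^] A.deg zs"
      using Cons g by auto
    have "gprod (map \<psi> (g # zs)) = (a [^] nat z \<otimes> b [^] t) \<otimes> gprod (map \<psi> zs)"
      unfolding g by (simp add: \<psi>_def)
    also have "\<dots> = a [^] (nat z + s ^ t * nat (A.val zs)) \<otimes> b [^] (t + A.deg zs)"
      unfolding IH(2) by (rule semicommuting_mult[OF c ba])
    finally have "gprod (map \<psi> (g # zs)) = a [^] (nat z + s ^ t * nat (A.val zs)) \<otimes> b [^] (t + A.deg zs)" .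
    moreover have "nat (A.val (g # zs)) = nat z + s ^ t * nat (A.val zs)"
      using z0 IH(1) unfolding g by (simp add: nat_add_distrib nat_mult_distrib nat_power_eq)
    moreover have "A.val (g # zs) \<ge> 0" using z0 IH(1) unfolding g by simp
    ultimately show ?case unfolding g by simp
  qed simp
  have one_of: "product_one G (image_mset \<psi> T)"
    if nn: "\<forall>g\<in>#T. fst g \<ge> 0" and dT: "r ^ Suc k dvd A.dg T" and vT: "\<exists>v\<in>A.vals T. int q dvd v" for T
  proof -
    obtain v where v: "v \<in> A.vals T" "int q dvd v" using vT by blast
    obtain zs where zs: "mset zs = T" "v = A.val zs" using v(1) by (rule A.valsE)
    have "\<forall>g\<in>set zs. fst g \<ge> 0" using nn zs(1) by auto
    note pp = psi_prod[OF this]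
    have "int q dvd int (nat (A.val zs))" using v(2) zs(2) pp by simp
    then have "a [^] nat (A.val zs) = \<one>" by (simp only: int_dvd_int_iff a1)
    moreover have "b [^] A.deg zs = \<one>" using dT unfolding b1 zs(1)[symmetric] A.dg_mset .
    ultimately have "gprod (map \<psi> zs) = \<one>" using pp by simp
    then have "product_one G (mset (map \<psi> zs))" using psiG by (intro product_oneI) auto
    then show ?thesis using zs(1) by simp
  qed
  have bound: "size S \<le> 2 * q * r ^ k" if SH: "set_mset S \<subseteq> pows a b" and S: "minimal_product_one G S" for S
  proof (rule ccontr)
    assume big: "\<not> size S \<le> 2 * q * r ^ k"
    obtain xs where xs: "mset xs = S" "gprod xs = \<one>"
      using S unfolding minimal_product_one_def product_one_def by auto
    have "\<forall>h. \<exists>g. h \<in> pows a b \<longrightarrow> fst g \<ge> 0 \<and> \<psi> g = h"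
    proof
      fix h
      show "\<exists>g. h \<in> pows a b \<longrightarrow> fst g \<ge> 0 \<and> \<psi> g = h"
      proof (cases "h \<in> pows a b")
        case True
        then obtain i t :: nat where "h = a [^] i \<otimes> b [^] t" by (rule powsE)
        then have "fst (int i, t) \<ge> 0 \<and> \<psi> (int i, t) = h" unfolding \<psi>_def by simp
        then show ?thesis by blast
      qed simp
    qed
    then obtain rep where rep: "\<And>h. h \<in> pows a b \<Longrightarrow> fst (rep h) \<ge> 0 \<and> \<psi> (rep h) = h" by metis
    define zs where "zs = map rep xs"
    have xH: "set xs \<subseteq> pows a b" using SH xs(1) by auto
    have nn: "\<forall>g\<in>set zs. fst g \<ge> 0" unfolding zs_def using rep xH by auto
    have mz: "map \<psi> zs = xs" unfolding zs_def map_map by (rule map_idI) (use rep xH in auto)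
    have "q dvd nat (A.val zs) \<and> r ^ Suc k dvd A.deg zs"
      using psi_prod[OF nn] xs(2) unfolding mz by (intro triv) simp
    then have "int q dvd int (nat (A.val zs))" "r ^ Suc k dvd A.dg (mset zs)"
      by (simp_all only: int_dvd_int_iff A.dg_mset)
    then have dz: "int q dvd A.val zs" "r ^ Suc k dvd A.dg (mset zs)" using psi_prod[OF nn] by simp_all
    have "size (mset zs) = size S" unfolding zs_def using xs(1) by auto
    then have "2 * q * r ^ k < size (mset zs)" using big by simp
    moreover have "\<exists>v\<in>A.vals (mset zs). int q dvd v" using dz(1) A.valsI[of zs] by blast
    ultimately obtain T U where TU: "mset zs = T + U" "T \<noteq> {#}" "U \<noteq> {#}"
      "r ^ Suc k dvd A.dg T" "r ^ Suc k dvd A.dg U"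
      "\<exists>v\<in>A.vals T. int q dvd v" "\<exists>v\<in>A.vals U. int q dvd v"
      using A.splits_prime_power[OF dz(2)] by blast
    have nz: "\<forall>g\<in>#T + U. fst g \<ge> 0" using nn unfolding TU(1)[symmetric] by simp
    have "S = image_mset \<psi> (mset zs)" using mz xs(1) by (metis mset_map)
    then have "S = image_mset \<psi> T + image_mset \<psi> U" unfolding TU(1) by simp
    moreover have "product_one G (image_mset \<psi> T)" "product_one G (image_mset \<psi> U)"
      using nz TU by (auto intro!: one_of)
    moreover have "image_mset \<psi> T \<noteq> {#}" "image_mset \<psi> U \<noteq> {#}" using TU by simp_all
    ultimately show False using S unfolding minimal_product_one_def by blast
  qed
  have "size S * (q * r ^ Suc k) \<le> size S * card (pows a b)"
    using card_pows_ge[OF fin c ba, of q "r ^ Suc k"] a1 b1 triv q0 by (intro mult_le_mono2) auto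
  also have "\<dots> \<le> 2 * q * r ^ k * order G"
    by (rule minimal_product_one_index_bound[OF fin pows_subgroup[OF fin c ba] bound S])
  finally have "(q * r ^ k) * (size S * r) \<le> (q * r ^ k) * (2 * order G)" by (simp add: ac_simps)
  then show ?thesis using q0 by simp
qed

text \<open>Some power of \<open>b\<close> lies outside the centralizer of \<open>a\<close> while
  its \<open>r\<close>-th power lies inside, so it acts on the powers of \<open>a\<close> with order
  exactly \<open>r\<close>. Its own order is a power of \<open>r\<close>, as the metacyclic bound
  requires.\<close>

lemma minimal_product_one_bound_noncommuting:
  fixes q s :: nat
  assumes fin: "finite (carrier G)" and odd: "odd (order G)" and q: "prime q"
    and c: "a \<in> carrier G" "b \<in> carrier G" and aq: "a [^] q = \<one>" "a \<noteq> \<one>"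
    and ba: "b \<otimes> a = a [^] s \<otimes> b" and as: "a [^] s \<noteq> a"
    and S: "minimal_product_one G S"
  obtains r where "prime r" "r dvd order G" "size S * r \<le> 2 * order G"
proof -
  have "ord a dvd q" using aq(1) pow_eq_id[OF c(1)] by simp
  then have oa: "ord a = q" using q ord_eq_1[OF c(1)] aq(2) by (metis prime_nat_iff)
  have pc: "b [^] t \<otimes> a = a [^] (s ^ t) \<otimes> b [^] t" for t :: nat
    using semicommuting_pow[OF c ba, of t 1] c by simp
  have cen: "b [^] t \<in> centralizer a \<longleftrightarrow> [s ^ t = 1] (mod q)" for t :: nat
  proof -
    have "b [^] t \<in> centralizer a \<longleftrightarrow> a [^] (s ^ t) \<otimes> b [^] t = a \<otimes> b [^] t"
      unfolding centralizer_def pc[symmetric] using c by simp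
    also have "\<dots> \<longleftrightarrow> a [^] (s ^ t) = a [^] (1::nat)" using c by simp
    finally show ?thesis unfolding nat_pow_eq_iff[OF c(1)] oa .
  qed
  have "b \<notin> centralizer a"
  proof
    assume "b \<in> centralizer a"
    then have "[s = 1] (mod q)" using cen[of 1] c by simp
    then have "a [^] s = a [^] (1::nat)" unfolding nat_pow_eq_iff[OF c(1)] oa .
    then show False using as c by simp
  qed
  then obtain n r k :: nat where b: "b [^] n \<notin> centralizer a" and r: "prime r" "r dvd order G"
    and br: "(b [^] n) [^] r \<in> centralizer a" and bk: "(b [^] n) [^] (r ^ k) = \<one>"
    using prime_power_order_outside[OF fin centralizer_subgroup[OF c(1)] c(2)] by metis
  have bn: "b [^] n \<in> carrier G" using c by simp
  have r_odd: "odd r" using r(2) odd dvd_trans by blast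
  have "ord (b [^] n) dvd r ^ k" using bk pow_eq_id[OF bn] by simp
  then obtain K where K: "ord (b [^] n) = r ^ K" using divides_primepow_nat[OF r(1)] by blast
  have "K \<noteq> 0"
  proof
    assume "K = 0"
    then have "b [^] n = \<one>" using K ord_eq_1[OF bn] by simp
    then show False using b subgroup.one_closed[OF centralizer_subgroup[OF c(1)]] by simp
  qed
  then obtain k' where k': "K = Suc k'" by (cases K) auto
  have "[(s ^ n) ^ r = 1] (mod q)" using br cen[of "n * r"] c by (simp add: nat_pow_pow power_mult)
  moreover have "\<not> [s ^ n = 1] (mod q)" using b cen by simp
  ultimately have "size S * r \<le> 2 * order G"
    using minimal_product_one_bound_metacyclic[OF fin q r(1) r_odd c(1) bn pc oa K[unfolded k'] _ _ S] by blast
  then show thesis using that r by blast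
qed

lemma is_cyclic_imp_cyclic_group:
  assumes "is_cyclic (carrier G)"
  shows "cyclic_group G"
proof -
  obtain x where x: "x \<in> carrier G" "carrier G \<subseteq> range (\<lambda>n::nat. x [^] n)" using assms unfolding is_cyclic_def by blast
  have "carrier G \<subseteq> range (\<lambda>n::int. x [^] n)" using x(2) by (metis (mono_tags) image_subset_iff int_pow_int rangeE rangeI subsetD subsetI)
  moreover have "range (\<lambda>n::int. x [^] n) \<subseteq> carrier G" using x(1) by auto
  ultimately show ?thesis unfolding cyclic_group using x(1) by blast
qed

lemma minimal_product_one_bound_odd:
  assumes fin: "finite (carrier G)" and odd: "odd (order G)" and nc: "\<not> cyclic_group G"
    and S: "minimal_product_one G S"
  obtains r where "prime r" "r dvd order G" "size S * r \<le> 2 * order G"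
proof -
  let ?P = "\<lambda>H. subgroup H G \<and> \<not> is_cyclic H"
  have "?P (carrier G)" using nc is_cyclic_imp_cyclic_group subgroup_self by blast
  \<comment> \<open>A noncyclic subgroup of least order has only cyclic proper subgroups.\<close>
  then obtain H where H: "subgroup H G" "\<not> is_cyclic H" and least: "\<And>K. ?P K \<Longrightarrow> card H \<le> card K"
    using ex_has_least_nat[of ?P "carrier G" card] by blast
  interpret H: subgroup H G by (rule H(1))
  let ?H = "G\<lparr>carrier := H\<rparr>"
  interpret GH: group ?H by (rule subgroup_imp_group[OF H(1)])
  have finH: "finite H" using fin H.subset finite_subset by blast
  have pw: "x [^]\<^bsub>?H\<^esub> n = x [^] n" for x and n :: nat using nat_pow_consistent by metis
  have cycH: "GH.is_cyclic K = is_cyclic K" for K unfolding GH.is_cyclic_def is_cyclic_def pw ..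
  have cases: "(\<exists>(l::nat) c d. prime l \<and> c \<in> H \<and> d \<in> H \<and> c \<otimes> d = d \<otimes> c \<and>
      c [^] l = \<one> \<and> d [^] l = \<one> \<and> c \<noteq> \<one> \<and> d \<notin> range (\<lambda>n::nat. c [^] n)) \<or>
    (\<exists>(q::nat) a b (s::nat). prime q \<and> a \<in> H \<and> b \<in> H \<and> a [^] q = \<one> \<and> a \<noteq> \<one> \<and>
      b \<otimes> a = a [^] s \<otimes> b \<and> a [^] s \<noteq> a)"
  proof -
    have "card H dvd order G" using lagrange[OF H(1)] by (metis dvd_triv_right)
    then have odH: "odd (order ?H)" using odd dvd_trans unfolding order_def by auto
    have least': "GH.is_cyclic K" if K: "subgroup K ?H" "K \<noteq> carrier ?H" for K
    proof -
      have "K \<subset> H" using subgroup.subset[OF K(1)] K(2) by auto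
      then have "card K < card H" using finH psubset_card_mono by blast
      then show ?thesis unfolding cycH using least[of K] incl_subgroup[OF H(1) K(1)] by fastforce
    qed
    have "finite (carrier ?H)" "\<not> GH.is_cyclic (carrier ?H)" unfolding cycH using finH H(2) by simp_all
    from GH.minimal_noncyclic_cases[OF this(1) odH this(2) least'] show ?thesis
      unfolding pw by simp
  qed
  then show thesis
  proof
    assume "\<exists>(l::nat) c d. prime l \<and> c \<in> H \<and> d \<in> H \<and> c \<otimes> d = d \<otimes> c \<and>
      c [^] l = \<one> \<and> d [^] l = \<one> \<and> c \<noteq> \<one> \<and> d \<notin> range (\<lambda>n::nat. c [^] n)"
    then obtain l :: nat and c d where l: "prime l" "c \<in> H" "d \<in> H" "c \<otimes> d = d \<otimes> c"
      "c [^] l = \<one>" "d [^] l = \<one>" "c \<noteq> \<one>" "d \<notin> range (\<lambda>n::nat. c [^] n)" by blast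
    have cG: "c \<in> carrier G" "d \<in> carrier G" using l by auto
    have "ord c dvd l" using l(5) pow_eq_id[OF cG(1)] by simp
    then have "ord c = l" using l(1) ord_eq_1[OF cG(1)] l(7) by (metis prime_nat_iff)
    then have "l dvd order G" using ord_dvd_group_order[OF cG(1)] by simp
    then show thesis
      using that[OF l(1)] minimal_product_one_bound_rank_two[OF fin l(1) cG l(4-8) S] by blast
  next
    assume "\<exists>(q::nat) a b (s::nat). prime q \<and> a \<in> H \<and> b \<in> H \<and> a [^] q = \<one> \<and> a \<noteq> \<one> \<and>
      b \<otimes> a = a [^] s \<otimes> b \<and> a [^] s \<noteq> a"
    then obtain q s :: nat and a b where q: "prime q" "a \<in> H" "b \<in> H" "a [^] q = \<one>" "a \<noteq> \<one>"
      "b \<otimes> a = a [^] s \<otimes> b" "a [^] s \<noteq> a" by blast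
    have aG: "a \<in> carrier G" "b \<in> carrier G" using q by auto
    show thesis
      using minimal_product_one_bound_noncommuting[OF fin odd q(1) aG q(4-7) S] that by blast
  qed
qed

end

theorem theorem7p1:
  fixes G :: "('a, 'b) monoid_scheme" and p :: nat
  assumes "group G" and "finite (carrier G)" and "\<not> cyclic_group G"
    and "prime p" and "p dvd order G"
    and "\<And>q::nat. prime q \<Longrightarrow> q dvd order G \<Longrightarrow> p \<le> q"
  shows "real (large_davenport G) \<le> 2 / real p * real (order G)"
proof -
  interpret group G by (rule assms(1))
  note sizes = minimal_product_one_sizes[OF assms(2)]
  have "large_davenport G \<in> {size S | S. minimal_product_one G S}"
    unfolding large_davenport_def by (rule Max_in[OF sizes])
  then obtain S where S: "minimal_product_one G S" "large_davenport G = size S" by blast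
  have p0: "p > 0" using assms(4) prime_gt_0_nat by blast
  have "size S * p \<le> 2 * order G"
  proof (cases "even (order G)")
    case True
    then have "p \<le> 2" using assms(6)[of 2] by simp
    then have "size S * p \<le> order G * 2"
      using minimal_product_one_size_le[OF assms(2) S(1)] by (intro mult_le_mono)
    then show ?thesis by simp
  next
    case False
    then obtain r where r: "prime r" "r dvd order G" "size S * r \<le> 2 * order G"
      using minimal_product_one_bound_odd[OF assms(2) _ assms(3) S(1)] by blast
    have "size S * p \<le> size S * r" using assms(6)[OF r(1,2)] by simp
    then show ?thesis using r(3) by (rule le_trans)
  qed
  then have "real (size S * p) \<le> real (2 * order G)" by (simp only: of_nat_le_iff)
  then have "real (size S) * real p \<le> 2 * real (order G)" by simp
  then show ?thesis unfolding S(2) using p0 by (simp add: field_simps)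
qed

end
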